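(* Let $A$ be the first-order ($N=1$) port-Hamiltonian operator with domain $\operatorname{dom}(A)$ described in the context, and assume that $A$ generates a contraction semigroup $(T(t))_{t\ge0}$ on $X$. Assume that $\sup_{\omega\in\mathbb R}\|\Psi_{i\omega}\|<\infty$, where $\|\Psi_{i\omega}\|=\sup_{\zeta\in(a,b)}\|\Psi_{i\omega}(\zeta)\|$. Then the following conditions are equivalent: (i) $(T(t))_{t\ge0}$ is exponentially stable; (ii) for all sequences $(\omega_k)_{k\in\mathbb N}$ in $\mathbb R$, the set $$\Big\{v_a\in\mathbb C^n\ \Big|\ \liminf_{k\to\infty}\Big(\|\mathcal Q(i\omega_k)v_a\|+\Big|v_a^*\begin{bmatrix}\Psi_{i\omega_k}(b)^*&I_n\end{bmatrix}\begin{bmatrix}Q&0\\ 0&-Q\end{bmatrix}\begin{bmatrix}\Psi_{i\omega_k}(b)\\ I_n\end{bmatrix}v_a\Big|\Big)=0\Big\}$$ contains only the zero element; (iii) for all sequences $(\omega_k)_{k\in\mathbb N}$ in $\mathbb R$, the set $$\big\{v_a\in\mathbb C^n\ \big|\ \liminf_{k\to\infty}\|\mathcal Q(i\omega_k)v_a\|=0\big\}$$ contains only the zero element.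
   Context: Let $a<b$ be real, $n\ge1$, and $P_0,P_1\in\mathbb C^{n\times n}$ with $P_0^*=-P_0$, $P_1^*=P_1$ and $P_1$ invertible. Let $\mathcal H\colon(a,b)\to\mathbb C^{n\times n}$ be measurable and uniformly bounded, with $\mathcal H(\zeta)^*=\mathcal H(\zeta)$ and $\mathcal H(\zeta)\ge mI$ for almost every $\zeta$, for some constant $m>0$. Let $X=L_{2,\mathcal H}((a,b);\mathbb C^n)$, i.e. $L_2((a,b);\mathbb C^n)$ as a set with inner product $\langle f,g\rangle_{\mathcal H}=\frac12\int_a^b g(\zeta)^*\mathcal H(\zeta)f(\zeta)\,d\zeta$. Let $W_B$ be a complex $n\times 2n$ matrix of full rank. The operator $A$ is $Ax=P_1\frac{d}{d\zeta}(\mathcal Hx)+P_0\mathcal Hx$ with $$\operatorname{dom}(A)=\Big\{x\in X\ \Big|\ \mathcal Hx\in H^1((a,b);\mathbb C^n),\ W_B\begin{bmatrix}(\mathcal Hx)(b)\\ (\mathcal Hx)(a)\end{bmatrix}=0\Big\}.$$ For $\lambda\in\mathbb C$, $\Psi_\lambda\colon[a,b]\to\mathbb C^{n\times n}$ denotes the fundamental solution, i.e. the unique (continuous, $H^1$) matrix function with $\Psi_\lambda'(\zeta)=\big(\lambda P_1^{-1}\mathcal H(\zeta)^{-1}-P_1^{-1}P_0\big)\Psi_\lambda(\zeta)$ for a.e. $\zeta\in(a,b)$ and $\Psi_\lambda(a)=I_n$. Further, $\mathcal Q(i\omega):=W_B\begin{bmatrix}\Psi_{i\omega}(b)\\ I_n\end{bmatrix}$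 for $\omega\in\mathbb R$, and $Q:=P_1$. The semigroup is exponentially stable if there are $M\ge1$, $\alpha>0$ with $\|T(t)\|\le Me^{-\alpha t}$ for all $t\ge0$. *)

theory Defs
  imports "HOL-Analysis.Analysis"
begin

section \<open>Complex vectors and block matrices\<close>

text \<open>\<open>cdot v w\<close> is \<open>v\<^sup>* w\<close>, conjugate-linear in the first argument.\<close>

definition cdot :: "complex^'n \<Rightarrow> complex^'n \<Rightarrow> complex" where
  "cdot v w = (\<Sum>i\<in>UNIV. cnj (v $ i) * w $ i)"

definition ctranspose :: "complex^'n^'m \<Rightarrow> complex^'m^'n" where
  "ctranspose A = (\<chi> i j. cnj (A $ j $ i))"

text \<open>
  \<open>vstack\<close> puts its first argument on top of the second one. It applies to vectors (entries in a
  field) as well as to matrices (entries are rows).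
\<close>

definition vstack :: "'e^'n \<Rightarrow> 'e^'m \<Rightarrow> 'e^('n + 'm)" where
  "vstack u v = (\<chi> i. case i of Inl j \<Rightarrow> u $ j | Inr j \<Rightarrow> v $ j)"

definition hstack :: "'e^'n^'r \<Rightarrow> 'e^'m^'r \<Rightarrow> 'e^('n + 'm)^'r" where
  "hstack A B = (\<chi> i. vstack (A $ i) (B $ i))"

section \<open>Function spaces on an interval\<close>

text \<open>
  Elements of $L_2$ are represented by functions; two functions represent the same element
  iff they agree almost everywhere on \<open>(a,b)\<close>. All notions below that refer to elements of $L_2$
  are invariant under changing representatives. Values outside \<open>(a,b)\<close> play no role.
\<close>

definition L2 :: "real \<Rightarrow> real \<Rightarrow> (real \<Rightarrow> 'v::{banach, second_countable_topology}) set" where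
  "L2 a b = {f \<in> borel_measurable (lebesgue_on {a<..<b}).
               integrable (lebesgue_on {a<..<b}) (\<lambda>\<zeta>. (norm (f \<zeta>))\<^sup>2)}"

definition ae_eq :: "real \<Rightarrow> real \<Rightarrow> (real \<Rightarrow> 'v) \<Rightarrow> (real \<Rightarrow> 'v) \<Rightarrow> bool" where
  "ae_eq a b f g \<longleftrightarrow> (AE \<zeta> in lebesgue_on {a<..<b}. f \<zeta> = g \<zeta>)"

text \<open>\<open>\<phi>\<close> is a $C^1$ test function with compact support in \<open>(a,b)\<close>, and \<open>\<phi>'\<close> is its derivative.\<close>

definition test_function :: "real \<Rightarrow> real \<Rightarrow> (real \<Rightarrow> real) \<Rightarrow> (real \<Rightarrow> real) \<Rightarrow> bool" where
  "test_function a b \<phi> \<phi>' \<longleftrightarrow>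
     (\<forall>\<zeta>. (\<phi> has_real_derivative \<phi>' \<zeta>) (at \<zeta>)) \<and> continuous_on UNIV \<phi>' \<and>
     (\<exists>K. compact K \<and> K \<subseteq> {a<..<b} \<and> (\<forall>\<zeta>. \<zeta> \<notin> K \<longrightarrow> \<phi> \<zeta> = 0))"

text \<open>
  \<open>has_H1_deriv a b u v\<close>: \<open>u\<close> belongs to the Sobolev space $H^1(a,b)$ and its weak derivative is \<open>v\<close>.
\<close>

definition has_H1_deriv ::
  "real \<Rightarrow> real \<Rightarrow> (real \<Rightarrow> 'v::{banach, second_countable_topology}) \<Rightarrow> (real \<Rightarrow> 'v) \<Rightarrow> bool" where
  "has_H1_deriv a b u v \<longleftrightarrow> u \<in> L2 a b \<and> v \<in> L2 a b \<and>
     (\<forall>\<phi> \<phi>'. test_function a b \<phi> \<phi>' \<longrightarrow>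
        (LINT \<zeta>|lebesgue_on {a<..<b}. \<phi>' \<zeta> *\<^sub>R u \<zeta>) =
        - (LINT \<zeta>|lebesgue_on {a<..<b}. \<phi> \<zeta> *\<^sub>R v \<zeta>))"

definition H1 :: "real \<Rightarrow> real \<Rightarrow> (real \<Rightarrow> 'v::{banach, second_countable_topology}) set" where
  "H1 a b = {u. \<exists>v. has_H1_deriv a b u v}"

section \<open>The energy space\<close>

definition innerH ::
  "real \<Rightarrow> real \<Rightarrow> (real \<Rightarrow> complex^'n^'n) \<Rightarrow> (real \<Rightarrow> complex^'n) \<Rightarrow> (real \<Rightarrow> complex^'n) \<Rightarrow> complex" where
  "innerH a b H f g = 1/2 * (LINT \<zeta>|lebesgue_on {a<..<b}. cdot (g \<zeta>) (H \<zeta> *v f \<zeta>))"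

definition normH ::
  "real \<Rightarrow> real \<Rightarrow> (real \<Rightarrow> complex^'n^'n) \<Rightarrow> (real \<Rightarrow> complex^'n) \<Rightarrow> real" where
  "normH a b H f = sqrt (Re (innerH a b H f f))"

text \<open>For \<open>c \<ge> 0\<close>: the operator norm of \<open>S\<close> on the energy space is at most \<open>c\<close>.\<close>

definition opnorm_le ::
  "real \<Rightarrow> real \<Rightarrow> (real \<Rightarrow> complex^'n^'n) \<Rightarrow> ((real \<Rightarrow> complex^'n) \<Rightarrow> (real \<Rightarrow> complex^'n)) \<Rightarrow> real \<Rightarrow> bool" where
  "opnorm_le a b H S c \<longleftrightarrow> (\<forall>f\<in>L2 a b. normH a b H (S f) \<le> c * normH a b H f)"

text \<open>
  Linearity is required up to null sets; together with boundedness it implies that \<open>S\<close> maps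
  almost everywhere equal functions to almost everywhere equal functions, so that \<open>S\<close> induces a
  bounded linear operator on equivalence classes.
\<close>

definition bounded_operator ::
  "real \<Rightarrow> real \<Rightarrow> (real \<Rightarrow> complex^'n^'n) \<Rightarrow> ((real \<Rightarrow> complex^'n) \<Rightarrow> (real \<Rightarrow> complex^'n)) \<Rightarrow> bool" where
  "bounded_operator a b H S \<longleftrightarrow>
     (\<forall>f\<in>L2 a b. S f \<in> L2 a b) \<and>
     (\<forall>f\<in>L2 a b. \<forall>g\<in>L2 a b. \<forall>c d :: complex.
        ae_eq a b (S (\<lambda>\<zeta>. c *s f \<zeta> + d *s g \<zeta>)) (\<lambda>\<zeta>. c *s S f \<zeta> + d *s S g \<zeta>)) \<and>
     (\<exists>c\<ge>0. opnorm_le a b H S c)"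

section \<open>Semigroups\<close>

definition C0_semigroup ::
  "real \<Rightarrow> real \<Rightarrow> (real \<Rightarrow> complex^'n^'n) \<Rightarrow>
   (real \<Rightarrow> (real \<Rightarrow> complex^'n) \<Rightarrow> (real \<Rightarrow> complex^'n)) \<Rightarrow> bool" where
  "C0_semigroup a b H T \<longleftrightarrow>
     (\<forall>t\<ge>0. bounded_operator a b H (T t)) \<and>
     (\<forall>f\<in>L2 a b. ae_eq a b (T 0 f) f) \<and>
     (\<forall>s\<ge>0. \<forall>t\<ge>0. \<forall>f\<in>L2 a b. ae_eq a b (T (s + t) f) (T s (T t f))) \<and>
     (\<forall>f\<in>L2 a b. ((\<lambda>t. normH a b H (\<lambda>\<zeta>. T t f \<zeta> - f \<zeta>)) \<longlongrightarrow> 0) (at_right 0))"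

definition contraction_semigroup ::
  "real \<Rightarrow> real \<Rightarrow> (real \<Rightarrow> complex^'n^'n) \<Rightarrow>
   (real \<Rightarrow> (real \<Rightarrow> complex^'n) \<Rightarrow> (real \<Rightarrow> complex^'n)) \<Rightarrow> bool" where
  "contraction_semigroup a b H T \<longleftrightarrow>
     C0_semigroup a b H T \<and> (\<forall>t\<ge>0. opnorm_le a b H (T t) 1)"

text \<open>Unbounded operators are given by their graphs, which are saturated under a.e. equality.\<close>

definition generator ::
  "real \<Rightarrow> real \<Rightarrow> (real \<Rightarrow> complex^'n^'n) \<Rightarrow>
   (real \<Rightarrow> (real \<Rightarrow> complex^'n) \<Rightarrow> (real \<Rightarrow> complex^'n)) \<Rightarrow>
   ((real \<Rightarrow> complex^'n) \<times> (real \<Rightarrow> complex^'n)) set" where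
  "generator a b H T = {(x, y). x \<in> L2 a b \<and> y \<in> L2 a b \<and>
     ((\<lambda>t. normH a b H (\<lambda>\<zeta>. (1 / t) *\<^sub>R (T t x \<zeta> - x \<zeta>) - y \<zeta>)) \<longlongrightarrow> 0) (at_right 0)}"

definition exponentially_stable ::
  "real \<Rightarrow> real \<Rightarrow> (real \<Rightarrow> complex^'n^'n) \<Rightarrow>
   (real \<Rightarrow> (real \<Rightarrow> complex^'n) \<Rightarrow> (real \<Rightarrow> complex^'n)) \<Rightarrow> bool" where
  "exponentially_stable a b H T \<longleftrightarrow>
     (\<exists>M\<ge>1. \<exists>\<alpha>>0. \<forall>t\<ge>0. opnorm_le a b H (T t) (M * exp (- \<alpha> * t)))"

section \<open>The port-Hamiltonian operator\<close>

text \<open>The boundary values of an $H^1$ function are those of its continuous representative \<open>u\<close>.\<close>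

definition phs_dom ::
  "real \<Rightarrow> real \<Rightarrow> (real \<Rightarrow> complex^'n^'n) \<Rightarrow> complex^('n + 'n)^'n \<Rightarrow> (real \<Rightarrow> complex^'n) set" where
  "phs_dom a b H WB = {x \<in> L2 a b. (\<lambda>\<zeta>. H \<zeta> *v x \<zeta>) \<in> H1 a b \<and>
     (\<exists>u. continuous_on {a..b} u \<and> ae_eq a b u (\<lambda>\<zeta>. H \<zeta> *v x \<zeta>) \<and>
          WB *v vstack (u b) (u a) = 0)}"

definition phs_operator ::
  "real \<Rightarrow> real \<Rightarrow> complex^'n^'n \<Rightarrow> complex^'n^'n \<Rightarrow> (real \<Rightarrow> complex^'n^'n) \<Rightarrow> complex^('n + 'n)^'n \<Rightarrow>
   ((real \<Rightarrow> complex^'n) \<times> (real \<Rightarrow> complex^'n)) set" where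
  "phs_operator a b P0 P1 H WB = {(x, y). x \<in> phs_dom a b H WB \<and> y \<in> L2 a b \<and>
     (\<exists>v. has_H1_deriv a b (\<lambda>\<zeta>. H \<zeta> *v x \<zeta>) v \<and>
          ae_eq a b y (\<lambda>\<zeta>. P1 *v v \<zeta> + P0 *v (H \<zeta> *v x \<zeta>)))}"

text \<open>\<open>mat \<mu>\<close> is \<open>\<mu>\<close> times the identity matrix.\<close>

definition is_fundamental_solution ::
  "real \<Rightarrow> real \<Rightarrow> complex^'n^'n \<Rightarrow> complex^'n^'n \<Rightarrow> (real \<Rightarrow> complex^'n^'n) \<Rightarrow> complex \<Rightarrow>
   (real \<Rightarrow> complex^'n^'n) \<Rightarrow> bool" where
  "is_fundamental_solution a b P0 P1 H \<mu> \<Psi> \<longleftrightarrow>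
     continuous_on {a..b} \<Psi> \<and>
     has_H1_deriv a b \<Psi> (\<lambda>\<zeta>.
       (mat \<mu> ** matrix_inv P1 ** matrix_inv (H \<zeta>) - matrix_inv P1 ** P0) ** \<Psi> \<zeta>) \<and>
     \<Psi> a = mat 1"

definition boundary_matrix ::
  "complex^('n + 'n)^'n \<Rightarrow> complex^'n^'n \<Rightarrow> complex^'n^'n" where
  "boundary_matrix WB \<Psi>b = WB ** vstack \<Psi>b (mat 1)"

end

theory Submission
  imports Defs "HOL-Library.Function_Algebras"
begin

text \<open>
  Along the imaginary axis \<open>\<Psi>(\<zeta>)\<^sup>* P1 \<Psi>(\<zeta>)\<close> has derivative zero, hence equals \<open>P1\<close>. So the quadratic
  term in condition (ii) vanishes identically, \<open>\<Psi>\<close> is invertible with a uniformly bounded inverse,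
  and variation of constants expresses the solutions of \<open>(\<i>\<omega> - A) x = f\<close> by \<open>f\<close> and \<open>v\<close> with
  constants that do not depend on \<open>\<omega>\<close>. By compactness of the unit sphere, (iii) says that
  \<open>\<parallel>Q(\<i>\<omega>) v\<parallel> \<ge> c \<parallel>v\<parallel>\<close> uniformly in \<open>\<omega>\<close>, and this is equivalent to a bound
  \<open>K \<parallel>x\<parallel> \<le> \<parallel>(\<i>\<omega> - A) x\<parallel>\<close>.

  That such a bound gives exponential decay is the Gearhart--Pruess theorem. For contractions it has
  an elementary proof: for backward Euler steps \<open>x\<^sub>k - h A x\<^sub>k = x\<^sub>k\<^sub>-\<^sub>1\<close>, multiply \<open>x\<^sub>k\<close> by the hat function
  \<open>min k (N - k)\<close> and apply a discrete Fourier transform of length \<open>N\<close>. The resolvent bound in the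
  right half plane and Parseval's identity yield
  \<open>\<parallel>x\<^sub>N\<parallel> \<le> C / (N h) \<parallel>x\<^sub>0\<parallel>\<close> with \<open>C\<close> independent of \<open>h\<close>, and letting \<open>h \<rightarrow> 0\<close> with \<open>N h = t\<close>
  fixed shows that \<open>T t\<close> has norm at most \<open>1/2\<close> for large \<open>t\<close>.
\<close>

section \<open>Semi-inner product spaces\<close>

text \<open>The obstacle in the Gearhart-Pruess step is to truncate an orbit in time without
  spoiling its equation. The hat function vanishes at both ends, so the truncated Euler sequence is
  periodic and an index shift becomes multiplication by a root of unity \<open>w\<close>, with no
  boundary terms. Its increments are at most 1 in modulus, while it is at least N/4 on the middle
  half; this produces the factor 1/(N h). The backward scheme places the frequencies at (1 - w)/h in
  the closed right half plane, which is why the bound must first be moved off the imaginary axis.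
  Convergence of the scheme is shown for data in the domain of the squared generator, hence the
  density lemmas. Stability and (iii) are both compared with \<open>uniformly_coercive\<close>. If
  stability holds, a small boundary residual of \<Psi> v can be corrected at proportional cost
  because \<open>WB\<close> has full rank; this gives an approximate eigenvector, which decay
  excludes. On the other side, (iii) fixes the vector while coercivity lets it vary with the
  frequency; the bound on \<Psi> makes the boundary matrices uniformly Lipschitz in the vector, and
  this closes the gap.\<close>

text \<open>A seminorm is used because elements of $L_2$ are represented by functions, not by classes.\<close>

locale semi_inner = vector_space sc
  for sc :: "complex \<Rightarrow> 'v::ab_group_add \<Rightarrow> 'v" (infixr \<open>\<cdot>\<close> 75) +
  fixes V :: "'v set" and ip :: "'v \<Rightarrow> 'v \<Rightarrow> complex"
  assumes subspace_V: "subspace V"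
    and ip_add: "\<lbrakk>x \<in> V; y \<in> V; z \<in> V\<rbrakk> \<Longrightarrow> ip (x + y) z = ip x z + ip y z"
    and ip_scale: "\<lbrakk>x \<in> V; y \<in> V\<rbrakk> \<Longrightarrow> ip (c \<cdot> x) y = c * ip x y"
    and ip_sym: "\<lbrakk>x \<in> V; y \<in> V\<rbrakk> \<Longrightarrow> ip y x = cnj (ip x y)"
    and ip_nonneg: "x \<in> V \<Longrightarrow> 0 \<le> Re (ip x x)"
begin

definition nm :: "'v \<Rightarrow> real" where "nm x = sqrt (Re (ip x x))"

lemma V_closed [simp, intro]:
  "0 \<in> V" "\<lbrakk>x \<in> V; y \<in> V\<rbrakk> \<Longrightarrow> x + y \<in> V" "\<lbrakk>x \<in> V; y \<in> V\<rbrakk> \<Longrightarrow> x - y \<in> V"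
  "x \<in> V \<Longrightarrow> c \<cdot> x \<in> V" "x \<in> V \<Longrightarrow> - x \<in> V"
  using subspace_0[OF subspace_V] subspace_add[OF subspace_V] subspace_diff[OF subspace_V]
    subspace_scale[OF subspace_V] subspace_neg[OF subspace_V] by simp_all

lemma V_sum [simp, intro]: "(\<And>i. i \<in> I \<Longrightarrow> f i \<in> V) \<Longrightarrow> sum f I \<in> V"
  by (rule subspace_sum[OF subspace_V])

lemma nm_ge_0 [simp]: "x \<in> V \<Longrightarrow> 0 \<le> nm x"
  by (simp add: nm_def ip_nonneg)

lemma nm_sq: "x \<in> V \<Longrightarrow> (nm x)\<^sup>2 = Re (ip x x)"
  by (simp add: nm_def ip_nonneg)

lemma ip_add_right: "\<lbrakk>x \<in> V; y \<in> V; z \<in> V\<rbrakk> \<Longrightarrow> ip z (x + y) = ip z x + ip z y"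
  using ip_sym[of "x + y" z] ip_sym[of x z] ip_sym[of y z] by (simp add: ip_add)

lemma ip_scale_right: "\<lbrakk>x \<in> V; y \<in> V\<rbrakk> \<Longrightarrow> ip y (c \<cdot> x) = cnj c * ip y x"
  using ip_sym[of "c \<cdot> x" y] ip_sym[of x y] by (simp add: ip_scale)

lemma ip_minus: "\<lbrakk>x \<in> V; y \<in> V\<rbrakk> \<Longrightarrow> ip (- x) y = - ip x y"
  using ip_scale[of x y "-1"] by simp

lemma ip_minus_right: "\<lbrakk>x \<in> V; y \<in> V\<rbrakk> \<Longrightarrow> ip y (- x) = - ip y x"
  using ip_scale_right[of x y "-1"] by simp

lemma ip_diff: "\<lbrakk>x \<in> V; y \<in> V; z \<in> V\<rbrakk> \<Longrightarrow> ip (x - y) z = ip x z - ip y z"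
  using ip_add[of x "- y" z] by (simp add: ip_minus)

lemma ip_diff_right: "\<lbrakk>x \<in> V; y \<in> V; z \<in> V\<rbrakk> \<Longrightarrow> ip z (x - y) = ip z x - ip z y"
  using ip_add_right[of x "- y" z] by (simp add: ip_minus_right)

lemma ip_0 [simp]: "x \<in> V \<Longrightarrow> ip 0 x = 0"
  using ip_scale[of x x 0] by simp

lemma ip_0_right [simp]: "x \<in> V \<Longrightarrow> ip x 0 = 0"
  using ip_scale_right[of x x 0] by simp

lemma ip_sum: "\<lbrakk>\<And>i. i \<in> I \<Longrightarrow> f i \<in> V; z \<in> V\<rbrakk> \<Longrightarrow> ip (sum f I) z = (\<Sum>i\<in>I. ip (f i) z)"
  by (induction I rule: infinite_finite_induct) (auto simp: ip_add)

lemma ip_sum_right: "\<lbrakk>\<And>i. i \<in> I \<Longrightarrow> f i \<in> V; z \<in> V\<rbrakk> \<Longrightarrow> ip z (sum f I) = (\<Sum>i\<in>I. ip z (f i))"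
  by (induction I rule: infinite_finite_induct) (auto simp: ip_add_right)

text \<open>Cauchy-Schwarz from the nonnegativity of the quadratic polynomial t ->
  \<open>(nm (x - t y))\<^sup>2\<close>. The case \<open>nm y = 0\<close> is separate, since it does
  not force \<open>y = 0\<close>.\<close>

lemma Re_ip_le:
  assumes x: "x \<in> V" and y: "y \<in> V"
  shows "Re (ip x y) \<le> nm x * nm y"
proof -
  have q: "2 * t * Re (ip x y) \<le> (nm x)\<^sup>2 + t\<^sup>2 * (nm y)\<^sup>2" for t :: real
  proof -
    have "0 \<le> Re (ip (x - of_real t \<cdot> y) (x - of_real t \<cdot> y))"
      by (rule ip_nonneg) (use x y in auto)
    also have "\<dots> = (nm x)\<^sup>2 - 2 * t * Re (ip x y) + t\<^sup>2 * (nm y)\<^sup>2"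
      using x y ip_sym[OF x y]
      by (simp add: ip_diff ip_diff_right ip_scale ip_scale_right nm_sq[OF x, symmetric] nm_sq[OF y, symmetric])
        (simp add: algebra_simps power2_eq_square)
    finally show ?thesis by simp
  qed
  show ?thesis
  proof (cases "nm y = 0")
    case True
    have "Re (ip x y) \<le> 0"
    proof (rule ccontr)
      assume "\<not> Re (ip x y) \<le> 0"
      then show False
        \<comment> \<open>With \<open>nm y = 0\<close> the polynomial is affine in t; this t makes
          its linear term exceed the constant \<open>(nm x)\<^sup>2\<close> by 1.\<close>
        using q[of "((nm x)\<^sup>2 + 1) / (2 * Re (ip x y))"] True by simp
    qed
    then show ?thesis using True by simp
  next
    case False
    have "2 * (Re (ip x y) / (nm y)\<^sup>2) * Re (ip x y) \<le> (nm x)\<^sup>2 + (Re (ip x y) / (nm y)\<^sup>2)\<^sup>2 * (nm y)\<^sup>2"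
      by (rule q)
    then have "2 * ((Re (ip x y))\<^sup>2 / (nm y)\<^sup>2) \<le> (nm x)\<^sup>2 + (Re (ip x y))\<^sup>2 / (nm y)\<^sup>2"
      using False by (simp add: power2_eq_square field_simps)
    then have "(Re (ip x y))\<^sup>2 \<le> (nm x * nm y)\<^sup>2"
      using False by (simp add: pos_divide_le_eq power_mult_distrib distrib_right)
    then show ?thesis
      by (rule power2_le_imp_le) (use x y in simp)
  qed
qed

lemma nm_triangle:
  assumes "x \<in> V" "y \<in> V"
  shows "nm (x + y) \<le> nm x + nm y"
proof (rule power2_le_imp_le)
  show "(nm (x + y))\<^sup>2 \<le> (nm x + nm y)\<^sup>2"
    using assms ip_sym[OF assms] Re_ip_le[OF assms]
    by (simp add: nm_sq power2_sum ip_add ip_add_right)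
qed (use assms in simp)

lemma nm_scale: "x \<in> V \<Longrightarrow> nm (c \<cdot> x) = cmod c * nm x"
proof -
  assume x: "x \<in> V"
  have "Re (ip (c \<cdot> x) (c \<cdot> x)) = (cmod c)\<^sup>2 * Re (ip x x)"
    using x by (simp add: ip_scale ip_scale_right mult.assoc[symmetric] complex_mult_cnj cmod_power2 flip: power2_eq_square)
  then show ?thesis by (simp add: nm_def real_sqrt_mult)
qed

lemma nm_0 [simp]: "nm 0 = 0"
  using nm_scale[of 0 0] by simp

lemma nm_minus [simp]: "x \<in> V \<Longrightarrow> nm (- x) = nm x"
  using nm_scale[of x "-1"] by simp

lemma nm_minus_commute: "\<lbrakk>x \<in> V; y \<in> V\<rbrakk> \<Longrightarrow> nm (x - y) = nm (y - x)"
  using nm_minus[of "x - y"] by simp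

lemma nm_diff_triangle: "\<lbrakk>x \<in> V; y \<in> V; z \<in> V\<rbrakk> \<Longrightarrow> nm (x - z) \<le> nm (x - y) + nm (y - z)"
  using nm_triangle[of "x - y" "y - z"] by simp

lemma nm_diff_le: "\<lbrakk>x \<in> V; y \<in> V\<rbrakk> \<Longrightarrow> nm (x - y) \<le> nm x + nm y"
  using nm_triangle[of x "- y"] by simp

lemma nm_le_diff: "\<lbrakk>x \<in> V; y \<in> V\<rbrakk> \<Longrightarrow> nm x \<le> nm y + nm (x - y)"
  using nm_triangle[of y "x - y"] by simp

end

section \<open>Discrete Fourier transform of vector sequences\<close>

text \<open>The summand is the j-th power of \<open>q\<close>, an N-th root of unity, so the sum is
  geometric. For distinct k and l, \<open>q\<close> differs from 1 because N cannot divide a nonzero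
  difference smaller than N in modulus.\<close>

lemma sum_roots_of_unity_orthogonal:
  fixes k l N :: nat
  assumes "k < N" "l < N"
  defines "w \<equiv> \<lambda>j. cis (2 * pi * real j / real N)"
  shows "(\<Sum>j<N. w j ^ k * cnj (w j ^ l)) = (if k = l then of_nat N else 0)"
proof -
  define q where "q = cis (2 * pi * (real k - real l) / real N)"
  have wq: "w j ^ k * cnj (w j ^ l) = q ^ j" for j
  proof -
    have "w j ^ k * cnj (w j ^ l) = cis (real k * (2 * pi * real j / real N) + real l * (- (2 * pi * real j / real N)))"
      unfolding w_def complex_cnj_power cis_cnj Complex.DeMoivre cis_mult by simp
    also have "real k * (2 * pi * real j / real N) + real l * (- (2 * pi * real j / real N))
        = real j * (2 * pi * (real k - real l) / real N)"
      by (simp add: diff_divide_distrib algebra_simps)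
    finally show ?thesis by (simp add: q_def Complex.DeMoivre)
  qed
  have qN: "q ^ N = 1"
  proof -
    have "real N * (2 * pi * (real k - real l) / real N) = 2 * pi * of_int (int k - int l)"
      using assms by simp
    then have "q ^ N = cis (2 * pi * of_int (int k - int l))"
      unfolding q_def Complex.DeMoivre by (rule arg_cong)
    then show ?thesis
      by (metis cis_multiple_2pi Ints_of_int)
  qed
  show ?thesis
  proof (cases "k = l")
    case True
    then show ?thesis unfolding wq by (simp add: q_def)
  next
    case False
    have "q \<noteq> 1"
    proof
      assume "q = 1"
      then have "cos (2 * pi * (real k - real l) / real N) = 1"
        unfolding q_def by (metis cis.sel(1) one_complex.sel(1))
      then obtain n :: int where n: "2 * pi * (real k - real l) / real N = of_int n * 2 * pi"
        using cos_one_2pi_int by blast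
      have "2 * pi * (real k - real l) = 2 * pi * (of_int n * real N)"
        using n assms by (simp add: field_simps)
      then have "real k - real l = of_int n * real N"
        using mult_cancel_left[of "2 * pi"] by simp
      then have "real_of_int (int k - int l) = real_of_int (n * int N)" by simp
      then have e: "int k - int l = n * int N" by linarith
      then have "int N dvd int k - int l" by simp
      moreover have "\<bar>int k - int l\<bar> < int N" using assms by linarith
      ultimately have "int k - int l = 0"
        using dvd_imp_le_int[of "int k - int l" "int N"] by linarith
      then show False using False by simp
    qed
    then show ?thesis
      unfolding wq using qN by (simp add: False geometric_sum)
  qed
qed

context semi_inner
begin

text \<open>Expanding the squares and summing over j first leaves only the diagonal terms, by
  orthogonality of the characters.\<close>

lemma discrete_parseval:
  fixes N :: nat
  assumes u: "\<And>k. u k \<in> V"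
  shows "(\<Sum>j<N. (nm (\<Sum>k<N. cis (2 * pi * real j / real N) ^ k \<cdot> u k))\<^sup>2) = N * (\<Sum>k<N. (nm (u k))\<^sup>2)"
proof -
  define w where "w j = cis (2 * pi * real j / real N)" for j
  let ?U = "\<lambda>j. \<Sum>k<N. w j ^ k \<cdot> u k"
  have "(\<Sum>j<N. ip (?U j) (?U j)) = (\<Sum>j<N. \<Sum>k<N. \<Sum>l<N. (w j ^ k * cnj (w j ^ l)) * ip (u k) (u l))"
  proof (rule sum.cong[OF refl])
    fix j
    have "ip (?U j) (?U j) = (\<Sum>k<N. ip (w j ^ k \<cdot> u k) (\<Sum>l<N. w j ^ l \<cdot> u l))"
      using u by (subst ip_sum) auto
    also have "\<dots> = (\<Sum>k<N. \<Sum>l<N. (w j ^ k * cnj (w j ^ l)) * ip (u k) (u l))"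
      using u by (intro sum.cong refl, subst ip_sum_right) (auto simp: ip_scale ip_scale_right mult_ac)
    finally show "ip (?U j) (?U j) = (\<Sum>k<N. \<Sum>l<N. (w j ^ k * cnj (w j ^ l)) * ip (u k) (u l))" .
  qed
  also have "\<dots> = (\<Sum>k<N. \<Sum>l<N. \<Sum>j<N. (w j ^ k * cnj (w j ^ l)) * ip (u k) (u l))"
    by (subst sum.swap) (rule sum.cong[OF refl], rule sum.swap)
  also have "\<dots> = (\<Sum>k<N. \<Sum>l<N. (if k = l then of_nat N else 0) * ip (u k) (u l))"
    unfolding sum_distrib_right[symmetric] w_def
    by (intro sum.cong refl, subst sum_roots_of_unity_orthogonal) auto
  also have "\<dots> = of_nat N * (\<Sum>k<N. ip (u k) (u k))"
    by (simp add: if_distrib[of "\<lambda>c. c * _"] sum_distrib_left cong: if_cong)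
  finally have "Re (\<Sum>j<N. ip (?U j) (?U j)) = Re (of_nat N * (\<Sum>k<N. ip (u k) (u k)))"
    by simp
  then show ?thesis
    using u by (simp add: nm_sq w_def)
qed

end

section \<open>Semigroups of contractions\<close>

text \<open>Linearity and the semigroup law hold modulo vectors of seminorm zero, because the
  operators act on functions and their identities hold only almost everywhere.\<close>

locale nonexpansive_semigroup = semi_inner sc V ip
  for sc :: "complex \<Rightarrow> 'v::ab_group_add \<Rightarrow> 'v" (infixr \<open>\<cdot>\<close> 75) and V ip +
  fixes S :: "real \<Rightarrow> 'v \<Rightarrow> 'v"
  assumes S_V [simp, intro]: "\<lbrakk>0 \<le> t; x \<in> V\<rbrakk> \<Longrightarrow> S t x \<in> V"
    and S_lin: "\<lbrakk>0 \<le> t; x \<in> V; y \<in> V\<rbrakk> \<Longrightarrow> nm (S t (c \<cdot> x + d \<cdot> y) - (c \<cdot> S t x + d \<cdot> S t y)) = 0"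
    and S_contr: "\<lbrakk>0 \<le> t; x \<in> V\<rbrakk> \<Longrightarrow> nm (S t x) \<le> nm x"
    and S_0: "x \<in> V \<Longrightarrow> nm (S 0 x - x) = 0"
    and S_add: "\<lbrakk>0 \<le> s; 0 \<le> t; x \<in> V\<rbrakk> \<Longrightarrow> nm (S (s + t) x - S s (S t x)) = 0"
begin

lemma S_diff:
  assumes "0 \<le> t" "x \<in> V" "y \<in> V"
  shows "nm (S t x - S t y) \<le> nm (x - y)"
proof -
  have "nm (S t (x - y) - (S t x - S t y)) = 0"
    using S_lin[OF assms, of 1 "-1"] by simp
  moreover have "nm (S t x - S t y) \<le> nm (S t (x - y)) + nm (S t x - S t y - S t (x - y))"
    using assms by (intro nm_le_diff) auto
  moreover have "nm (S t (x - y)) \<le> nm (x - y)"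
    using assms by (intro S_contr) auto
  ultimately show ?thesis
    using nm_minus_commute[of "S t x - S t y" "S t (x - y)"] assms by auto
qed

text \<open>Transports a first-order expansion along the semigroup: the error of approximating x by
  y + c g does not grow in time.\<close>

lemma S_diff_scale:
  assumes "0 \<le> t" "x \<in> V" "y \<in> V" "g \<in> V"
  shows "nm (S t x - S t y - c \<cdot> S t g) \<le> nm (x - y - c \<cdot> g)"
proof -
  have 1: "nm (S t (y + c \<cdot> g) - (S t y + c \<cdot> S t g)) = 0"
    using S_lin[of t y g 1 c] assms by simp
  have "nm (S t x - (S t y + c \<cdot> S t g)) \<le> nm (S t x - S t (y + c \<cdot> g)) + nm (S t (y + c \<cdot> g) - (S t y + c \<cdot> S t g))"
    using assms by (intro nm_diff_triangle) auto
  also have "\<dots> \<le> nm (x - (y + c \<cdot> g))"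
    using 1 assms S_diff[of t x "y + c \<cdot> g"] by auto
  finally show ?thesis by (simp add: algebra_simps)
qed

section \<open>The generator as a derivative at time zero\<close>

text \<open>The graph of the generator. It is a relation because the limit \<open>g\<close> is
  determined only up to seminorm zero.\<close>

definition deriv_at_0 :: "'v \<Rightarrow> 'v \<Rightarrow> bool" where
  "deriv_at_0 z g \<longleftrightarrow> z \<in> V \<and> g \<in> V \<and>
     ((\<lambda>t. nm (of_real (1 / t) \<cdot> (S t z - z) - g)) \<longlongrightarrow> 0) (at_right 0)"

lemma deriv_at_0_lin:
  assumes z: "deriv_at_0 z g" and z': "deriv_at_0 z' g'"
  shows "deriv_at_0 (c \<cdot> z + d \<cdot> z') (c \<cdot> g + d \<cdot> g')"
proof -
  have V: "z \<in> V" "g \<in> V" "z' \<in> V" "g' \<in> V" using z z' by (auto simp: deriv_at_0_def)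
  let ?q = "\<lambda>t z g. of_real (1 / t) \<cdot> (S t z - z) - g"
  let ?w = "\<lambda>t. ?q t (c \<cdot> z + d \<cdot> z') (c \<cdot> g + d \<cdot> g')"
  let ?u = "\<lambda>t. cmod c * nm (?q t z g) + cmod d * nm (?q t z' g')"
  have "nm (?w t) \<le> ?u t" if t: "0 < t" for t
  proof -
    let ?r = "S t (c \<cdot> z + d \<cdot> z') - (c \<cdot> S t z + d \<cdot> S t z')"
    have "?w t = c \<cdot> ?q t z g + (d \<cdot> ?q t z' g' + of_real (1 / t) \<cdot> ?r)"
      by (simp add: algebra_simps)
    moreover have "nm (c \<cdot> ?q t z g + (d \<cdot> ?q t z' g' + of_real (1 / t) \<cdot> ?r))
        \<le> nm (c \<cdot> ?q t z g) + nm (d \<cdot> ?q t z' g' + of_real (1 / t) \<cdot> ?r)"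
      using V t by (intro nm_triangle) auto
    moreover have "nm (d \<cdot> ?q t z' g' + of_real (1 / t) \<cdot> ?r) \<le> nm (d \<cdot> ?q t z' g') + nm (of_real (1 / t) \<cdot> ?r)"
      using V t by (intro nm_triangle) auto
    moreover have "nm (of_real (1 / t) \<cdot> ?r) = 0"
      using S_lin[of t z z' c d] V t by (subst nm_scale) auto
    moreover have "nm (c \<cdot> ?q t z g) = cmod c * nm (?q t z g)" "nm (d \<cdot> ?q t z' g') = cmod d * nm (?q t z' g')"
      using V t by (intro nm_scale; auto)+
    ultimately show ?thesis by simp
  qed
  note bd = this
  have "(?u \<longlongrightarrow> cmod c * 0 + cmod d * 0) (at_right 0)"
    using z z' by (intro tendsto_intros) (auto simp: deriv_at_0_def)
  then have lim: "(?u \<longlongrightarrow> 0) (at_right 0)" by simp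
  have "((\<lambda>t. nm (?w t)) \<longlongrightarrow> 0) (at_right 0)"
  proof (rule tendsto_sandwich[OF _ _ tendsto_const lim])
    show "\<forall>\<^sub>F t in at_right 0. 0 \<le> nm (?w t)"
      using V by (auto simp: eventually_at_filter)
    show "\<forall>\<^sub>F t in at_right 0. nm (?w t) \<le> ?u t"
      using bd by (auto simp: eventually_at_filter)
  qed
  then show ?thesis using V unfolding deriv_at_0_def by blast
qed

text \<open>Replaces the formula that writes S t z - z as the integral of S s g over [0, t]. The
  orbit is cut into equal short steps; each contributes its first-order error, which is o(s)
  uniformly because contractions transport the error at time 0, plus the deviation of S s g from the
  comparison vector \<open>w\<close>.\<close>

lemma mean_value:
  assumes z: "deriv_at_0 z g" and w: "w \<in> V" and t: "0 \<le> t"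
    and B: "\<And>s. \<lbrakk>0 \<le> s; s \<le> t\<rbrakk> \<Longrightarrow> nm (S s g - w) \<le> B"
  shows "nm (S t z - z - of_real t \<cdot> w) \<le> t * B"
proof (cases "t = 0")
  case True
  then show ?thesis using z S_0[of z] by (simp add: deriv_at_0_def)
next
  case False
  then have t0: "t > 0" using t by simp
  have zV: "z \<in> V" "g \<in> V" using z by (auto simp: deriv_at_0_def)
  define e where "e s = nm (of_real (1 / s) \<cdot> (S s z - z) - g)" for s
  have e0: "0 \<le> e s" if "0 \<le> s" for s using that zV by (simp add: e_def)
  \<comment> \<open>Induction on the number of steps; \<open>e s\<close> is the error of the
    difference quotient at time 0 and vanishes as the step length shrinks.\<close>
  have step: "nm (S (real j * s) z - z - of_real (real j * s) \<cdot> w) \<le> real j * s * (B + e s)"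
    if s: "s > 0" and "real j * s \<le> t" for s j
    using that(2)
  proof (induction j)
    case 0
    then show ?case using S_0[of z] zV by simp
  next
    case (Suc j)
    let ?r = "real j * s"
    let ?e = "S (?r + s) z - S ?r z - of_real s \<cdot> S ?r g"
    have r: "0 \<le> ?r" "?r \<le> t" using s Suc.prems by (auto simp: algebra_simps)
    have 1: "nm (?e) \<le> s * e s"
    proof -
      have "nm (S (?r + s) z - (S ?r z + of_real s \<cdot> S ?r g)) \<le>
         nm (S (?r + s) z - S ?r (S s z)) + nm (S ?r (S s z) - (S ?r z + of_real s \<cdot> S ?r g))"
        using r s zV by (intro nm_diff_triangle) auto
      also have "nm (S (?r + s) z - S ?r (S s z)) = 0" using S_add r s zV by simp
      also have "nm (S ?r (S s z) - (S ?r z + of_real s \<cdot> S ?r g)) \<le> nm (S s z - z - of_real s \<cdot> g)"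
        using S_diff_scale[of ?r "S s z" z g "of_real s"] r s zV by (simp add: algebra_simps)
      also have "S s z - z - of_real s \<cdot> g = of_real s \<cdot> (of_real (1 / s) \<cdot> (S s z - z) - g)"
        using s by (simp add: scale_right_diff_distrib)
      also have "nm \<dots> = s * e s" using s zV by (subst nm_scale) (auto simp: e_def)
      finally show ?thesis by (simp add: algebra_simps)
    qed
    have 2: "nm (of_real s \<cdot> (S ?r g - w)) \<le> s * B"
      using B[OF r] s r zV w by (simp add: nm_scale)
    have 3: "nm (S ?r z - z - of_real ?r \<cdot> w) \<le> ?r * (B + e s)"
      by (rule Suc.IH[OF r(2)])
    let ?p = "of_real s \<cdot> (S ?r g - w) + (S ?r z - z - of_real ?r \<cdot> w)"
    have "real (Suc j) * s = ?r + s" by (simp add: algebra_simps)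
    then have "S (real (Suc j) * s) z - z - of_real (real (Suc j) * s) \<cdot> w =
       (?e) + (?p)"
      by (simp add: algebra_simps)
    moreover have "nm \<dots> \<le> nm (?e)
        + nm (?p)"
      using r s zV w by (intro nm_triangle) auto
    moreover have "nm (?p)
        \<le> nm (of_real s \<cdot> (S ?r g - w)) + nm (S ?r z - z - of_real ?r \<cdot> w)"
      using r s zV w by (intro nm_triangle) auto
    ultimately show ?case using 1 2 3 by (simp add: algebra_simps)
  qed
  have le: "nm (S t z - z - of_real t \<cdot> w) \<le> t * (B + e (t / real (Suc n)))" for n
    using step[of "t / real (Suc n)" "Suc n"] t0 by simp
  have "((\<lambda>n. t / real (Suc n)) \<longlongrightarrow> 0) sequentially"
    by (rule LIMSEQ_Suc) (rule lim_const_over_n)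
  then have "filterlim (\<lambda>n. t / real (Suc n)) (at_right 0) sequentially"
    using t0 by (auto simp: filterlim_at eventually_sequentially)
  moreover have "(e \<longlongrightarrow> 0) (at_right 0)" using z by (simp add: deriv_at_0_def e_def[abs_def])
  ultimately have "((\<lambda>n. e (t / real (Suc n))) \<longlongrightarrow> 0) sequentially"
    by (rule filterlim_compose[rotated])
  then have "((\<lambda>n. t * (B + e (t / real (Suc n)))) \<longlongrightarrow> t * (B + 0)) sequentially"
    by (intro tendsto_intros)
  then show ?thesis
    using le by (intro tendsto_lowerbound[of "\<lambda>n. t * (B + e (t / real (Suc n)))"]) auto
qed

lemma S_orbit_diff:
  assumes "deriv_at_0 z g" "0 \<le> t"
  shows "nm (S t z - z) \<le> t * nm g"
  using mean_value[of z g 0 t "nm g"] assms S_contr[of _ g] by (simp add: deriv_at_0_def)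

text \<open>By contractivity and Cauchy-Schwarz, Re (ip (S t z) z) is at most
  \<open>(nm z)\<^sup>2\<close>, so each difference quotient has nonpositive real part against z;
  pass to the limit.\<close>

lemma dissipative:
  assumes "deriv_at_0 z g"
  shows "Re (ip g z) \<le> 0"
proof -
  have zV: "z \<in> V" "g \<in> V" using assms by (auto simp: deriv_at_0_def)
  let ?q = "\<lambda>t. of_real (1 / t) \<cdot> (S t z - z)"
  have "Re (ip g z) \<le> nm (?q t - g) * nm z" if t: "t > 0" for t
  proof -
    have "Re (ip (S t z) z) \<le> nm z * nm z"
      using Re_ip_le[of "S t z" z] S_contr[of t z] zV t mult_right_mono[of "nm (S t z)" "nm z" "nm z"]
      by fastforce
    then have "Re (ip (?q t) z) \<le> 0"
      using t zV nm_sq[of z]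
      by (simp add: ip_scale ip_diff power2_eq_square divide_nonpos_pos mult_nonneg_nonpos)
    moreover have "Re (ip (g - ?q t) z) \<le> nm (g - ?q t) * nm z"
      using zV t by (intro Re_ip_le) auto
    moreover have "nm (g - ?q t) = nm (?q t - g)"
      using zV t by (intro nm_minus_commute) auto
    ultimately show ?thesis using zV t by (simp add: ip_diff)
  qed
  then have "\<forall>\<^sub>F t in at_right 0. Re (ip g z) \<le> nm (?q t - g) * nm z"
    by (auto simp: eventually_at_filter)
  moreover have "((\<lambda>t. nm (?q t - g) * nm z) \<longlongrightarrow> 0 * nm z) (at_right 0)"
    using assms by (intro tendsto_intros) (simp add: deriv_at_0_def)
  ultimately show ?thesis
    by (intro tendsto_lowerbound[of _ 0]) auto
qed

section \<open>Shifting the generator by an imaginary number\<close>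

text \<open>Unimodular factors preserve contractivity, so statements about the generator apply at
  every frequency after a rotation.\<close>

lemma rotated_semigroup:
  fixes \<omega> :: real
  shows "nonexpansive_semigroup sc V ip (\<lambda>t x. cis (- \<omega> * t) \<cdot> S t x)"
proof
  let ?c = "\<lambda>t. cis (- \<omega> * t)"
  fix t x assume "0 \<le> (t::real)" "x \<in> V"
  then show "?c t \<cdot> S t x \<in> V" by simp
  show "nm (?c t \<cdot> S t x) \<le> nm x"
    using \<open>0 \<le> t\<close> \<open>x \<in> V\<close> S_contr by (simp add: nm_scale)
next
  let ?c = "\<lambda>t. cis (- \<omega> * t)"
  fix t x y c d assume *: "0 \<le> (t::real)" "x \<in> V" "y \<in> V"
  have "?c t \<cdot> S t (c \<cdot> x + d \<cdot> y) - (c \<cdot> ?c t \<cdot> S t x + d \<cdot> ?c t \<cdot> S t y)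
     = ?c t \<cdot> (S t (c \<cdot> x + d \<cdot> y) - (c \<cdot> S t x + d \<cdot> S t y))"
    by (simp add: algebra_simps)
  then show "nm (?c t \<cdot> S t (c \<cdot> x + d \<cdot> y) - (c \<cdot> ?c t \<cdot> S t x + d \<cdot> ?c t \<cdot> S t y)) = 0"
    using * S_lin[OF *] by (simp add: nm_scale)
next
  let ?c = "\<lambda>t. cis (- \<omega> * t)"
  fix x assume "x \<in> V"
  then show "nm (?c 0 \<cdot> S 0 x - x) = 0" using S_0 by simp
next
  let ?c = "\<lambda>t. cis (- \<omega> * t)"
  fix s t x assume *: "0 \<le> (s::real)" "0 \<le> (t::real)" "x \<in> V"
  have "nm (S s (?c t \<cdot> S t x + 0 \<cdot> S t x) - (?c t \<cdot> S s (S t x) + 0 \<cdot> S s (S t x))) = 0"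
    using * by (intro S_lin) auto
  then have 1: "nm (?c t \<cdot> S s (S t x) - S s (?c t \<cdot> S t x)) = 0"
    using * nm_minus_commute[of "?c t \<cdot> S s (S t x)" "S s (?c t \<cdot> S t x)"] by simp
  have "?c (s + t) = ?c s * ?c t" by (simp add: cis_mult algebra_simps)
  then have "?c (s + t) \<cdot> S (s + t) x - ?c s \<cdot> S s (?c t \<cdot> S t x)
      = ?c s \<cdot> ((?c t \<cdot> (S (s + t) x - S s (S t x))) + (?c t \<cdot> S s (S t x) - S s (?c t \<cdot> S t x)))"
    by (simp add: algebra_simps)
  also have "nm \<dots> \<le> nm (?c t \<cdot> (S (s + t) x - S s (S t x))) + nm (?c t \<cdot> S s (S t x) - S s (?c t \<cdot> S t x))"
    using * by (subst nm_scale) (auto intro!: nm_triangle)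
  also have "\<dots> = 0" using * 1 S_add[OF *] by (simp add: nm_scale)
  finally show "nm (?c (s + t) \<cdot> S (s + t) x - ?c s \<cdot> S s (?c t \<cdot> S t x)) = 0"
    using * nm_ge_0 by (smt (verit) S_V V_closed add_nonneg_nonneg)
qed

lemma rotated_deriv:
  fixes \<omega> :: real
  assumes "deriv_at_0 z g"
  shows "nonexpansive_semigroup.deriv_at_0 sc V ip (\<lambda>t x. cis (- \<omega> * t) \<cdot> S t x) z (g - (\<i> * of_real \<omega>) \<cdot> z)"
proof -
  interpret R: nonexpansive_semigroup sc V ip "\<lambda>t x. cis (- \<omega> * t) \<cdot> S t x"
    by (rule rotated_semigroup)
  have zV: "z \<in> V" "g \<in> V" using assms by (auto simp: deriv_at_0_def)
  let ?q = "\<lambda>t. of_real (1 / t) \<cdot> (S t z - z) - g"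
  let ?c = "\<lambda>t. cis (- \<omega> * t)"
  let ?e = "\<lambda>t. nm (of_real (1 / t) \<cdot> (?c t \<cdot> S t z - z) - (g - (\<i> * of_real \<omega>) \<cdot> z))"
  let ?u = "\<lambda>t. nm (?q t) + cmod (?c t - 1) * nm g + cmod (of_real (1 / t) * (?c t - 1) + \<i> * of_real \<omega>) * nm z"
  \<comment> \<open>The difference quotient of this exponential is the factor of \<open>z\<close> in
    the product rule for the rotated orbit.\<close>
  have "DERIV (\<lambda>z. exp (- (\<i> * of_real \<omega>) * z)) 0 :> - (\<i> * of_real \<omega>)"
    by (auto intro!: derivative_eq_intros)
  then have "((\<lambda>h. (exp (- (\<i> * of_real \<omega>) * h) - 1) / h) \<longlongrightarrow> - (\<i> * of_real \<omega>)) (at 0)"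
    by (simp add: DERIV_def)
  moreover have of_real_0: "filterlim (of_real :: real \<Rightarrow> complex) (at 0) (at_right 0)"
    unfolding filterlim_at by (auto intro!: tendsto_eq_intros simp: eventually_at_filter)
  ultimately have "((\<lambda>t. (exp (- (\<i> * of_real \<omega>) * of_real t) - 1) / of_real t) \<longlongrightarrow> - (\<i> * of_real \<omega>)) (at_right 0)"
    by (rule filterlim_compose)
  then have "((\<lambda>t. (exp (- (\<i> * of_real \<omega>) * of_real t) - 1) / of_real t + \<i> * of_real \<omega>) \<longlongrightarrow>
      - (\<i> * of_real \<omega>) + \<i> * of_real \<omega>) (at_right 0)"
    by (intro tendsto_intros)
  then have c2: "((\<lambda>t. of_real (1 / t) * (cis (- \<omega> * t) - 1) + \<i> * of_real \<omega>) \<longlongrightarrow> 0) (at_right 0)"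
    by (simp add: cis_conv_exp mult_ac)
  have "((\<lambda>t. cis (- \<omega> * t) - 1) \<longlongrightarrow> cis (- \<omega> * 0) - 1) (at_right 0)"
    by (intro tendsto_intros)
  then have c1: "((\<lambda>t. cis (- \<omega> * t) - 1) \<longlongrightarrow> 0) (at_right 0)"
    by simp
  have bd: "?e t \<le> ?u t" if t: "t > 0" for t
  proof -
    have "of_real (1 / t) \<cdot> (?c t \<cdot> S t z - z) - (g - (\<i> * of_real \<omega>) \<cdot> z)
      = ?c t \<cdot> ?q t + ((?c t - 1) \<cdot> g + (of_real (1 / t) * (?c t - 1) + \<i> * of_real \<omega>) \<cdot> z)"
      by (simp add: algebra_simps)
    also have "nm \<dots> \<le> nm (?c t \<cdot> ?q t) + nm ((?c t - 1) \<cdot> g + (of_real (1 / t) * (?c t - 1) + \<i> * of_real \<omega>) \<cdot> z)"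
      using zV t by (intro nm_triangle) auto
    also have "\<dots> \<le> nm (?c t \<cdot> ?q t) + (nm ((?c t - 1) \<cdot> g) + nm ((of_real (1 / t) * (?c t - 1) + \<i> * of_real \<omega>) \<cdot> z))"
      using zV t by (intro add_left_mono nm_triangle) auto
    finally show ?thesis using zV t by (simp add: nm_scale)
  qed
  have lim: "(?u \<longlongrightarrow> 0) (at_right 0)"
    using tendsto_add[OF tendsto_add[OF _ tendsto_mult_right[OF tendsto_norm_zero[OF c1]]]
        tendsto_mult_right[OF tendsto_norm_zero[OF c2]], of "\<lambda>t. nm (?q t)" 0 "nm g" "nm z"] assms
    by (simp add: deriv_at_0_def)
  have "((\<lambda>t. ?e t) \<longlongrightarrow> 0) (at_right 0)"
  proof (rule tendsto_sandwich[OF _ _ tendsto_const lim])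
    show "\<forall>\<^sub>F t in at_right 0. 0 \<le> ?e t"
      using zV by (auto simp: eventually_at_filter)
    show "\<forall>\<^sub>F t in at_right 0. ?e t \<le> ?u t"
      using bd by (auto simp: eventually_at_filter)
  qed
  then show ?thesis unfolding R.deriv_at_0_def using zV by blast
qed

text \<open>After rotation the orbit moves by at most \<tau> times the residual during time \<tau>.
  Since it has lost half of its norm by then, it has moved by at least
  \<open>nm z / 2\<close>.\<close>

lemma resolvent_bound_of_decay:
  assumes "deriv_at_0 z g" "\<tau> > 0" "nm (S \<tau> z) \<le> nm z / 2"
  shows "nm z \<le> 2 * \<tau> * nm ((\<i> * of_real \<omega>) \<cdot> z - g)"
proof -
  interpret R: nonexpansive_semigroup sc V ip "\<lambda>t x. cis (- \<omega> * t) \<cdot> S t x"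
    by (rule rotated_semigroup)
  have zV: "z \<in> V" "g \<in> V" using assms by (auto simp: deriv_at_0_def)
  have "nm (cis (- \<omega> * \<tau>) \<cdot> S \<tau> z - z) \<le> \<tau> * nm (g - (\<i> * of_real \<omega>) \<cdot> z)"
    using R.S_orbit_diff[OF rotated_deriv[OF assms(1)]] assms(2) by simp
  moreover have "nm z \<le> nm (cis (- \<omega> * \<tau>) \<cdot> S \<tau> z) + nm (z - cis (- \<omega> * \<tau>) \<cdot> S \<tau> z)"
    using zV assms(2) by (intro nm_le_diff) auto
  moreover have "nm (cis (- \<omega> * \<tau>) \<cdot> S \<tau> z) = nm (S \<tau> z)"
    using zV assms(2) by (simp add: nm_scale)
  moreover have "nm (z - cis (- \<omega> * \<tau>) \<cdot> S \<tau> z) = nm (cis (- \<omega> * \<tau>) \<cdot> S \<tau> z - z)"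
    "nm ((\<i> * of_real \<omega>) \<cdot> z - g) = nm (g - (\<i> * of_real \<omega>) \<cdot> z)"
    using zV assms(2) by (auto intro!: nm_minus_commute)
  ultimately show ?thesis using assms(3) by simp
qed

end

section \<open>Decay from a resolvent bound on the imaginary axis\<close>

text \<open>\<open>range\<close> states that x - h A x = y is solvable, written through the value (x
  - y)/h of the generator at x; this is one backward Euler step. \<open>lower\<close> has a constant
  common to all frequencies.\<close>

locale bounded_resolvent_semigroup = nonexpansive_semigroup sc V ip S
  for sc :: "complex \<Rightarrow> 'v::ab_group_add \<Rightarrow> 'v" (infixr \<open>\<cdot>\<close> 75) and V ip S +
  fixes K :: real
  assumes range: "\<lbrakk>0 < h; y \<in> V\<rbrakk> \<Longrightarrow> \<exists>x. deriv_at_0 x (of_real (1 / h) \<cdot> (x - y))"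
    and S_cont: "x \<in> V \<Longrightarrow> ((\<lambda>t. nm (S t x - x)) \<longlongrightarrow> 0) (at_right 0)"
    and K_pos: "0 < K"
    and lower: "deriv_at_0 x y \<Longrightarrow> K * nm x \<le> nm ((\<i> * of_real \<omega>) \<cdot> x - y)"
begin

definition G :: "('v \<times> 'v) set" where "G = {(x, y). deriv_at_0 x y}"

lemma G_deriv: "(x, y) \<in> G \<Longrightarrow> deriv_at_0 x y"
  by (simp add: G_def)

lemma G_lin: "\<lbrakk>(x, y) \<in> G; (x', y') \<in> G\<rbrakk> \<Longrightarrow> (c \<cdot> x + d \<cdot> x', c \<cdot> y + d \<cdot> y') \<in> G"
  by (simp add: G_def deriv_at_0_lin)

lemma G_range: "\<lbrakk>0 < h; y \<in> V\<rbrakk> \<Longrightarrow> \<exists>x. (x, of_real (1 / h) \<cdot> (x - y)) \<in> G"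
  using range by (simp add: G_def)

lemma G_lower: "(x, y) \<in> G \<Longrightarrow> K * nm x \<le> nm ((\<i> * of_real \<omega>) \<cdot> x - y)"
  using lower by (simp add: G_def)

lemma G_V: "(x, y) \<in> G \<Longrightarrow> x \<in> V \<and> y \<in> V"
  using G_deriv by (auto simp: deriv_at_0_def)

lemma G_diff: "\<lbrakk>(x, y) \<in> G; (x', y') \<in> G\<rbrakk> \<Longrightarrow> (x - x', y - y') \<in> G"
  using G_lin[of x y x' y' 1 "-1"] by simp

lemma G_scale: "(x, y) \<in> G \<Longrightarrow> (c \<cdot> x, c \<cdot> y) \<in> G"
  using G_lin[of x y x y c 0] by simp

lemma G_0: "(0, 0) \<in> G"
proof -
  obtain x y where "(x, y) \<in> G" using G_range[of 1 0] by auto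
  then show ?thesis using G_scale[of x y 0] by simp
qed

lemma G_sum: "(\<And>i. i \<in> I \<Longrightarrow> (f i, g i) \<in> G) \<Longrightarrow> (sum f I, sum g I) \<in> G"
proof (induction I rule: infinite_finite_induct)
  case (insert i I)
  then show ?case using G_lin[of "f i" "g i" "sum f I" "sum g I" 1 1] by simp
qed (auto simp: G_0)

text \<open>Pairing x - y = h A x with x and using dissipativity gives \<open>(nm x)\<^sup>2\<close>
  at most Re (ip y x).\<close>

lemma euler_step_contraction:
  assumes h: "0 < h" and y: "y \<in> V" and G: "(x, of_real (1 / h) \<cdot> (x - y)) \<in> G"
  shows "nm x \<le> nm y"
proof -
  have x: "x \<in> V" using G G_V by blast
  have "Re (ip (of_real (1 / h) \<cdot> (x - y)) x) \<le> 0" by (rule dissipative[OF G_deriv[OF G]])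
  then have "Re (ip (x - y) x) \<le> 0"
    using h x y by (simp add: ip_scale divide_le_0_iff)
  then have "nm x * nm x \<le> nm y * nm x"
    using Re_ip_le[OF y x] x y nm_sq[OF x] by (simp add: ip_diff power2_eq_square)
  then show ?thesis
    using nm_ge_0[OF x] nm_ge_0[OF y] by (smt (verit) mult_le_cancel_right)
qed

text \<open>Two regimes: if Re \<mu> is at most K/2, the bound on the imaginary axis absorbs the
  real part as a perturbation and keeps half of its constant; if Re \<mu> is larger, dissipativity
  alone gives the factor Re \<mu>.\<close>

lemma half_plane_lower:
  assumes G: "(x, y) \<in> G" and \<mu>: "0 \<le> Re \<mu>"
  shows "K / 2 * nm x \<le> nm (\<mu> \<cdot> x - y)"
proof (cases "Re \<mu> \<le> K / 2")
  case True
  have V: "x \<in> V" "y \<in> V" using G G_V by auto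
  have "\<mu> \<cdot> x = of_real (Re \<mu>) \<cdot> x + (\<i> * of_real (Im \<mu>)) \<cdot> x"
    by (simp only: scale_left_distrib[symmetric] complex_eq[symmetric])
  then have e: "(\<i> * of_real (Im \<mu>)) \<cdot> x - y = \<mu> \<cdot> x - y - of_real (Re \<mu>) \<cdot> x"
    by simp
  have "nm ((\<i> * of_real (Im \<mu>)) \<cdot> x - y) \<le> nm (\<mu> \<cdot> x - y) + nm (of_real (Re \<mu>) \<cdot> x)"
    unfolding e using V nm_triangle[of "\<mu> \<cdot> x - y" "- (of_real (Re \<mu>) \<cdot> x)"] by simp
  moreover have "nm (of_real (Re \<mu>) \<cdot> x) \<le> K / 2 * nm x"
    unfolding nm_scale[OF V(1)] using V \<mu> True by (intro mult_right_mono) auto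
  ultimately show ?thesis using G_lower[OF G, of "Im \<mu>"] by simp
next
  case False
  have V: "x \<in> V" "y \<in> V" using G G_V by auto
  have "Im (ip x x) = 0" using ip_sym[OF V(1) V(1)] by (metis Reals_cnj_iff complex_is_Real_iff)
  then have "Re (ip (\<mu> \<cdot> x - y) x) = Re \<mu> * (nm x)\<^sup>2 - Re (ip y x)"
    using V by (simp add: ip_diff ip_scale nm_sq)
  then have "Re \<mu> * (nm x)\<^sup>2 \<le> nm (\<mu> \<cdot> x - y) * nm x"
    using dissipative[OF G_deriv[OF G]] Re_ip_le[of "\<mu> \<cdot> x - y" x] V by auto
  moreover have "K / 2 * (nm x)\<^sup>2 \<le> Re \<mu> * (nm x)\<^sup>2"
    using False by (intro mult_right_mono) auto
  ultimately have "(K / 2 * nm x) * nm x \<le> nm (\<mu> \<cdot> x - y) * nm x"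
    by (simp add: power2_eq_square)
  then show ?thesis
    using V nm_ge_0[of x] nm_ge_0[of "\<mu> \<cdot> x - y"] by (smt (verit) V_closed mult_le_cancel_right mult_eq_0_iff)
qed

section \<open>The backward Euler scheme\<close>

definition euler :: "real \<Rightarrow> (nat \<Rightarrow> 'v) \<Rightarrow> bool" where
  "euler h x \<longleftrightarrow> x 0 \<in> V \<and> (\<forall>k. (x (Suc k), of_real (1 / h) \<cdot> (x (Suc k) - x k)) \<in> G)"

lemma euler_exists:
  assumes "0 < h" "y \<in> V"
  obtains x where "euler h x" "x 0 = y"
proof -
  define x where "x = rec_nat y (\<lambda>_ z. SOME x. (x, of_real (1 / h) \<cdot> (x - z)) \<in> G)"
  have x0: "x 0 = y" and xS: "x (Suc k) = (SOME z. (z, of_real (1 / h) \<cdot> (z - x k)) \<in> G)" for k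
    by (auto simp: x_def)
  have G: "(x (Suc k), of_real (1 / h) \<cdot> (x (Suc k) - x k)) \<in> G" if "x k \<in> V" for k
    unfolding xS using G_range[OF assms(1) that] by (rule someI_ex)
  have V: "x k \<in> V" for k
    by (induction k) (use G G_V x0 assms in auto)
  show ?thesis by (rule that[of x]) (use G V x0 in \<open>auto simp: euler_def\<close>)
qed

lemma euler_V: "euler h x \<Longrightarrow> x k \<in> V"
  by (cases k) (auto simp: euler_def dest: G_V)

lemma euler_decreasing:
  assumes "0 < h" "euler h x" "i \<le> j"
  shows "nm (x j) \<le> nm (x i)"
  using assms(3)
proof (induction rule: dec_induct)
  case (step n)
  have "nm (x (Suc n)) \<le> nm (x n)"
    using assms euler_V[OF assms(2)] by (intro euler_step_contraction) (auto simp: euler_def)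
  then show ?case using step by simp
qed simp

text \<open>The transforms satisfy (\<mu> - A) X = (w/h) D, where D comes from the increments of the
  hat function. The half-plane bound and Parseval compare the sum of
  \<open>(nm (chi k x k))\<^sup>2\<close> with that of \<open>(nm (d k x k))\<^sup>2\<close>; the
  latter is at most N \<open>(nm (x 0))\<^sup>2\<close>, since the norms decrease and the increments
  are bounded by 1.\<close>

lemma euler_decay:
  assumes h: "0 < h" and e: "euler h x" and p: "0 < (p::nat)"
  shows "(K / 2 * h * real p)\<^sup>2 * (nm (x (4 * p)))\<^sup>2 \<le> 2 * (nm (x 0))\<^sup>2"
proof -
  define N where "N = 4 * p"
  define chi where "chi k = real (min k (N - k))" for k
  define w where "w j = cis (2 * pi * real j / real N)" for j
  define d where "d k = chi (Suc k) - chi k" for k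
  \<comment> \<open>The value of the generator at \<open>x k\<close> for positive k. At k = 0
    truncated subtraction makes it 0, harmless because \<open>chi 0 = 0\<close>.\<close>
  define a where "a k = of_real (1 / h) \<cdot> (x k - x (k - 1))" for k
  define X where "X j = (\<Sum>k<N. w j ^ k \<cdot> (of_real (chi k) \<cdot> x k))" for j
  define D where "D j = (\<Sum>k<N. w j ^ k \<cdot> (of_real (d k) \<cdot> x k))" for j
  define A where "A j = (\<Sum>k<N. w j ^ k \<cdot> (of_real (chi k) \<cdot> a k))" for j
  have xV: "x k \<in> V" for k by (rule euler_V[OF e])
  let ?D = "\<lambda>k. (nm (of_real (d k) \<cdot> x k))\<^sup>2"
  let ?X = "\<lambda>k. (nm (of_real (chi k) \<cdot> x k))\<^sup>2"
  have chi0: "chi 0 = 0" "chi N = 0" by (auto simp: chi_def)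
  have ag: "(of_real (chi k) \<cdot> x k, of_real (chi k) \<cdot> a k) \<in> G" for k
  proof (cases k)
    case 0
    then show ?thesis using chi0 G_0 by simp
  next
    case (Suc l)
    then show ?thesis using e by (intro G_scale) (auto simp: euler_def a_def)
  qed
  have XA: "(X j, A j) \<in> G" for j
    unfolding X_def A_def by (intro G_sum G_scale ag)
  have hA: "(\<Sum>k<N. w j ^ k \<cdot> (of_real (chi k) \<cdot> x (k - 1))) = w j \<cdot> (X j + D j)" for j
  proof -
    define f where "f k = w j ^ k \<cdot> (of_real (chi k) \<cdot> x (k - 1))" for k
    \<comment> \<open>Both end terms vanish with \<open>chi\<close>, so the index shift costs
      nothing but a factor \<open>w j\<close>.\<close>
    have "f 0 + (\<Sum>k<N. f (Suc k)) = (\<Sum>k<N. f k) + f N"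
      by (metis sum.lessThan_Suc sum.lessThan_Suc_shift)
    then have "(\<Sum>k<N. f k) = (\<Sum>k<N. f (Suc k))" using chi0 by (simp add: f_def)
    also have "\<dots> = (\<Sum>k<N. w j \<cdot> (w j ^ k \<cdot> (of_real (chi k) \<cdot> x k) + w j ^ k \<cdot> (of_real (d k) \<cdot> x k)))"
      by (simp add: f_def d_def algebra_simps)
    also have "\<dots> = w j \<cdot> (X j + D j)"
      by (simp add: X_def D_def scale_sum_right[symmetric] sum.distrib[symmetric])
    finally show ?thesis by (simp add: f_def)
  qed
  have Aeq: "A j = of_real (1 / h) \<cdot> (X j - w j \<cdot> (X j + D j))" for j
    unfolding hA[symmetric] unfolding A_def X_def a_def
    by (simp add: scale_sum_right sum_subtractf[symmetric] algebra_simps)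
  have DV: "D j \<in> V" for j using xV by (auto simp: D_def)
  have le: "(K / 2 * h)\<^sup>2 * (nm (X j))\<^sup>2 \<le> (nm (D j))\<^sup>2" for j
  proof -
    \<comment> \<open>The symbol of the backward difference quotient; its real part is nonnegative
      because \<open>w j\<close> lies on the unit circle.\<close>
    let ?\<mu> = "(1 - w j) / of_real h"
    have "Re (w j) \<le> 1" using complex_Re_le_cmod[of "w j"] by (simp add: w_def)
    then have "0 \<le> Re ?\<mu>" using h by simp
    then have "K / 2 * nm (X j) \<le> nm (?\<mu> \<cdot> X j - A j)" by (rule half_plane_lower[OF XA])
    also have "?\<mu> \<cdot> X j - A j = (w j / of_real h) \<cdot> D j"
      unfolding Aeq by (simp add: algebra_simps diff_divide_distrib)
    also have "nm \<dots> = nm (D j) / h" using DV h by (simp add: nm_scale norm_divide w_def)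
    finally have "K / 2 * h * nm (X j) \<le> nm (D j)" using h by (simp add: field_simps)
    moreover have "0 \<le> K / 2 * h * nm (X j)" using K_pos h XA[of j] G_V by (intro mult_nonneg_nonneg) auto
    ultimately have "(K / 2 * h * nm (X j))\<^sup>2 \<le> (nm (D j))\<^sup>2" by (rule power_mono)
    then show ?thesis by (simp only: power_mult_distrib)
  qed
  have "(K / 2 * h)\<^sup>2 * (\<Sum>j<N. (nm (X j))\<^sup>2) \<le> (\<Sum>j<N. (nm (D j))\<^sup>2)"
    unfolding sum_distrib_left by (intro sum_mono le)
  moreover have "(\<Sum>j<N. (nm (X j))\<^sup>2) = N * (\<Sum>k<N. ?X k)"
    unfolding X_def w_def using xV by (intro discrete_parseval) auto
  moreover have "(\<Sum>j<N. (nm (D j))\<^sup>2) = N * (\<Sum>k<N. ?D k)"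
    unfolding D_def w_def using xV by (intro discrete_parseval) auto
  ultimately have "real N * ((K / 2 * h)\<^sup>2 * (\<Sum>k<N. ?X k))
      \<le> real N * (\<Sum>k<N. ?D k)"
    by (simp add: mult_ac)
  then have main: "(K / 2 * h)\<^sup>2 * (\<Sum>k<N. ?X k) \<le> (\<Sum>k<N. ?D k)"
    using p by (simp add: N_def)
  have "(\<Sum>k<N. ?D k) \<le> (\<Sum>k<N. (nm (x 0))\<^sup>2)"
  proof (intro sum_mono power_mono)
    fix k
    have "\<bar>d k\<bar> \<le> 1" by (auto simp: d_def chi_def min_def)
    then have "nm (of_real (d k) \<cdot> x k) \<le> 1 * nm (x k)"
      using xV by (simp add: nm_scale mult_left_le_one_le)
    then show "nm (of_real (d k) \<cdot> x k) \<le> nm (x 0)" using euler_decreasing[OF h e, of 0 k] by simp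
  qed (use xV in auto)
  then have up: "(\<Sum>k<N. ?D k) \<le> real N * (nm (x 0))\<^sup>2" by simp
  \<comment> \<open>On the middle half of the 4 p indices the hat is at least p and every norm is at
    least the final one.\<close>
  have "real (2 * p) * (real p * nm (x N))\<^sup>2 = (\<Sum>k\<in>{p..<3*p}. (real p * nm (x N))\<^sup>2)" by simp
  also have "\<dots> \<le> (\<Sum>k\<in>{p..<3*p}. ?X k)"
  proof (intro sum_mono power_mono)
    fix k assume k: "k \<in> {p..<3*p}"
    have "real p \<le> chi k" using k by (auto simp: chi_def N_def)
    moreover have "nm (x N) \<le> nm (x k)" using k by (intro euler_decreasing[OF h e]) (auto simp: N_def)
    ultimately have "real p * nm (x N) \<le> chi k * nm (x k)"
      using xV by (intro mult_mono) (auto simp: chi_def)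
    then show "real p * nm (x N) \<le> nm (of_real (chi k) \<cdot> x k)"
      using xV by (simp add: nm_scale chi_def)
  qed (use xV in auto)
  also have "\<dots> \<le> (\<Sum>k<N. ?X k)"
    by (intro sum_mono2) (auto simp: N_def)
  finally have "(K / 2 * h)\<^sup>2 * (real (2 * p) * (real p * nm (x N))\<^sup>2) \<le> real N * (nm (x 0))\<^sup>2"
    using main up by (meson mult_left_mono order_trans zero_le_power2)
  \<comment> \<open>N = 4 p terms on the right against 2 p terms on the left leave the factor
    2.\<close>
  then have "real (2 * p) * ((K / 2 * h * real p)\<^sup>2 * (nm (x N))\<^sup>2) \<le> real (2 * p) * (2 * (nm (x 0))\<^sup>2)"
    by (simp add: N_def) (simp add: power2_eq_square mult_ac)
  then show ?thesis
    using p by (subst (asm) mult_le_cancel_left_pos) (auto simp: N_def)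
qed

text \<open>Consistency plus stability: for data in the domain of the squared generator each step
  errs by at most \<open>h * h * nm b0\<close>, and contractivity lets the errors merely add
  up.\<close>

lemma euler_approximates:
  assumes h: "0 < h" and e: "euler h x" and a0: "(x 0, a0) \<in> G" and b0: "(a0, b0) \<in> G"
  shows "nm (S (real n * h) (x 0) - x n) \<le> real n * (h * h * nm b0)"
proof -
  \<comment> \<open>\<open>a k\<close> and the following \<open>b k\<close> are A and its square
    applied to \<open>x k\<close>. Both are again Euler sequences, so \<open>nm (b k)\<close> never
    exceeds \<open>nm b0\<close>.\<close>
  define a where "a k = (case k of 0 \<Rightarrow> a0 | Suc l \<Rightarrow> of_real (1 / h) \<cdot> (x (Suc l) - x l))" for k
  define b where "b k = (case k of 0 \<Rightarrow> b0 | Suc l \<Rightarrow> of_real (1 / h) \<cdot> (a (Suc l) - a l))" for k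
  have aS: "a (Suc l) = of_real (1 / h) \<cdot> (x (Suc l) - x l)"
    and bS: "b (Suc l) = of_real (1 / h) \<cdot> (a (Suc l) - a l)" for l
    by (auto simp: a_def b_def)
  have xa: "(x k, a k) \<in> G" for k
    using e a0 by (cases k) (auto simp: a_def euler_def)
  have ab: "(a k, b k) \<in> G" for k
  proof (cases k)
    case (Suc l)
    show ?thesis unfolding Suc bS
      by (subst aS) (intro G_scale G_diff xa)
  qed (use b0 in \<open>simp add: a_def b_def\<close>)
  have V: "x k \<in> V" "a k \<in> V" "b k \<in> V" for k using xa ab G_V by blast+
  have bdec: "nm (b k) \<le> nm b0" for k
  proof (induction k)
    case (Suc k)
    have "(b (Suc k), of_real (1 / h) \<cdot> (b (Suc k) - b k)) \<in> G"
      by (subst bS) (intro G_scale G_diff ab)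
    then show ?case using euler_step_contraction[OF h V(3)] Suc by fastforce
  qed (simp add: b_def)
  have step: "nm (S h (x k) - x (Suc k)) \<le> h * h * nm b0" for k
  proof -
    let ?x = "x (Suc k)" and ?a = "a (Suc k)"
    \<comment> \<open>Since \<open>x k\<close> equals \<open>?x\<close> minus h times
      \<open>?a\<close>, this expression is S h (x k) minus \<open>?x\<close> up to seminorm zero;
      the comparison vector is therefore the end value \<open>S h ?a\<close>.\<close>
    have "nm (S h ?x - ?x - of_real h \<cdot> S h ?a) \<le> h * (h * nm b0)"
    proof (rule mean_value[OF G_deriv[OF xa]])
      fix s assume s: "0 \<le> s" "s \<le> h"
      have "nm (S s ?a - S h ?a) \<le> nm (S s ?a - S s (S (h - s) ?a)) + nm (S s (S (h - s) ?a) - S h ?a)"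
        using s V by (intro nm_diff_triangle) auto
      also have "nm (S s (S (h - s) ?a) - S h ?a) = 0"
        using S_add[of s "h - s" ?a] s V nm_minus_commute[of "S s (S (h - s) ?a)" "S h ?a"] by simp
      also have "nm (S s ?a - S s (S (h - s) ?a)) \<le> nm (?a - S (h - s) ?a)"
        using s V by (intro S_diff) auto
      also have "\<dots> = nm (S (h - s) ?a - ?a)" using s V by (intro nm_minus_commute) auto
      also have "\<dots> \<le> (h - s) * nm (b (Suc k))" using s by (intro S_orbit_diff G_deriv ab) auto
      also have "\<dots> \<le> h * nm b0" using s bdec V by (intro mult_mono) auto
      finally show "nm (S s ?a - S h ?a) \<le> h * nm b0" by simp
    qed (use h V in auto)
    moreover have "nm (S h (x k) - (S h ?x - of_real h \<cdot> S h ?a)) = 0"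
    proof -
      have "x k = 1 \<cdot> ?x + (- of_real h) \<cdot> ?a" using h by (simp add: aS)
      then show ?thesis using S_lin[of h ?x ?a 1 "- of_real h"] h V by simp
    qed
    moreover have "nm (S h (x k) - ?x) \<le> nm (S h (x k) - (S h ?x - of_real h \<cdot> S h ?a)) + nm (S h ?x - of_real h \<cdot> S h ?a - ?x)"
      using h V by (intro nm_diff_triangle) auto
    moreover have "S h ?x - of_real h \<cdot> S h ?a - ?x = S h ?x - ?x - of_real h \<cdot> S h ?a" by simp
    ultimately show ?thesis by simp
  qed
  show ?thesis
  proof (induction n)
    case 0
    then show ?case using S_0[OF V(1)] by simp
  next
    case (Suc n)
    let ?t = "real n * h"
    have t: "0 \<le> ?t" using h by simp
    have eq: "real (Suc n) * h = h + ?t" by (simp add: algebra_simps)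
    have "nm (S (h + ?t) (x 0) - x (Suc n)) \<le> nm (S (h + ?t) (x 0) - S h (S ?t (x 0))) + nm (S h (S ?t (x 0)) - x (Suc n))"
      using t h V by (intro nm_diff_triangle) auto
    also have "nm (S h (S ?t (x 0)) - x (Suc n)) \<le> nm (S h (S ?t (x 0)) - S h (x n)) + nm (S h (x n) - x (Suc n))"
      using t h V by (intro nm_diff_triangle) auto
    also have "nm (S h (S ?t (x 0)) - S h (x n)) \<le> nm (S ?t (x 0) - x n)"
      using t h V by (intro S_diff) auto
    finally show ?case
      unfolding eq using Suc step[of n] S_add[of h ?t "x 0"] t h V by (simp add: algebra_simps)
  qed
qed

section \<open>Density of the domain and of the domain of the square\<close>

text \<open>The approximant z solves z - h A z = y instead of being a time average of the orbit.
  Over the time \<tau> h the orbit of z moves by about \<tau> (z - y), while strong continuity keeps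
  the orbit of y near y; comparing the two forces z close to y.\<close>

lemma domain_dense:
  assumes y: "y \<in> V" and e: "0 < e"
  shows "\<exists>x a. (x, a) \<in> G \<and> nm (x - y) < e"
proof -
  \<comment> \<open>Chosen so that 2 \<tau> \<open>nm y\<close> is at most e/2, and then \<epsilon>
    so that \<epsilon> (1 + \<tau>) = \<tau> e/4; the final bound is 3e/4.\<close>
  define \<tau> where "\<tau> = e / (4 * (nm y + 1))"
  define \<epsilon> where "\<epsilon> = e * \<tau> / (4 * (1 + \<tau>))"
  have ny: "0 \<le> nm y" using y by simp
  have \<tau>: "0 < \<tau>" and \<tau>2: "2 * \<tau> * nm y \<le> e / 2"
    using e ny by (auto simp: \<tau>_def field_simps)
  have \<epsilon>: "0 < \<epsilon>" "\<epsilon> * (1 + \<tau>) = \<tau> * (e / 4)" using e \<tau> by (auto simp: \<epsilon>_def field_simps)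
  have "\<forall>\<^sub>F t in at_right 0. nm (S t y - y) < \<epsilon>"
    using S_cont[OF y] \<epsilon>(1) by (rule order_tendstoD)
  then obtain \<delta> where \<delta>: "0 < \<delta>" "\<And>t. \<lbrakk>0 < t; t < \<delta>\<rbrakk> \<Longrightarrow> nm (S t y - y) < \<epsilon>"
    by (auto simp: eventually_at_right_field)
  \<comment> \<open>Makes \<tau> h = \<delta>/2, so the orbit of \<open>y\<close> stays within
    \<epsilon> of \<open>y\<close> during the whole comparison time.\<close>
  define h where "h = \<delta> / (2 * \<tau>)"
  have h: "0 < h" "\<tau> * h < \<delta>" "0 < \<tau> * h" using \<delta>(1) \<tau> by (auto simp: h_def)
  have near: "nm (S s y - y) \<le> \<epsilon>" if "0 \<le> s" "s \<le> \<tau> * h" for s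
    using that \<delta>(2)[of s] S_0[OF y] \<epsilon>(1) h by (cases "s = 0") auto
  obtain z where z: "(z, of_real (1 / h) \<cdot> (z - y)) \<in> G" using G_range[OF h(1) y] by auto
  let ?a = "of_real (1 / h) \<cdot> (z - y)"
  let ?t = "\<tau> * h"
  have zV: "z \<in> V" using z G_V by auto
  have nzy: "nm z \<le> nm y" by (rule euler_step_contraction[OF h(1) y z])
  have na: "nm ?a \<le> 2 * nm y / h"
  proof -
    have "nm (z - y) \<le> nm z + nm y" using zV y by (rule nm_diff_le)
    then have "nm (z - y) / h \<le> 2 * nm y / h" using nzy h by (intro divide_right_mono) auto
    then show ?thesis using h zV y by (simp add: nm_scale norm_divide)
  qed
  have "nm (S ?t z - z - of_real ?t \<cdot> ?a) \<le> ?t * ((2 * \<tau> * nm y + \<epsilon>) / h)"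
  proof (rule mean_value[OF G_deriv[OF z]])
    fix s assume s: "0 \<le> s" "s \<le> ?t"
    let ?d = "(S s z - z) - (S s y - y)"
    let ?l = "S s ?a - (of_real (1 / h) \<cdot> S s z + (- of_real (1 / h)) \<cdot> S s y)"
    have "nm (S s z - z) \<le> s * nm ?a" by (rule S_orbit_diff[OF G_deriv[OF z] s(1)])
    also have "\<dots> \<le> ?t * (2 * nm y / h)" using s na zV y by (intro mult_mono) auto
    finally have 1: "nm (S s z - z) \<le> 2 * \<tau> * nm y" using h by simp
    have "S s ?a - ?a = (?l) +
         of_real (1 / h) \<cdot> (?d)"
      by (simp add: algebra_simps)
    then have "nm (S s ?a - ?a) = nm ((?l) +
         of_real (1 / h) \<cdot> (?d))"
      by (rule arg_cong)
    moreover have "\<dots> \<le> nm (?l) +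
         nm (of_real (1 / h) \<cdot> (?d))"
      using s zV y by (intro nm_triangle) auto
    moreover have "nm (?l) = 0"
      using S_lin[of s z y "of_real (1 / h)" "- of_real (1 / h)"] s zV y by (simp add: algebra_simps)
    moreover have "nm (?d) \<le> nm (S s z - z) + nm (S s y - y)"
      using s zV y by (intro nm_diff_le) auto
    moreover have "nm (of_real (1 / h) \<cdot> (?d)) = nm (?d) / h"
      using s zV y h by (subst nm_scale) (auto simp: norm_divide)
    ultimately have "nm (S s ?a - ?a) \<le> nm (?d) / h" by linarith
    also have "\<dots> \<le> (2 * \<tau> * nm y + \<epsilon>) / h"
      using \<open>nm (?d) \<le> _\<close> 1 near[OF s] h by (intro divide_right_mono) auto
    finally show "nm (S s ?a - ?a) \<le> (2 * \<tau> * nm y + \<epsilon>) / h" .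
  qed (use h zV y in auto)
  then have mv: "nm (S ?t z - z - of_real \<tau> \<cdot> (z - y)) \<le> \<tau> * (2 * \<tau> * nm y + \<epsilon>)"
    using h by simp
  have "nm (S ?t z - y) \<le> nm (S ?t z - S ?t y) + nm (S ?t y - y)"
    using h zV y by (intro nm_diff_triangle) auto
  also have "\<dots> \<le> nm (z - y) + \<epsilon>"
    using S_diff[of ?t z y] near[of ?t] h zV y by (intro add_mono) auto
  finally have 2: "nm (S ?t z - y) \<le> nm (z - y) + \<epsilon>" .
  \<comment> \<open>The left side carries 1 + \<tau> copies of z - y and the bound on the right only
    one; the surplus \<tau> gives the estimate.\<close>
  have "of_real (1 + \<tau>) \<cdot> (z - y) = (S ?t z - y) - (S ?t z - z - of_real \<tau> \<cdot> (z - y))"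
    by (simp add: algebra_simps)
  also have "nm \<dots> \<le> nm (S ?t z - y) + nm (S ?t z - z - of_real \<tau> \<cdot> (z - y))"
    using h zV y by (intro nm_diff_le) auto
  finally have "(1 + \<tau>) * nm (z - y) \<le> nm (z - y) + \<epsilon> + \<tau> * (2 * \<tau> * nm y + \<epsilon>)"
    using 2 mv zV y \<tau> nm_scale[of "z - y" "of_real (1 + \<tau>)"]
    by (simp del: of_real_add)
  then have "\<tau> * nm (z - y) \<le> \<epsilon> * (1 + \<tau>) + \<tau> * (2 * \<tau> * nm y)"
    by (simp add: algebra_simps)
  then have "\<tau> * nm (z - y) \<le> \<tau> * (e / 4 + 2 * \<tau> * nm y)"
    unfolding \<epsilon>(2) by (simp add: algebra_simps)
  then have "nm (z - y) \<le> e / 4 + 2 * \<tau> * nm y" using \<tau> by simp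
  then show ?thesis using z \<tau>2 e by (intro exI[of _ z] exI[of _ ?a]) auto
qed

text \<open>A resolvent step from a domain element d gives z with A z = (z - d)/h, which lies in the
  domain because z and d do. The difference z - d is itself the resolvent step from h g with g = A
  d, hence has seminorm at most h \<open>nm g\<close>.\<close>

lemma domain_square_dense:
  assumes y: "y \<in> V" and e: "0 < e"
  shows "\<exists>x a b. (x, a) \<in> G \<and> (a, b) \<in> G \<and> nm (x - y) < e"
proof -
  obtain d g where d: "(d, g) \<in> G" "nm (d - y) < e / 2"
    using domain_dense[OF y, of "e / 2"] e by auto
  have V: "d \<in> V" "g \<in> V" using d G_V by auto
  define h where "h = e / (2 * (nm g + 1))"
  have ng: "0 \<le> nm g" using V by simp
  have h: "0 < h" using e ng by (simp add: h_def)
  obtain z where z: "(z, of_real (1 / h) \<cdot> (z - d)) \<in> G" using G_range[OF h V(1)] by auto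
  have zV: "z \<in> V" using z G_V by auto
  have "(z - d, of_real (1 / h) \<cdot> (z - d) - g) \<in> G" by (rule G_diff[OF z d(1)])
  moreover have "of_real (1 / h) \<cdot> (z - d) - g = of_real (1 / h) \<cdot> (z - d - of_real h \<cdot> g)"
    using h by (simp add: algebra_simps)
  ultimately have "nm (z - d) \<le> nm (of_real h \<cdot> g)"
    using V by (intro euler_step_contraction[OF h]) auto
  also have "\<dots> = h * nm g" using h V by (simp add: nm_scale)
  also have "\<dots> \<le> e / 2" using e ng by (simp add: h_def field_simps)
  finally have "nm (z - y) < e" using nm_diff_triangle[of z d y] zV V y d by simp
  moreover have "(of_real (1 / h) \<cdot> (z - d), of_real (1 / h) \<cdot> (of_real (1 / h) \<cdot> (z - d) - g)) \<in> G"
    by (intro G_scale G_diff z d)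
  ultimately show ?thesis using z by blast
qed

text \<open>With N = 4 p and N h = 24/K, the factor K/2 h p in \<open>euler_decay\<close> is 3, and
  9 \<open>(nm (x N))\<^sup>2\<close> at most 2 \<open>(nm (x 0))\<^sup>2\<close> implies halving.
  The Euler error vanishes as p grows, first for data in the domain of the square, then for all
  vectors by density.\<close>

theorem halving_time:
  "\<exists>\<tau>>0. \<forall>x\<in>V. nm (S \<tau> x) \<le> nm x / 2"
proof (intro exI[of _ "24 / K"] conjI ballI)
  let ?\<tau> = "24 / K"
  show \<tau>: "0 < ?\<tau>" using K_pos by simp
  have half: "nm (S ?\<tau> x) \<le> nm x / 2" if xa: "(x, a) \<in> G" and ab: "(a, b) \<in> G" for x a b
  proof -
    have V: "x \<in> V" "a \<in> V" "b \<in> V" using xa ab G_V by auto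
    have le: "nm (S ?\<tau> x) \<le> nm x / 2 + ?\<tau> * ?\<tau> * nm b / 4 / real (Suc q)" for q
    proof -
      let ?p = "Suc q"
      define h where "h = ?\<tau> / real (4 * ?p)"
      have h: "0 < h" "real (4 * ?p) * h = ?\<tau>" "K / 2 * h * real ?p = 3"
        using K_pos by (simp_all add: h_def divide_simps)
      obtain z where z: "euler h z" "z 0 = x" using euler_exists[OF h(1) V(1)] .
      have "3\<^sup>2 * (nm (z (4 * ?p)))\<^sup>2 \<le> 2 * (nm x)\<^sup>2"
        using euler_decay[OF h(1) z(1), of ?p] unfolding h(3) z(2) by simp
      then have "(2 * nm (z (4 * ?p)))\<^sup>2 \<le> (nm x)\<^sup>2"
        using zero_le_power2[of "nm x"] unfolding power_mult_distrib power2_eq_square[of 3] power2_eq_square[of 2]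
        by linarith
      then have 1: "2 * nm (z (4 * ?p)) \<le> nm x" by (rule power2_le_imp_le) (use V in auto)
      have "nm (S ?\<tau> x - z (4 * ?p)) \<le> real (4 * ?p) * (h * h * nm b)"
        using euler_approximates[OF h(1) z(1), of a b "4 * ?p"] xa ab z(2) unfolding h(2) by simp
      also have "\<dots> = (real (4 * ?p) * h) * h * nm b" by (simp only: mult.assoc)
      also have "\<dots> = ?\<tau> * h * nm b" unfolding h(2) ..
      also have "\<dots> = ?\<tau> * ?\<tau> * nm b / 4 / real ?p"
        by (simp only: h_def of_nat_mult of_nat_numeral divide_divide_eq_left times_divide_eq_left times_divide_eq_right)
      finally have "nm (S ?\<tau> x - z (4 * ?p)) \<le> ?\<tau> * ?\<tau> * nm b / 4 / real ?p" .
      moreover have "nm (S ?\<tau> x) \<le> nm (z (4 * ?p)) + nm (S ?\<tau> x - z (4 * ?p))"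
        using V \<tau> euler_V[OF z(1)] by (intro nm_le_diff) auto
      ultimately show ?thesis using 1 by simp
    qed
    have "(\<lambda>q. ?\<tau> * ?\<tau> * nm b / 4 / real (Suc q)) \<longlonglongrightarrow> 0"
      by (rule LIMSEQ_Suc) (rule lim_const_over_n)
    then have "(\<lambda>q. nm x / 2 + ?\<tau> * ?\<tau> * nm b / 4 / real (Suc q)) \<longlonglongrightarrow> nm x / 2 + 0"
      by (intro tendsto_intros)
    then show ?thesis
      using le by (intro tendsto_lowerbound[of "\<lambda>q. nm x / 2 + ?\<tau> * ?\<tau> * nm b / 4 / real (Suc q)"]) auto
  qed
  fix y assume y: "y \<in> V"
  show "nm (S ?\<tau> y) \<le> nm y / 2"
  proof (rule field_le_epsilon)
    fix e :: real assume "0 < e"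
    then obtain x a b where x: "(x, a) \<in> G" "(a, b) \<in> G" "nm (x - y) < e / 2"
      using domain_square_dense[OF y, of "e / 2"] by auto
    have xV: "x \<in> V" using x G_V by auto
    have "nm (S ?\<tau> y) \<le> nm (S ?\<tau> x) + nm (S ?\<tau> y - S ?\<tau> x)"
      using y xV \<tau> by (intro nm_le_diff) auto
    also have "nm (S ?\<tau> y - S ?\<tau> x) \<le> nm (y - x)" using y xV \<tau> by (intro S_diff) auto
    also have "nm (y - x) = nm (x - y)" using y xV by (rule nm_minus_commute)
    finally have "nm (S ?\<tau> y) \<le> nm x / 2 + nm (x - y)" using half[OF x(1,2)] by simp
    moreover have "nm x \<le> nm y + nm (x - y)" using y xV by (intro nm_le_diff)
    ultimately show "nm (S ?\<tau> y) \<le> nm y / 2 + e" using x(3) \<open>0 < e\<close> by linarith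
  qed
qed

end

section \<open>Absolutely continuous functions on an interval\<close>

lemma integrable_lebesgue_on_Icc_iff:
  fixes f :: "real \<Rightarrow> 'a::euclidean_space"
  shows "integrable (lebesgue_on {a<..<b}) f \<longleftrightarrow> f absolutely_integrable_on {a..b}"
proof -
  have "integrable (lebesgue_on {a<..<b}) f \<longleftrightarrow> f absolutely_integrable_on {a<..<b}"
    by (simp add: set_integrable_def integrable_restrict_space)
  also have "\<dots> \<longleftrightarrow> f absolutely_integrable_on {a..b}"
    using absolutely_integrable_on_open_interval[of a b f] by simp
  finally show ?thesis .
qed

lemma integral_lebesgue_on_Icc:
  fixes f :: "real \<Rightarrow> 'a::euclidean_space"
  assumes "integrable (lebesgue_on {a<..<b}) f"
  shows "(LINT x|lebesgue_on {a<..<b}. f x) = integral {a..b} f"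
  using lebesgue_integral_eq_integral[OF assms] integral_open_interval_real[of a b f] by simp

lemma finite_measure_lebesgue_on_Ioo: "finite_measure (lebesgue_on {a<..<b::real})"
  by (rule finite_measure_lebesgue_on) simp

lemma continuous_on_Icc_measurable:
  fixes f :: "real \<Rightarrow> 'a::euclidean_space"
  assumes "continuous_on {a..b} f"
  shows "f \<in> borel_measurable (lebesgue_on {a<..<b})"
  by (rule continuous_imp_measurable_on_sets_lebesgue)
    (use assms in \<open>auto intro: continuous_on_subset\<close>)

lemma L2_integrable:
  assumes "f \<in> L2 a b"
  shows "integrable (lebesgue_on {a<..<b}) f"
proof -
  let ?M = "lebesgue_on {a<..<b}"
  interpret finite_measure "?M" by (rule finite_measure_lebesgue_on_Ioo)
  show ?thesis
  proof (rule Bochner_Integration.integrable_bound)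
    show "integrable (?M) (\<lambda>x. 1 + (norm (f x))\<^sup>2)"
      using assms by (intro Bochner_Integration.integrable_add) (auto simp: L2_def)
    show "f \<in> borel_measurable (?M)" using assms by (simp add: L2_def)
    have "y \<le> 1 + y\<^sup>2" for y :: real
      using zero_le_power2[of "y - 1 / 2"] unfolding power2_diff by (simp add: power_divide)
    then show "AE x in ?M. norm (f x) \<le> norm (1 + (norm (f x))\<^sup>2)"
      by (auto intro!: always_eventually)
  qed
qed

lemma L2_bound:
  assumes "f \<in> L2 a b" "g \<in> borel_measurable (lebesgue_on {a<..<b})"
    and "AE x in lebesgue_on {a<..<b}. norm (g x) \<le> C * norm (f x)"
  shows "g \<in> L2 a b"
  unfolding L2_def
proof (intro CollectI conjI assms(2))
  let ?M = "lebesgue_on {a<..<b}"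
  show "integrable (?M) (\<lambda>x. (norm (g x))\<^sup>2)"
  proof (rule Bochner_Integration.integrable_bound)
    show "integrable (?M) (\<lambda>x. C\<^sup>2 * (norm (f x))\<^sup>2)"
      using assms(1) by (simp add: L2_def)
    show "(\<lambda>x. (norm (g x))\<^sup>2) \<in> borel_measurable (?M)" using assms(2) by measurable
    show "AE x in ?M. norm ((norm (g x))\<^sup>2) \<le> norm (C\<^sup>2 * (norm (f x))\<^sup>2)"
      using assms(3) by eventually_elim (auto simp flip: power_mult_distrib intro: power_mono)
  qed
qed

lemma continuous_L2:
  fixes f :: "real \<Rightarrow> 'a::euclidean_space"
  assumes "continuous_on {a..b} f"
  shows "f \<in> L2 a b"
proof -
  interpret finite_measure "lebesgue_on {a<..<b}" by (rule finite_measure_lebesgue_on_Ioo)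
  have "bounded (f ` {a..b})"
    by (intro compact_imp_bounded compact_continuous_image assms) simp
  then obtain C where C: "\<And>x. x \<in> {a..b} \<Longrightarrow> norm (f x) \<le> C"
    by (meson bounded_iff imageI)
  show ?thesis
  proof (rule L2_bound)
    show "(\<lambda>_. 1 :: real) \<in> L2 a b" by (simp add: L2_def)
    show "AE x in lebesgue_on {a<..<b}. norm (f x) \<le> C * norm (1::real)"
      using C by (intro AE_I2) (auto simp: space_restrict_space)
  qed (rule continuous_on_Icc_measurable[OF assms])
qed

lemma L2_lin:
  fixes f g :: "real \<Rightarrow> 'a::{banach,second_countable_topology}"
  assumes "f \<in> L2 a b" "g \<in> L2 a b"
  shows "(\<lambda>x. f x + g x) \<in> L2 a b"
  unfolding L2_def
proof (intro CollectI conjI)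
  let ?M = "lebesgue_on {a<..<b}"
  show m: "(\<lambda>x. f x + g x) \<in> borel_measurable (?M)"
    using assms by (auto simp: L2_def)
  show "integrable (?M) (\<lambda>x. (norm (f x + g x))\<^sup>2)"
  proof (rule Bochner_Integration.integrable_bound)
    show "integrable (?M) (\<lambda>x. 2 * (norm (f x))\<^sup>2 + 2 * (norm (g x))\<^sup>2)"
      using assms by (auto simp: L2_def)
    show "(\<lambda>x. (norm (f x + g x))\<^sup>2) \<in> borel_measurable (?M)"
      using m by measurable
    have "(norm (x + y))\<^sup>2 \<le> 2 * (norm x)\<^sup>2 + 2 * (norm y)\<^sup>2" for x y :: 'a
    proof -
      have "(norm (x + y))\<^sup>2 \<le> (norm x + norm y)\<^sup>2"
        by (intro power_mono norm_triangle_ineq) auto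
      also have "\<dots> \<le> 2 * (norm x)\<^sup>2 + 2 * (norm y)\<^sup>2"
        using zero_le_power2[of "norm x - norm y"] by (simp add: power2_sum power2_diff)
      finally show ?thesis .
    qed
    then show "AE x in ?M. norm ((norm (f x + g x))\<^sup>2) \<le> norm (2 * (norm (f x))\<^sup>2 + 2 * (norm (g x))\<^sup>2)"
      by (auto intro!: always_eventually)
  qed
qed

text \<open>Absolute continuity in integrated form: \<open>v\<close> enters only up to null sets, as
  suits the almost-everywhere differential equations below, and pointwise derivatives never
  appear.\<close>

definition abs_cont_deriv :: "real \<Rightarrow> real \<Rightarrow> (real \<Rightarrow> 'v::euclidean_space) \<Rightarrow> (real \<Rightarrow> 'v) \<Rightarrow> bool" where
  "abs_cont_deriv a b u v \<longleftrightarrow> v absolutely_integrable_on {a..b} \<and> (\<forall>x\<in>{a..b}. u x = u a + integral {a..x} v)"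

lemma abs_cont_deriv_eq: "abs_cont_deriv a b u v \<Longrightarrow> x \<in> {a..b} \<Longrightarrow> u x = u a + integral {a..x} v"
  unfolding abs_cont_deriv_def by blast

lemma abs_cont_deriv_continuous:
  assumes "abs_cont_deriv a b u v"
  shows "continuous_on {a..b} u"
proof -
  have "continuous_on {a..b} (\<lambda>x. u a + integral {a..x} v)"
    using assms by (intro continuous_intros indefinite_integral_continuous_1)
      (simp add: abs_cont_deriv_def set_lebesgue_integral_eq_integral)
  then show ?thesis
    by (rule continuous_on_eq) (rule abs_cont_deriv_eq[OF assms, symmetric])
qed

lemma abs_cont_deriv_diff:
  assumes "abs_cont_deriv a b u v" "a \<le> x" "x \<le> y" "y \<le> b"
  shows "u y - u x = integral {x..y} v"
proof -
  have "v integrable_on {a..b}"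
    using assms by (auto simp: abs_cont_deriv_def set_lebesgue_integral_eq_integral)
  then have "v integrable_on {a..y}"
    by (rule integrable_on_subinterval) (use assms in auto)
  then have "integral {a..x} v + integral {x..y} v = integral {a..y} v"
    using assms by (intro Henstock_Kurzweil_Integration.integral_combine) auto
  moreover have "u x = u a + integral {a..x} v" "u y = u a + integral {a..y} v"
    using assms(2-) by (auto intro!: abs_cont_deriv_eq[OF assms(1)])
  ultimately show ?thesis by (metis add_diff_cancel_left add_diff_cancel_left')
qed

lemma bounded_bilinear_measurable:
  fixes B :: "'a::euclidean_space \<Rightarrow> 'b::euclidean_space \<Rightarrow> 'c::real_normed_vector"
  assumes "bounded_bilinear B" "f \<in> borel_measurable M" "g \<in> borel_measurable M"
  shows "(\<lambda>x. B (f x) (g x)) \<in> borel_measurable M"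
  using assms(2,3)
  by (rule borel_measurable_continuous_Pair) (intro bounded_bilinear.continuous_on[OF assms(1)] continuous_intros)

lemma absolutely_integrable_bilinear_continuous:
  fixes B :: "'a::euclidean_space \<Rightarrow> 'b::euclidean_space \<Rightarrow> 'c::euclidean_space" and a b :: real
  assumes B: "bounded_bilinear B" and f: "f absolutely_integrable_on {a..b}" and w: "continuous_on {a..b} w"
  shows "(\<lambda>s. B (f s) (w s)) absolutely_integrable_on {a..b}"
proof -
  let ?M = "lebesgue_on {a<..<b}"
  obtain K where K: "K > 0" "\<And>x y. norm (B x y) \<le> norm x * norm y * K"
    using bounded_bilinear.pos_bounded[OF B] by blast
  have "bounded (w ` {a..b})"
    by (intro compact_imp_bounded compact_continuous_image w) simp
  then obtain C where C: "\<And>x. x \<in> {a..b} \<Longrightarrow> norm (w x) \<le> C"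
    by (meson bounded_iff imageI)
  have "integrable (?M) (\<lambda>s. B (f s) (w s))"
  proof (rule Bochner_Integration.integrable_bound)
    have fi: "integrable (?M) f" using f by (simp add: integrable_lebesgue_on_Icc_iff)
    then show "integrable (?M) (\<lambda>s. (C * K) *\<^sub>R f s)" by simp
    show "(\<lambda>s. B (f s) (w s)) \<in> borel_measurable (?M)"
      using fi by (intro bounded_bilinear_measurable[OF B] continuous_on_Icc_measurable[OF w]) auto
    show "AE x in ?M. norm (B (f x) (w x)) \<le> norm ((C * K) *\<^sub>R f x)"
    proof (rule AE_I2)
      fix x assume "x \<in> space (?M)"
      then have x: "norm (w x) \<le> C" using C[of x] by (simp add: space_restrict_space)
      then have C0: "0 \<le> C" using norm_ge_zero order_trans by blast
      have "norm (B (f x) (w x)) \<le> norm (f x) * norm (w x) * K" by (rule K)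
      also have "\<dots> \<le> norm (f x) * C * K" using x K(1) by (intro mult_right_mono mult_left_mono) auto
      also have "\<dots> = norm ((C * K) *\<^sub>R f x)" using C0 K(1) by (simp add: abs_mult)
      finally show "norm (B (f x) (w x)) \<le> norm ((C * K) *\<^sub>R f x)" .
    qed
  qed
  then show ?thesis by (simp add: integrable_lebesgue_on_Icc_iff)
qed

lemma uniformly_close_on_Icc:
  fixes u :: "real \<Rightarrow> 'a::metric_space"
  assumes "continuous_on {a..b} u" "0 < e"
  obtains d where "0 < d" "\<And>s t. \<lbrakk>s \<in> {a..b}; t \<in> {a..b}; \<bar>s - t\<bar> < d\<rbrakk> \<Longrightarrow> dist (u s) (u t) \<le> e"
proof -
  have "uniformly_continuous_on {a..b} u"
    by (intro compact_uniformly_continuous assms) simp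
  then obtain d where "0 < d" "\<forall>x\<in>{a..b}. \<forall>x'\<in>{a..b}. dist x' x < d \<longrightarrow> dist (u x') (u x) < e"
    using assms(2) unfolding uniformly_continuous_on_def by blast
  then show ?thesis
    by (intro that[of d]) (auto simp: dist_real_def less_imp_le)
qed

text \<open>On a short interval \<open>[x, y]\<close> the two factors are almost constant, so the increment of
  \<open>B u w\<close> differs from the integral of the formal derivative by a small multiple of
  $\int_x^y (\|f\| + \|g\|)$; summing over a fine partition gives equality.\<close>

lemma abs_cont_deriv_product:
  fixes B :: "'a::euclidean_space \<Rightarrow> 'b::euclidean_space \<Rightarrow> 'c::euclidean_space"
  assumes B: "bounded_bilinear B" and u: "abs_cont_deriv a b u f" and w: "abs_cont_deriv a b w g"
  shows "abs_cont_deriv a b (\<lambda>x. B (u x) (w x)) (\<lambda>x. B (f x) (w x) + B (u x) (g x))"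
proof -
  define h where "h = (\<lambda>x. B (f x) (w x) + B (u x) (g x))"
  define N where "N = (\<lambda>s. norm (f s) + norm (g s))"
  note uc = abs_cont_deriv_continuous[OF u] and wc = abs_cont_deriv_continuous[OF w]
  have fa: "f absolutely_integrable_on {a..b}" and ga: "g absolutely_integrable_on {a..b}"
    using u w by (auto simp: abs_cont_deriv_def)
  have ha: "h absolutely_integrable_on {a..b}"
    unfolding h_def
    by (intro set_integral_add absolutely_integrable_bilinear_continuous[OF B fa wc]
      absolutely_integrable_bilinear_continuous[OF bounded_bilinear.flip[OF B] ga uc])
  have hi: "h integrable_on {a..b}" and fi: "f integrable_on {a..b}" and gi: "g integrable_on {a..b}"
    using ha fa ga by (auto simp: set_lebesgue_integral_eq_integral)
  have Ni: "N integrable_on {a..b}"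
    unfolding N_def using fa ga by (intro integrable_add) (auto simp: absolutely_integrable_on_def)
  obtain K where K: "K > 0" "\<And>x y. norm (B x y) \<le> norm x * norm y * K"
    using bounded_bilinear.pos_bounded[OF B] by blast
  define D where "D x = B (u x) (w x) - integral {a..x} h" for x
  have local: "norm (D y - D x) \<le> integral {x..y} (\<lambda>s. e * K * N s)"
    if xy: "a \<le> x" "x \<le> y" "y \<le> b"
      and cu: "\<And>s. s \<in> {x..y} \<Longrightarrow> norm (u x - u s) \<le> e" and cw: "\<And>s. s \<in> {x..y} \<Longrightarrow> norm (w y - w s) \<le> e"
    for x y e
  proof -
    have sub: "{x..y} \<subseteq> {a..b}" using xy by auto
    note ss = integrable_on_subinterval[OF _ sub]
    \<comment> \<open>The increment of the product splits exactly when \<open>w\<close> is frozen at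
      the right end and \<open>u\<close> at the left end, which explains the asymmetric closeness
      assumptions.\<close>
    have 1: "integral {x..y} (\<lambda>s. B (f s) (w y)) = B (u y - u x) (w y)"
      using integral_linear[OF ss[OF fi] bounded_bilinear.bounded_linear_left[OF B], of "w y"]
      by (simp add: abs_cont_deriv_diff[OF u xy] o_def)
    have 2: "integral {x..y} (\<lambda>s. B (u x) (g s)) = B (u x) (w y - w x)"
      using integral_linear[OF ss[OF gi] bounded_bilinear.bounded_linear_right[OF B], of "u x"]
      by (simp add: abs_cont_deriv_diff[OF w xy] o_def)
    have i1: "(\<lambda>s. B (f s) (w y)) integrable_on {x..y}" "(\<lambda>s. B (u x) (g s)) integrable_on {x..y}"
      using integrable_linear[OF ss[OF fi] bounded_bilinear.bounded_linear_left[OF B], of "w y"]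
        integrable_linear[OF ss[OF gi] bounded_bilinear.bounded_linear_right[OF B], of "u x"]
      by (auto simp: o_def)
    have "h integrable_on {a..y}" by (rule integrable_on_subinterval[OF hi]) (use xy in auto)
    then have "integral {a..x} h + integral {x..y} h = integral {a..y} h"
      using xy by (intro Henstock_Kurzweil_Integration.integral_combine) auto
    then have "D y - D x = B (u y) (w y) - B (u x) (w x) - integral {x..y} h"
      by (simp add: D_def algebra_simps)
    also have "\<dots> = B (u y - u x) (w y) + B (u x) (w y - w x) - integral {x..y} h"
      by (simp add: bounded_bilinear.diff_left[OF B] bounded_bilinear.diff_right[OF B])
    also have "\<dots> = integral {x..y} (\<lambda>s. B (f s) (w y) + B (u x) (g s) - h s)"
      unfolding 1[symmetric] 2[symmetric] using i1 ss[OF hi]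
      by (simp add: integral_add integral_diff integrable_add)
    finally have eq: "D y - D x = integral {x..y} (\<lambda>s. B (f s) (w y) + B (u x) (g s) - h s)" .
    show ?thesis
      unfolding eq
    proof (rule integral_norm_bound_integral)
      show "(\<lambda>s. B (f s) (w y) + B (u x) (g s) - h s) integrable_on {x..y}"
        by (intro integrable_add integrable_diff i1 ss[OF hi])
      show "(\<lambda>s. e * K * N s) integrable_on {x..y}"
        by (rule integrable_on_mult_right[OF ss[OF Ni]])
      fix s assume s: "s \<in> {x..y}"
      have "B (f s) (w y) + B (u x) (g s) - h s = B (f s) (w y - w s) + B (u x - u s) (g s)"
        by (simp add: h_def bounded_bilinear.diff_left[OF B] bounded_bilinear.diff_right[OF B])
      also have "norm \<dots> \<le> norm (f s) * norm (w y - w s) * K + norm (u x - u s) * norm (g s) * K"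
        by (rule order_trans[OF norm_triangle_ineq add_mono[OF K(2) K(2)]])
      also have "\<dots> \<le> norm (f s) * e * K + e * norm (g s) * K"
        using cu[OF s] cw[OF s] K(1) by (intro add_mono mult_right_mono mult_left_mono) auto
      finally show "norm (B (f s) (w y) + B (u x) (g s) - h s) \<le> e * K * N s"
        by (simp add: N_def algebra_simps)
    qed
  qed
  have "D x = D a" if x: "x \<in> {a..b}" for x
  proof -
    have N0: "0 \<le> integral {a..b} N" by (rule integral_nonneg[OF Ni]) (auto simp: N_def)
    have "norm (D x - D a) \<le> e * (K * integral {a..b} N)" if e: "0 < e" for e
    proof -
      let ?g = "(\<lambda>s. e * K * N s)"
      obtain d1 where d1: "0 < d1" "\<And>s t. \<lbrakk>s \<in> {a..b}; t \<in> {a..b}; \<bar>s - t\<bar> < d1\<rbrakk> \<Longrightarrow> dist (u s) (u t) \<le> e"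
        using uniformly_close_on_Icc[OF uc e] by blast
      obtain d2 where d2: "0 < d2" "\<And>s t. \<lbrakk>s \<in> {a..b}; t \<in> {a..b}; \<bar>s - t\<bar> < d2\<rbrakk> \<Longrightarrow> dist (w s) (w t) \<le> e"
        using uniformly_close_on_Icc[OF wc e] by blast
      \<comment> \<open>Makes the mesh \<open>r\<close> finer than both moduli of
        continuity.\<close>
      obtain n where n: "(x - a) / min d1 d2 < real n" using reals_Archimedean2 by blast
      define r where "r = (x - a) / real (Suc n)"
      have r: "0 \<le> r" "r < d1" "r < d2"
      proof -
        show "0 \<le> r" using x by (simp add: r_def)
        have "x - a < real (Suc n) * min d1 d2"
          using n d1(1) d2(1) by (simp add: pos_divide_less_eq algebra_simps) 
        then have "r < min d1 d2" 
          unfolding r_def by (metis pos_divide_less_eq mult.commute of_nat_0_less_iff zero_less_Suc)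
        then show "r < d1" "r < d2" by auto
      qed
      have xr: "a + real (Suc n) * r = x" by (simp add: r_def del: of_nat_Suc)
      have "norm (D (a + real j * r) - D a) \<le> integral {a..a + real j * r} ?g" if "j \<le> Suc n" for j
        using that
      proof (induction j)
        case (Suc j)
        define y where "y = a + real j * r"
        have jr: "real (Suc j) * r \<le> real (Suc n) * r" "0 \<le> real j * r"
          using Suc.prems r(1) by (auto intro!: mult_right_mono)
        then have yb: "a \<le> y" "y \<le> y + r" "y + r \<le> b"
          using xr x r(1) by (auto simp: y_def algebra_simps)
        have ys: "a + real (Suc j) * r = y + r" by (simp add: y_def algebra_simps)
        have "norm (D (y + r) - D y) \<le> integral {y..y + r} ?g"
        proof (rule local[OF yb])
          fix s assume s: "s \<in> {y..y + r}"
          show "norm (u y - u s) \<le> e" using d1(2)[of y s] s yb r by (auto simp: dist_norm)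
          show "norm (w (y + r) - w s) \<le> e" using d2(2)[of "y + r" s] s yb r by (auto simp: dist_norm)
        qed
        moreover have "norm (D y - D a) \<le> integral {a..y} ?g"
          using Suc unfolding y_def by simp
        moreover have "integral {a..y} ?g + integral {y..y + r} ?g = integral {a..y + r} ?g"
          using yb by (intro Henstock_Kurzweil_Integration.integral_combine integrable_on_mult_right
              integrable_on_subinterval[OF Ni]) auto
        moreover have "norm (D (y + r) - D a) \<le> norm (D (y + r) - D y) + norm (D y - D a)"
          using norm_triangle_ineq[of "D (y + r) - D y" "D y - D a"] by simp
        ultimately show ?case unfolding ys by linarith
      qed simp
      from this[of "Suc n"] have "norm (D x - D a) \<le> integral {a..x} ?g" unfolding xr by simp
      also have "\<dots> \<le> integral {a..b} ?g"
        using x e K(1) by (intro integral_subset_le integrable_on_mult_right integrable_on_subinterval[OF Ni] Ni)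
          (auto simp: N_def)
      also have "\<dots> = e * (K * integral {a..b} N)" by simp
      finally show ?thesis .
    qed note bound = this
    have "norm (D x - D a) \<le> 0 + \<epsilon>" if "0 < \<epsilon>" for \<epsilon>
    proof -
      define I where "I = K * integral {a..b} N"
      have I: "0 \<le> I" using N0 K(1) by (simp add: I_def)
      have "norm (D x - D a) \<le> (\<epsilon> / (I + 1)) * I"
        using bound[of "\<epsilon> / (I + 1)"] that I unfolding I_def by simp
      also have "\<dots> \<le> \<epsilon>" using that I by (simp add: field_simps)
      finally show ?thesis by simp
    qed
    then have "norm (D x - D a) \<le> 0" by (rule field_le_epsilon)
    then show ?thesis by simp
  qed
  then have "B (u x) (w x) = B (u a) (w a) + integral {a..x} h" if "x \<in> {a..b}" for x
    using that unfolding D_def by (metis add_diff_cancel_right' diff_add_cancel integral_refl interval_cbox diff_zero)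
  then show ?thesis
    using ha unfolding abs_cont_deriv_def h_def[symmetric] by blast
qed

lemma abs_cont_deriv_C1:
  fixes u :: "real \<Rightarrow> 'a::euclidean_space"
  assumes "\<And>x. (u has_vector_derivative u' x) (at x)" "continuous_on {a..b} u'"
  shows "abs_cont_deriv a b u u'"
  unfolding abs_cont_deriv_def
proof (intro conjI ballI)
  show "u' absolutely_integrable_on {a..b}"
    by (rule absolutely_integrable_continuous_real[OF assms(2)])
  fix x assume "x \<in> {a..b}"
  then have "(u' has_integral (u x - u a)) {a..x}"
    using assms(1) by (intro fundamental_theorem_of_calculus) (auto intro: has_vector_derivative_at_within)
  then show "u x = u a + integral {a..x} u'" by (simp add: integral_unique)
qed

lemma abs_cont_deriv_const: "abs_cont_deriv a b (\<lambda>_. c) (\<lambda>_. 0)"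
  by (simp add: abs_cont_deriv_def)

lemma abs_cont_deriv_cong:
  assumes u: "abs_cont_deriv a b u v"
    and u': "\<And>x. x \<in> {a..b} \<Longrightarrow> u x = u' x" and v': "ae_eq a b v v'"
  shows "abs_cont_deriv a b u' v'"
proof -
  have "AE x in lebesgue. x \<in> {a<..<b} \<longrightarrow> v x = v' x"
    using v' by (simp add: ae_eq_def AE_restrict_space_iff)
  then obtain Z where Z: "Z \<in> null_sets lebesgue" "\<And>x. x \<notin> Z \<Longrightarrow> x \<in> {a<..<b} \<Longrightarrow> v x = v' x"
    by (auto elim!: AE_E3)
  \<comment> \<open>\<open>ae_eq\<close> concerns the open interval, so the two end points join the
    exceptional set.\<close>
  define W where "W = insert a (insert b Z)"
  have W: "negligible W" using Z(1) by (simp add: W_def negligible_iff_null_sets)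
  have eq: "v' x = v x" if "x \<in> {a..b} - W" for x
    using that Z(2) by (auto simp: W_def)
  have "v' absolutely_integrable_on {a..b}"
    by (rule absolutely_integrable_spike[where f = v, OF _ W]) (use u eq in \<open>auto simp: abs_cont_deriv_def\<close>)
  moreover have "integral {a..x} v' = integral {a..x} v" if "x \<in> {a..b}" for x
    using that eq by (intro integral_spike[OF W]) auto
  moreover have "u' x = u' a + integral {a..x} v" if x: "x \<in> {a..b}" for x
    using abs_cont_deriv_eq[OF u x] x u'[OF x] u'[of a] by simp
  ultimately show ?thesis
    unfolding abs_cont_deriv_def by metis
qed

section \<open>Continuously differentiable cut-off functions\<close>

text \<open>Quadratic spline rising from 0 to 1 on [0, 1] with knots 0, 1/2, 1. It has exactly the
  regularity demanded of test functions; truncated powers avoid case distinctions when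
  differentiating.\<close>

definition smoothstep :: "real \<Rightarrow> real" where
  "smoothstep t = 2 * (max 0 t)\<^sup>2 - 4 * (max 0 (t - 1/2))\<^sup>2 + 2 * (max 0 (t - 1))\<^sup>2"

text \<open>Piecewise linear, supported on [0, 1], with peak 2 at 1/2 and hence mass 1.\<close>

definition tent :: "real \<Rightarrow> real" where
  "tent t = 4 * max 0 t - 8 * max 0 (t - 1/2) + 4 * max 0 (t - 1)"

lemma DERIV_max_0_squared: "((\<lambda>t. (max 0 t)\<^sup>2) has_real_derivative 2 * max 0 x) (at x)"
proof -
  consider "x < 0" | "x = 0" | "0 < x" by linarith
  then show ?thesis
  proof cases
    case 1
    show ?thesis
      by (rule has_field_derivative_transform_within_open[of "\<lambda>_. 0" _ _ "{..<0}"]) (use 1 in auto)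
  next
    case 2
    have "continuous (at 0) (\<lambda>z::real. max 0 z)"
      by (intro continuous_intros)
    then show ?thesis
      unfolding 2 CARAT_DERIV by (intro exI[of _ "\<lambda>z. max 0 z"]) (auto simp: max_def power2_eq_square)
  next
    case 3
    show ?thesis
      by (rule has_field_derivative_transform_within_open[of "\<lambda>t. t\<^sup>2" _ _ "{0<..}"])
        (use 3 in \<open>auto intro!: derivative_eq_intros\<close>)
  qed
qed

lemma DERIV_smoothstep: "(smoothstep has_real_derivative tent x) (at x)"
proof -
  have shift: "((\<lambda>t. (max 0 (t - c))\<^sup>2) has_real_derivative 2 * max 0 (x - c)) (at x)" for c :: real
  proof -
    have "((\<lambda>t. t - c) has_real_derivative 1) (at x)" by (auto intro!: derivative_eq_intros)
    from DERIV_chain2[OF DERIV_max_0_squared this] show ?thesis by simp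
  qed
  show ?thesis
    unfolding smoothstep_def[abs_def] tent_def
    by (rule derivative_eq_intros DERIV_max_0_squared shift refl | simp)+
qed

lemma continuous_tent: "continuous_on A tent"
  unfolding tent_def[abs_def] by (intro continuous_intros)

lemma tent_eq_0: "t \<le> 0 \<or> 1 \<le> t \<Longrightarrow> tent t = 0"
  by (auto simp: tent_def max_def)

lemma tent_nonneg: "0 \<le> tent t"
  by (auto simp: tent_def max_def)

lemma smoothstep_eq_0: "t \<le> 0 \<Longrightarrow> smoothstep t = 0"
  by (auto simp: smoothstep_def max_def)

lemma smoothstep_eq_1: "1 \<le> t \<Longrightarrow> smoothstep t = 1"
  by (auto simp: smoothstep_def max_def power2_eq_square algebra_simps)

lemma smoothstep_mono: "s \<le> t \<Longrightarrow> smoothstep s \<le> smoothstep t"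
  by (rule DERIV_nonneg_imp_nondecreasing) (auto intro: DERIV_smoothstep tent_nonneg)

lemma smoothstep_bounds: "0 \<le> smoothstep t" "smoothstep t \<le> 1"
  using smoothstep_mono[of "min 0 t" t] smoothstep_mono[of t "max 1 t"]
  by (auto simp: smoothstep_eq_0 smoothstep_eq_1)

definition ramp :: "real \<Rightarrow> real \<Rightarrow> real \<Rightarrow> real" where
  "ramp c \<delta> t = smoothstep ((t - c) / \<delta>)"

text \<open>Unit mass on [c, c + \<delta>], the derivative of the ramp.\<close>

definition bump :: "real \<Rightarrow> real \<Rightarrow> real \<Rightarrow> real" where
  "bump c \<delta> t = tent ((t - c) / \<delta>) / \<delta>"

lemma DERIV_ramp: "0 < \<delta> \<Longrightarrow> (ramp c \<delta> has_real_derivative bump c \<delta> x) (at x)"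
proof -
  assume "0 < \<delta>"
  then have "((\<lambda>t. (t - c) / \<delta>) has_real_derivative 1 / \<delta>) (at x)"
    by (auto intro!: derivative_eq_intros)
  from DERIV_chain2[OF DERIV_smoothstep this] show ?thesis
    by (simp add: ramp_def[abs_def] bump_def)
qed

lemma continuous_bump: "0 < \<delta> \<Longrightarrow> continuous_on A (bump c \<delta>)"
  unfolding bump_def[abs_def]
  by (intro continuous_intros continuous_on_compose2[OF continuous_tent[of UNIV]]) auto

lemma ramp_eq_0: "0 < \<delta> \<Longrightarrow> t \<le> c \<Longrightarrow> ramp c \<delta> t = 0"
  unfolding ramp_def by (rule smoothstep_eq_0) (simp add: divide_le_0_iff)

lemma ramp_eq_1: "0 < \<delta> \<Longrightarrow> c + \<delta> \<le> t \<Longrightarrow> ramp c \<delta> t = 1"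
  unfolding ramp_def by (rule smoothstep_eq_1) (simp add: field_simps)

text \<open>Integration against the bump is an average over its support, so it stays as close to
  \<open>z\<close> as \<open>u\<close> does there.\<close>

lemma integral_bump_near:
  fixes u :: "real \<Rightarrow> 'a::euclidean_space"
  assumes \<delta>: "0 < \<delta>" "a \<le> c" "c + \<delta> \<le> b" and u: "continuous_on {a..b} u"
    and near: "\<And>t. t \<in> {c..c + \<delta>} \<Longrightarrow> norm (u t - z) \<le> e"
  shows "norm (integral {a..b} (\<lambda>t. bump c \<delta> t *\<^sub>R u t) - z) \<le> e"
proof -
  have "(ramp c \<delta> has_vector_derivative bump c \<delta> x) (at x within {a..b})" for x
    using DERIV_ramp[OF \<delta>(1)]
    by (simp add: has_real_derivative_iff_has_vector_derivative has_vector_derivative_at_within)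
  then have "(bump c \<delta> has_integral ramp c \<delta> b - ramp c \<delta> a) {a..b}"
    using \<delta> by (intro fundamental_theorem_of_calculus) auto
  then have one: "(bump c \<delta> has_integral 1) {a..b}"
    using \<delta> by (simp add: ramp_eq_0 ramp_eq_1)
  have ib: "(\<lambda>t. bump c \<delta> t *\<^sub>R z) integrable_on {a..b}" "integral {a..b} (\<lambda>t. bump c \<delta> t *\<^sub>R z) = z"
    using has_integral_scaleR_left[OF one, of z] by (auto simp: integral_unique has_integral_integrable)
  have iu: "(\<lambda>t. bump c \<delta> t *\<^sub>R u t) integrable_on {a..b}"
    by (intro integrable_continuous_interval continuous_intros continuous_bump u \<delta>)
  have "integral {a..b} (\<lambda>t. bump c \<delta> t *\<^sub>R u t) - z = integral {a..b} (\<lambda>t. bump c \<delta> t *\<^sub>R u t - bump c \<delta> t *\<^sub>R z)"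
    using integral_diff[OF iu ib(1)] ib(2) by simp
  also have "norm \<dots> \<le> integral {a..b} (\<lambda>t. bump c \<delta> t * e)"
  proof (rule integral_norm_bound_integral)
    show "(\<lambda>t. bump c \<delta> t *\<^sub>R u t - bump c \<delta> t *\<^sub>R z) integrable_on {a..b}"
      by (rule integrable_diff[OF iu ib(1)])
    show "(\<lambda>t. bump c \<delta> t * e) integrable_on {a..b}"
      using has_integral_mult_left[OF one] by blast
    fix t assume "t \<in> {a..b}"
    have b0: "0 \<le> bump c \<delta> t" using \<delta> by (simp add: bump_def tent_nonneg)
    show "norm (bump c \<delta> t *\<^sub>R u t - bump c \<delta> t *\<^sub>R z) \<le> bump c \<delta> t * e"
    proof (cases "t \<in> {c..c + \<delta>}")
      case True
      have "norm (bump c \<delta> t *\<^sub>R u t - bump c \<delta> t *\<^sub>R z) = bump c \<delta> t * norm (u t - z)"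
        using b0 by (simp flip: scaleR_diff_right)
      then show ?thesis using near[OF True] b0 by (simp add: mult_left_mono)
    next
      case False
      then have "bump c \<delta> t = 0"
        using \<delta> unfolding bump_def by (subst tent_eq_0) (auto simp: field_simps)
      then show ?thesis by simp
    qed
  qed
  also have "\<dots> = e" using integral_unique[OF has_integral_mult_left[OF one, of e]] by simp
  finally show ?thesis .
qed

section \<open>Weak derivatives and indefinite integrals\<close>

text \<open>Test with a plateau that rises just after \<open>a\<close> and falls just before
  \<open>d\<close>. Its derivative is a difference of two bumps, so the left side tends to u a - u
  d, and the right side tends to minus the integral of \<open>v\<close> over [a, d].\<close>

lemma has_H1_deriv_imp_abs_cont_deriv:
  fixes u :: "real \<Rightarrow> 'a::euclidean_space"
  assumes ab: "a < b" and u: "continuous_on {a..b} u" and H: "has_H1_deriv a b u v"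
  shows "abs_cont_deriv a b u v"
  unfolding abs_cont_deriv_def
proof (intro conjI ballI)
  let ?M = "lebesgue_on {a<..<b}"
  have vi: "integrable (?M) v"
    using H by (intro L2_integrable) (simp add: has_H1_deriv_def)
  then show va: "v absolutely_integrable_on {a..b}" by (simp add: integrable_lebesgue_on_Icc_iff)
  fix d assume d: "d \<in> {a..b}"
  show "u d = u a + integral {a..d} v"
  proof (cases "d = a")
    case False
    with d have ad: "a < d" "d \<le> b" by auto
    \<comment> \<open>The 5 guarantees 4 \<delta> < d - a, so the rise on
      [a + \<delta>, a + 2 \<delta>] ends before the fall on [d - 2 \<delta>, d - \<delta>]
      begins.\<close>
    define \<delta> where "\<delta> n = (d - a) / (real n + 5)" for n
    have \<delta>: "0 < \<delta> n" "4 * \<delta> n < d - a" for n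
    proof -
      show "0 < \<delta> n" using ad by (simp add: \<delta>_def)
      have "(d - a) * 4 < (d - a) * (real n + 5)" using ad by (intro mult_strict_left_mono) auto
      then have "(d - a) * 4 / (real n + 5) < d - a" by (simp add: pos_divide_less_eq)
      then show "4 * \<delta> n < d - a" by (simp add: \<delta>_def mult.commute)
    qed
    have "(\<lambda>n. (d - a) / real (n + 5)) \<longlonglongrightarrow> 0"
      by (rule LIMSEQ_ignore_initial_segment) (rule lim_const_over_n)
    then have "\<delta> \<longlonglongrightarrow> 0"
      by (simp add: \<delta>_def[abs_def])
    define \<phi> where "\<phi> n t = ramp (a + \<delta> n) (\<delta> n) t - ramp (d - 2 * \<delta> n) (\<delta> n) t" for n t
    define \<phi>' where "\<phi>' n t = bump (a + \<delta> n) (\<delta> n) t - bump (d - 2 * \<delta> n) (\<delta> n) t" for n t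
    let ?L = "\<lambda>n. (LINT t|?M. \<phi>' n t *\<^sub>R u t)"
    let ?R = "(LINT t|?M. indicator {..<d} t *\<^sub>R v t)"
    have D\<phi>: "(\<phi> n has_real_derivative \<phi>' n t) (at t)" for n t
      unfolding \<phi>_def[abs_def] \<phi>'_def by (intro DERIV_diff DERIV_ramp \<delta>)
    have c\<phi>': "continuous_on A (\<phi>' n)" for n A
      unfolding \<phi>'_def[abs_def] by (intro continuous_intros continuous_bump \<delta>)
    have c\<phi>: "continuous_on A (\<phi> n)" for n A
      by (intro DERIV_continuous_on) (auto intro: has_field_derivative_at_within D\<phi>)
    have test: "test_function a b (\<phi> n) (\<phi>' n)" for n
      unfolding test_function_def
    proof (intro conjI allI D\<phi> c\<phi>' exI[of _ "{a + \<delta> n..d - \<delta> n}"] impI)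
      show "{a + \<delta> n..d - \<delta> n} \<subseteq> {a<..<b}" using \<delta>[of n] ad by auto
      fix t assume "t \<notin> {a + \<delta> n..d - \<delta> n}"
      then consider "t \<le> a + \<delta> n" "t \<le> d - 2 * \<delta> n" | "a + \<delta> n + \<delta> n \<le> t" "d - 2 * \<delta> n + \<delta> n \<le> t"
        using \<delta>[of n] by auto
      then show "\<phi> n t = 0"
        by cases (simp_all add: \<phi>_def ramp_eq_0 ramp_eq_1 \<delta>)
    qed simp
    have ibp: "?L n = - (LINT t|?M. \<phi> n t *\<^sub>R v t)" for n
      using H test unfolding has_H1_deriv_def by blast
    have lim1: "(\<lambda>n. LINT t|?M. \<phi>' n t *\<^sub>R u t) \<longlonglongrightarrow> u a - u d"
    proof (rule LIMSEQ_I)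
      fix e :: real assume "0 < e"
      then have e3: "0 < e / 3" by simp
      obtain \<eta> where \<eta>: "0 < \<eta>" "\<And>s t. \<lbrakk>s \<in> {a..b}; t \<in> {a..b}; \<bar>s - t\<bar> < \<eta>\<rbrakk> \<Longrightarrow> dist (u s) (u t) \<le> e / 3"
        using uniformly_close_on_Icc[OF u e3] by blast
      have "\<forall>\<^sub>F n in sequentially. \<delta> n < \<eta> / 3"
        using \<open>\<delta> \<longlonglongrightarrow> 0\<close> \<eta>(1) by (intro order_tendstoD) auto
      then obtain N where N: "\<And>n. N \<le> n \<Longrightarrow> \<delta> n < \<eta> / 3"
        by (auto simp: eventually_sequentially)
      show "\<exists>no. \<forall>n\<ge>no. norm (?L n - (u a - u d)) < e"
      proof (intro exI[of _ N] allI impI)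
        fix n assume n: "N \<le> n"
        have near: "\<delta> n < \<eta> / 3" by (rule N[OF n])
        let ?I = "\<lambda>c. integral {a..b} (\<lambda>t. bump c (\<delta> n) t *\<^sub>R u t)"
        have 1: "norm (?I (a + \<delta> n) - u a) \<le> e / 3"
        proof (rule integral_bump_near[OF \<delta>(1) _ _ u])
          fix t assume t: "t \<in> {a + \<delta> n..a + \<delta> n + \<delta> n}"
          show "norm (u t - u a) \<le> e / 3"
            using \<eta>(2)[of t a] t near \<delta>[of n] ad by (auto simp: dist_norm)
        qed (use \<delta>[of n] ad in auto)
        have 2: "norm (?I (d - 2 * \<delta> n) - u d) \<le> e / 3"
        proof (rule integral_bump_near[OF \<delta>(1) _ _ u])
          fix t assume t: "t \<in> {d - 2 * \<delta> n..d - 2 * \<delta> n + \<delta> n}"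
          show "norm (u t - u d) \<le> e / 3"
            using \<eta>(2)[of t d] t near \<delta>[of n] ad by (auto simp: dist_norm)
        qed (use \<delta>[of n] ad in auto)
        have ii: "(\<lambda>t. bump c (\<delta> n) t *\<^sub>R u t) integrable_on {a..b}" for c
          by (intro integrable_continuous_interval continuous_intros continuous_bump u \<delta>)
        have "integrable (?M) (\<lambda>t. \<phi>' n t *\<^sub>R u t)"
          unfolding integrable_lebesgue_on_Icc_iff
          by (intro absolutely_integrable_continuous_real continuous_intros c\<phi>' u)
        then have "?L n = ?I (a + \<delta> n) - ?I (d - 2 * \<delta> n)"
          using integral_diff[OF ii ii] by (simp add: integral_lebesgue_on_Icc \<phi>'_def scaleR_left_diff_distrib)
        then have "norm (?L n - (u a - u d))
            = norm ((?I (a + \<delta> n) - u a) - (?I (d - 2 * \<delta> n) - u d))"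
          by (simp only:) (simp add: algebra_simps)
        also have "\<dots> \<le> e / 3 + e / 3" by (rule order_trans[OF norm_triangle_ineq4 add_mono[OF 1 2]])
        finally show "norm (?L n - (u a - u d)) < e"
          using \<open>0 < e\<close> by simp
      qed
    qed
    have lim2: "(\<lambda>n. LINT t|?M. \<phi> n t *\<^sub>R v t) \<longlonglongrightarrow> ?R"
    proof (rule integral_dominated_convergence)
      show "integrable (?M) (\<lambda>t. norm (v t))" using vi by simp
      have vm: "v \<in> borel_measurable (?M)" using vi by auto
      show "(\<lambda>t. indicator {..<d} t *\<^sub>R v t) \<in> borel_measurable (?M)"
        by (intro borel_measurable_scaleR vm measurable_restrict_space1 borel_measurable_indicator) auto
      show "(\<lambda>t. \<phi> n t *\<^sub>R v t) \<in> borel_measurable (?M)" for n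
        by (intro borel_measurable_scaleR vm continuous_on_Icc_measurable c\<phi>)
      show "AE t in ?M. norm (\<phi> n t *\<^sub>R v t) \<le> norm (v t)" for n
      proof (rule AE_I2)
        fix t
        have "\<bar>\<phi> n t\<bar> \<le> 1"
          using smoothstep_bounds[of "(t - (a + \<delta> n)) / \<delta> n"] smoothstep_bounds[of "(t - (d - 2 * \<delta> n)) / \<delta> n"]
          by (auto simp: \<phi>_def ramp_def abs_le_iff)
        then show "norm (\<phi> n t *\<^sub>R v t) \<le> norm (v t)" by (simp add: mult_left_le_one_le)
      qed
      show "AE t in ?M. (\<lambda>n. \<phi> n t *\<^sub>R v t) \<longlonglongrightarrow> indicator {..<d} t *\<^sub>R v t"
      proof (rule AE_I2)
        fix t assume "t \<in> space (?M)"
        then have t: "a < t" "t < b" by (auto simp: space_restrict_space)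
        have "\<forall>\<^sub>F n in sequentially. \<phi> n t = indicator {..<d} t"
        proof (cases "t < d")
          case True
          have "\<forall>\<^sub>F n in sequentially. \<delta> n < min (t - a) (d - t) / 2"
            using \<open>\<delta> \<longlonglongrightarrow> 0\<close> t True by (intro order_tendstoD) auto
          then show ?thesis
          proof eventually_elim
            case (elim n)
            then have "a + \<delta> n + \<delta> n \<le> t" "t \<le> d - 2 * \<delta> n" by auto
            then show ?case using True by (simp add: \<phi>_def ramp_eq_0 ramp_eq_1 \<delta>)
          qed
        next
          case False
          have "\<phi> n t = 0" for n
          proof -
            have "a + \<delta> n + \<delta> n \<le> t" "d - 2 * \<delta> n + \<delta> n \<le> t" using False \<delta>[of n] by auto
            then show ?thesis by (simp add: \<phi>_def ramp_eq_1 \<delta>)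
          qed
          then show ?thesis using False by simp
        qed
        then have "\<forall>\<^sub>F n in sequentially. \<phi> n t *\<^sub>R v t = indicator {..<d} t *\<^sub>R v t"
          by eventually_elim simp
        then show "(\<lambda>n. \<phi> n t *\<^sub>R v t) \<longlonglongrightarrow> indicator {..<d} t *\<^sub>R v t"
          by (rule tendsto_eventually)
      qed
    qed
    have "u a - u d = - ?R"
      using lim1 tendsto_minus[OF lim2] unfolding ibp by (rule LIMSEQ_unique)
    moreover have "?R = integral {a..d} v"
    proof -
      have "?R = (LINT t|lebesgue. indicator {a<..<b} t *\<^sub>R indicator {..<d} t *\<^sub>R v t)"
        by (rule integral_restrict_space) simp
      also have "(\<lambda>t. indicator {a<..<b} t *\<^sub>R indicator {..<d} t *\<^sub>R v t) = (\<lambda>t. indicator {a<..<d} t *\<^sub>R v t)"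
        using ad by (auto simp: fun_eq_iff indicator_def)
      also have "(LINT t|lebesgue. indicator {a<..<d} t *\<^sub>R v t) = (LINT t|lebesgue_on {a<..<d}. v t)"
        by (rule integral_restrict_space[symmetric]) simp
      also have "\<dots> = integral {a..d} v"
      proof (rule integral_lebesgue_on_Icc)
        show "integrable (lebesgue_on {a<..<d}) v"
          unfolding integrable_lebesgue_on_Icc_iff
          by (rule set_integrable_subset[OF va]) (use ad in auto)
      qed
      finally show ?thesis .
    qed
    ultimately show ?thesis by (simp add: algebra_simps)
  qed simp
qed

text \<open>The product rule for the test function times \<open>u\<close>, integrated over the
  interval; the test function vanishes at both ends.\<close>

lemma abs_cont_deriv_imp_has_H1_deriv:
  fixes u :: "real \<Rightarrow> 'a::euclidean_space"
  assumes ab: "a < b" and u: "abs_cont_deriv a b u v" and v: "v \<in> L2 a b"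
  shows "has_H1_deriv a b u v"
  unfolding has_H1_deriv_def
proof (intro conjI allI impI v)
  note uc = abs_cont_deriv_continuous[OF u]
  show "u \<in> L2 a b" by (rule continuous_L2[OF uc])
  fix \<phi> \<phi>' assume t: "test_function a b \<phi> \<phi>'"
  have D: "(\<phi> has_real_derivative \<phi>' x) (at x)" and c: "continuous_on UNIV \<phi>'" for x
    using t by (auto simp: test_function_def)
  have \<phi>: "abs_cont_deriv a b \<phi> \<phi>'"
    using D continuous_on_subset[OF c]
    by (intro abs_cont_deriv_C1) (auto simp: has_real_derivative_iff_has_vector_derivative)
  have ends: "\<phi> a = 0" "\<phi> b = 0" using t by (auto simp: test_function_def)
  have P: "abs_cont_deriv a b (\<lambda>x. \<phi> x *\<^sub>R u x) (\<lambda>x. \<phi>' x *\<^sub>R u x + \<phi> x *\<^sub>R v x)"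
    by (rule abs_cont_deriv_product[OF bounded_bilinear_scaleR \<phi> u])
  have va: "v absolutely_integrable_on {a..b}" using u by (simp add: abs_cont_deriv_def)
  have a1: "(\<lambda>x. \<phi>' x *\<^sub>R u x) absolutely_integrable_on {a..b}"
    by (intro absolutely_integrable_continuous_real continuous_intros uc continuous_on_subset[OF c]) auto
  have a2: "(\<lambda>x. \<phi> x *\<^sub>R v x) absolutely_integrable_on {a..b}"
    by (rule absolutely_integrable_bilinear_continuous[OF bounded_bilinear.flip[OF bounded_bilinear_scaleR] va
          abs_cont_deriv_continuous[OF \<phi>]])
  have "integral {a..b} (\<lambda>x. \<phi>' x *\<^sub>R u x + \<phi> x *\<^sub>R v x) = 0"
    using abs_cont_deriv_eq[OF P, of b] ab ends by simp
  moreover have "integral {a..b} (\<lambda>x. \<phi>' x *\<^sub>R u x + \<phi> x *\<^sub>R v x) =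
      integral {a..b} (\<lambda>x. \<phi>' x *\<^sub>R u x) + integral {a..b} (\<lambda>x. \<phi> x *\<^sub>R v x)"
    using a1 a2 by (intro Henstock_Kurzweil_Integration.integral_add) (auto simp: set_lebesgue_integral_eq_integral)
  ultimately show "(LINT x|lebesgue_on {a<..<b}. \<phi>' x *\<^sub>R u x) = - (LINT x|lebesgue_on {a<..<b}. \<phi> x *\<^sub>R v x)"
    using a1 a2 by (simp add: integral_lebesgue_on_Icc integrable_lebesgue_on_Icc_iff eq_neg_iff_add_eq_0)
qed

section \<open>Complex matrices\<close>

lemma bounded_bilinear_mv: "bounded_bilinear (\<lambda>(A::complex^'n^'m) (v::complex^'n). A *v v)"
  unfolding bilinear_conv_bounded_bilinear[symmetric] bilinear_def
  by (auto intro!: linearI simp: vec_eq_iff matrix_vector_mult_def sum.distrib scaleR_sum_right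
      distrib_left distrib_right)

lemmas mv_add_right = bounded_bilinear.add_right[OF bounded_bilinear_mv]
  and mv_minus_right = bounded_bilinear.minus_right[OF bounded_bilinear_mv]
  and mv_diff_right = bounded_bilinear.diff_right[OF bounded_bilinear_mv]
  and mv_diff_left = bounded_bilinear.diff_left[OF bounded_bilinear_mv]
  and mv_zero_right = bounded_bilinear.zero_right[OF bounded_bilinear_mv]
  and mv_zero_left = bounded_bilinear.zero_left[OF bounded_bilinear_mv]
  and bounded_linear_mv = bounded_bilinear.bounded_linear_right[OF bounded_bilinear_mv]
  and continuous_on_mv = bounded_bilinear.continuous_on[OF bounded_bilinear_mv]

lemma bounded_bilinear_mm: "bounded_bilinear (\<lambda>(A::complex^'n^'m) (B::complex^'k^'n). A ** B)"
  unfolding bilinear_conv_bounded_bilinear[symmetric] bilinear_def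
  by (auto intro!: linearI simp: vec_eq_iff matrix_matrix_mult_def sum.distrib scaleR_sum_right
      distrib_left distrib_right)

lemma bounded_bilinear_cdot: "bounded_bilinear (cdot :: complex^'n \<Rightarrow> complex^'n \<Rightarrow> complex)"
  unfolding bilinear_conv_bounded_bilinear[symmetric] bilinear_def
  by (auto intro!: linearI simp: cdot_def sum.distrib scaleR_sum_right distrib_left distrib_right)

lemma bounded_linear_ctranspose: "bounded_linear (ctranspose :: complex^'n^'m \<Rightarrow> complex^'m^'n)"
  unfolding linear_conv_bounded_linear[symmetric]
  by (rule linearI) (auto simp: vec_eq_iff ctranspose_def)

lemma bounded_linear_vstack: "bounded_linear (\<lambda>p. vstack (f p) (g p) :: complex^('n + 'm))"
  if "bounded_linear f" "bounded_linear g"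
  for f :: "'a::euclidean_space \<Rightarrow> complex^'n" and g :: "'a \<Rightarrow> complex^'m"
  unfolding linear_conv_bounded_linear[symmetric]
  by (rule linearI)
    (auto simp: vec_eq_iff vstack_def linear_simps[OF that(1)] linear_simps[OF that(2)] split: sum.split)

lemma ctranspose_mult: "ctranspose (A ** B) = ctranspose B ** ctranspose A"
  by (simp add: vec_eq_iff ctranspose_def matrix_matrix_mult_def mult.commute)

lemma ctranspose_ctranspose [simp]: "ctranspose (ctranspose A) = A"
  by (simp add: vec_eq_iff ctranspose_def)

lemma ctranspose_mat [simp]: "ctranspose (mat c) = mat (cnj c)"
  by (simp add: vec_eq_iff ctranspose_def mat_def)

lemma ctranspose_diff: "ctranspose (A - B) = ctranspose A - ctranspose B"
  by (simp add: vec_eq_iff ctranspose_def)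

lemma mat_mult_commute: "mat c ** A = A ** mat c" for A :: "complex^'n^'n"
  by (simp add: vec_eq_iff matrix_matrix_mult_def mat_def if_distrib[of "\<lambda>x. x * _"] if_distrib[of "\<lambda>x. _ * x"]
      mult.commute cong: if_cong)

lemma mat_mult_vec: "mat c *v v = c *s v" for v :: "complex^'n"
  by (simp add: vec_eq_iff matrix_vector_mult_def mat_def if_distrib[of "\<lambda>x. x * _"] cong: if_cong)

lemma mm_diff_left: "(A - B) ** C = A ** C - B ** C" for A B :: "complex^'n^'m" and C :: "complex^'k^'n"
  by (rule bounded_bilinear.diff_left[OF bounded_bilinear_mm])

lemma mm_diff_right: "A ** (B - C) = A ** B - A ** C" for A :: "complex^'n^'m" and C :: "complex^'k^'n"
  by (rule bounded_bilinear.diff_right[OF bounded_bilinear_mm])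

lemma mm_add_left: "(A + B) ** C = A ** C + B ** C" for A B :: "complex^'n^'m" and C :: "complex^'k^'n"
  by (rule bounded_bilinear.add_left[OF bounded_bilinear_mm])

lemma mm_minus_left: "(- A) ** C = - (A ** C)" for A :: "complex^'n^'m" and C :: "complex^'k^'n"
  by (rule bounded_bilinear.minus_left[OF bounded_bilinear_mm])

lemma mat_minus: "mat (- c) = - (mat c :: complex^'n^'n)"
  by (simp add: vec_eq_iff mat_def)

lemma cdot_mv: "cdot (A *v v) w = cdot v (ctranspose A *v w)"
  unfolding cdot_def matrix_vector_mult_def ctranspose_def
  by (simp add: sum_distrib_left sum_distrib_right mult_ac) (rule sum.swap)

lemma cnj_cdot: "cnj (cdot v w) = cdot w v"
  by (simp add: cdot_def mult.commute)

lemma Re_cdot: "Re (cdot v w) = v \<bullet> w"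
  by (simp add: cdot_def inner_vec_def inner_complex_def)

lemma norm_sq_cdot: "(norm v)\<^sup>2 = Re (cdot v v)" for v :: "complex^'n"
  by (simp add: Re_cdot power2_norm_eq_inner)

lemma cdot_scale_right: "cdot v (c *s w) = c * cdot v w"
  by (simp add: cdot_def sum_distrib_left mult_ac)

lemma mv_scale: "A *v (c *s v) = c *s (A *v v)" for v :: "complex^'n"
  by (simp add: vec_eq_iff matrix_vector_mult_def sum_distrib_left mult_ac)

text \<open>The squared norm of z, the adjoint applied to w, is Re (cdot w (A z)), and the
  hypothesis bounds A z. This carries the bound on \<Psi> over to its adjoint.\<close>

lemma norm_ctranspose_mv_le:
  fixes A :: "complex^'n^'m"
  assumes "\<And>v. norm (A *v v) \<le> C * norm v"
  shows "norm (ctranspose A *v w) \<le> C * norm w"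
proof -
  let ?z = "ctranspose A *v w"
  have "(norm ?z)\<^sup>2 = Re (cdot w (A *v ?z))"
    using cdot_mv[of "ctranspose A" w ?z] by (simp add: norm_sq_cdot)
  also have "\<dots> \<le> norm w * norm (A *v ?z)"
    unfolding Re_cdot by (rule norm_cauchy_schwarz)
  also have "\<dots> \<le> norm w * (C * norm ?z)" by (intro mult_left_mono assms) auto
  finally have "norm ?z * norm ?z \<le> (C * norm w) * norm ?z" by (simp add: power2_eq_square mult_ac)
  \<comment> \<open>The sign of \<open>C\<close> follows from the hypothesis at one nonzero
    vector.\<close>
  moreover have "0 \<le> C * norm w" 
  proof -
    have "(\<chi> i. 1) \<noteq> (0 :: complex^'n)" by (simp add: vec_eq_iff)
    moreover have "0 \<le> C * norm ((\<chi> i. 1) :: complex^'n)"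
      using assms norm_ge_zero order_trans by blast
    ultimately show ?thesis by (simp add: zero_le_mult_iff)
  qed
  ultimately show ?thesis
    by (cases "norm ?z = 0") (auto simp: mult_le_cancel_right)
qed

lemma matrix_inv_mult:
  fixes A :: "complex^'n^'n"
  assumes "invertible A"
  shows "matrix_inv A ** A = mat 1" "A ** matrix_inv A = mat 1"
  using someI_ex[OF assms[unfolded invertible_def]] by (simp_all add: matrix_inv_def)

lemma ctranspose_matrix_inv:
  fixes A :: "complex^'n^'n"
  assumes "invertible A" "ctranspose A = A"
  shows "ctranspose (matrix_inv A) = matrix_inv A"
proof -
  have "ctranspose (matrix_inv A) ** A = mat 1"
    using arg_cong[OF matrix_inv_mult(2)[OF assms(1)], of ctranspose] assms(2) by (simp add: ctranspose_mult)
  then have "ctranspose (matrix_inv A) ** (A ** matrix_inv A) = matrix_inv A"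
    by (simp add: matrix_mul_assoc)
  then show ?thesis by (simp add: matrix_inv_mult[OF assms(1)])
qed

text \<open>Cauchy-Schwarz turns coercivity into a lower bound m |v| for |A v|; in finite dimension
  injectivity already gives the inverse.\<close>

lemma coercive_inverse:
  fixes A :: "complex^'n^'n"
  assumes "0 < m" and co: "\<And>v. m * (norm v)\<^sup>2 \<le> Re (cdot v (A *v v))"
  shows "invertible A" "norm (matrix_inv A *v w) \<le> norm w / m"
proof -
  have le: "m * norm v \<le> norm (A *v v)" for v
  proof -
    have "m * (norm v)\<^sup>2 \<le> norm v * norm (A *v v)"
      using co[of v] norm_cauchy_schwarz[of v "A *v v"] by (simp add: Re_cdot)
    then have "norm v * (m * norm v) \<le> norm v * norm (A *v v)" by (simp add: power2_eq_square mult_ac)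
    then show ?thesis by (cases "norm v = 0") (auto simp: mult_le_cancel_left)
  qed
  have "v = 0" if "A *v v = 0" for v
    using le[of v] that assms(1) by (simp add: mult_le_0_iff)
  then have "inj ((*v) A)" by (metis matrix_left_invertible_injective matrix_left_invertible_ker)
  then show inv: "invertible A"
    using matrix_left_invertible_injective invertible_left_inverse by blast
  have "A *v (matrix_inv A *v w) = w"
    by (simp add: matrix_vector_mul_assoc matrix_inv_mult[OF inv])
  then show "norm (matrix_inv A *v w) \<le> norm w / m"
    using le[of "matrix_inv A *v w"] assms(1) by (simp add: field_simps)
qed

lemma vstack_mm_mv: "vstack A B *v v = vstack (A *v v) (B *v v)"
  for A :: "complex^'n^'m" and B :: "complex^'n^'k"
  by (auto simp: vec_eq_iff vstack_def matrix_vector_mult_def split: sum.split)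

lemma hstack_mv_vstack: "hstack A B *v vstack u v = A *v u + B *v v"
  for A :: "complex^'n^'r" and B :: "complex^'m^'r"
  by (simp add: vec_eq_iff hstack_def vstack_def matrix_vector_mult_def UNIV_Plus_UNIV[symmetric] sum.Plus
      del: UNIV_Plus_UNIV)

lemma boundary_matrix_mv: "boundary_matrix WB \<Psi> *v v = WB *v vstack (\<Psi> *v v) v"
  by (simp add: boundary_matrix_def matrix_vector_mul_assoc[symmetric] vstack_mm_mv)

text \<open>Multiplying out the blocks exhibits the form as the defect of \<open>\<Psi>b\<close>
  from preserving the Hermitian form of \<open>Q\<close>.\<close>

lemma boundary_form:
  fixes \<Psi>b Q :: "complex^'n^'n"
  shows "(hstack (ctranspose \<Psi>b) (mat 1) ** vstack (hstack Q 0) (hstack 0 (- Q)) ** vstack \<Psi>b (mat 1)) *v v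
    = (ctranspose \<Psi>b ** Q ** \<Psi>b - Q) *v v"
proof -
  have "hstack Q (0::complex^'n^'n) *v vstack p q = Q *v p" "hstack (0::complex^'n^'n) (- Q) *v vstack p q = - (Q *v q)" for p q
    by (simp_all add: hstack_mv_vstack bounded_bilinear.minus_left[OF bounded_bilinear_mv]
        mv_zero_left)
  then show ?thesis
    by (simp add: matrix_vector_mul_assoc[symmetric] vstack_mm_mv hstack_mv_vstack
        mv_minus_right mv_diff_left)
qed

text \<open>Full rank makes the rows a spanning set of minimal size, hence independent. As
  \<open>rows A\<close> is a set, a count of its elements is needed as well to see that no row is
  repeated.\<close>

lemma full_row_rank_right_inverse:
  fixes A :: "'a::field^'n^'m"
  assumes "rank A = CARD('m)"
  shows "\<exists>B. A ** B = mat 1"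
  unfolding matrix_right_invertible_independent_rows
proof (intro allI impI)
  let ?r = "\<lambda>i. row i A"
  have rows: "rows A = range ?r" by (auto simp: rows_def)
  have fin: "finite (rows A)" unfolding rows by simp
  have "vec.dim (rows A) \<le> card (rows A)" by (rule vec.dim_le_card'[OF fin])
  moreover have le: "card (rows A) \<le> CARD('m)" unfolding rows by (rule card_image_le) simp
  ultimately have card: "card (range ?r) = CARD('m)"
    using assms by (simp add: row_rank_def_gen rows)
  then have inj: "inj ?r" by (intro eq_card_imp_inj_on) auto
  have "vec.independent (rows A)"
    by (rule vec.card_le_dim_spanning[of _ "rows A"])
      (use assms le fin in \<open>auto simp: row_rank_def_gen vec.span_superset\<close>)
  then have ind: "vec.independent (range ?r)" by (simp add: rows)
  fix c i assume 0: "(\<Sum>i\<in>UNIV. c i *s row i A) = 0"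
  define u where "u = (\<lambda>x. c (inv ?r x))"
  have "(\<Sum>x\<in>range ?r. u x *s x) = 0"
    using 0 by (subst sum.reindex[OF inj]) (simp add: u_def inv_f_f[OF inj])
  then have "u (?r i) = 0"
    using vec.independentD[OF ind _ _ _, of "range ?r" u "?r i"] by simp
  then show "c i = 0" by (simp add: u_def inv_f_f[OF inj])
qed

lemma L2_bilinear_continuous:
  fixes B :: "'a::euclidean_space \<Rightarrow> 'b::euclidean_space \<Rightarrow> 'c::euclidean_space"
  assumes B: "bounded_bilinear B" and f: "f \<in> L2 a b" and w: "continuous_on {a..b} w"
  shows "(\<lambda>s. B (f s) (w s)) \<in> L2 a b"
proof -
  let ?M = "lebesgue_on {a<..<b}"
  obtain K where K: "K > 0" "\<And>x y. norm (B x y) \<le> norm x * norm y * K"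
    using bounded_bilinear.pos_bounded[OF B] by blast
  have "bounded (w ` {a..b})"
    by (intro compact_imp_bounded compact_continuous_image w) simp
  then obtain C where C: "\<And>x. x \<in> {a..b} \<Longrightarrow> norm (w x) \<le> C"
    by (meson bounded_iff imageI)
  show ?thesis
  proof (rule L2_bound[OF f])
    show "(\<lambda>s. B (f s) (w s)) \<in> borel_measurable (?M)"
      using f by (intro bounded_bilinear_measurable[OF B] continuous_on_Icc_measurable[OF w]) (simp add: L2_def)
    show "AE x in ?M. norm (B (f x) (w x)) \<le> (C * K) * norm (f x)"
    proof (rule AE_I2)
      fix x assume "x \<in> space (?M)"
      then have x: "norm (w x) \<le> C" using C[of x] by (simp add: space_restrict_space)
      have "norm (B (f x) (w x)) \<le> norm (f x) * norm (w x) * K" by (rule K)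
      also have "\<dots> \<le> norm (f x) * C * K" using x K(1) by (intro mult_right_mono mult_left_mono) auto
      finally show "norm (B (f x) (w x)) \<le> (C * K) * norm (f x)" by (simp add: mult_ac)
    qed
  qed
qed

lemma L2_bounded_linear:
  fixes L :: "'a::euclidean_space \<Rightarrow> 'b::euclidean_space"
  assumes L: "bounded_linear L" and f: "f \<in> L2 a b"
  shows "(\<lambda>s. L (f s)) \<in> L2 a b"
proof -
  obtain K where K: "\<And>x. norm (L x) \<le> norm x * K"
    using bounded_linear.bounded[OF L] by blast
  have "L \<in> borel_measurable borel"
    by (intro borel_measurable_continuous_onI linear_continuous_on L)
  then have "(\<lambda>s. L (f s)) \<in> borel_measurable (lebesgue_on {a<..<b})"
    using f by (intro measurable_compose[of f _ borel L borel]) (auto simp: L2_def)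
  then show ?thesis
    using K by (intro L2_bound[OF f, of _ K]) (auto simp: mult.commute)
qed

lemma bounded_linear_vector_scale: "bounded_linear (\<lambda>v::complex^'n. c *s v)"
  unfolding linear_conv_bounded_linear[symmetric]
  by (rule linearI) (auto simp: vec_eq_iff algebra_simps)

lemma has_H1_deriv_cong:
  fixes u :: "real \<Rightarrow> 'a::euclidean_space"
  assumes H: "has_H1_deriv a b u v" and e: "ae_eq a b u u'" and m: "u' \<in> borel_measurable (lebesgue_on {a<..<b})"
  shows "has_H1_deriv a b u' v"
  unfolding has_H1_deriv_def
proof (intro conjI allI impI)
  let ?M = "lebesgue_on {a<..<b}"
  have uL: "u \<in> L2 a b" and "v \<in> L2 a b" using H by (auto simp: has_H1_deriv_def)
  then show "v \<in> L2 a b" by simp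
  show "u' \<in> L2 a b"
    by (rule L2_bound[OF uL m, of 1]) (use e in \<open>auto simp: ae_eq_def elim: eventually_mono\<close>)
  fix \<phi> \<phi>' assume t: "test_function a b \<phi> \<phi>'"
  then have "continuous_on {a..b} \<phi>'" by (auto simp: test_function_def intro: continuous_on_subset)
  then have pm: "\<phi>' \<in> borel_measurable (?M)" by (rule continuous_on_Icc_measurable)
  have um: "u \<in> borel_measurable (?M)" using uL by (simp add: L2_def)
  have "(LINT \<zeta>|?M. \<phi>' \<zeta> *\<^sub>R u' \<zeta>) = (LINT \<zeta>|?M. \<phi>' \<zeta> *\<^sub>R u \<zeta>)"
    using e by (intro integral_cong_AE borel_measurable_scaleR pm m um) (auto simp: ae_eq_def elim: eventually_mono)
  then show "(LINT \<zeta>|?M. \<phi>' \<zeta> *\<^sub>R u' \<zeta>) = - (LINT \<zeta>|?M. \<phi> \<zeta> *\<^sub>R v \<zeta>)"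
    using H t by (simp add: has_H1_deriv_def)
qed

section \<open>The port-Hamiltonian system\<close>

locale port_hamiltonian =
  fixes a b m :: real and P0 P1 :: "complex^'n^'n" and H :: "real \<Rightarrow> complex^'n^'n"
    and WB :: "complex^('n + 'n)^'n" and \<Psi> :: "complex \<Rightarrow> real \<Rightarrow> complex^'n^'n"
  assumes ab: "a < b"
    and P0: "ctranspose P0 = - P0" and P1: "ctranspose P1 = P1" and P1_inv: "invertible P1"
    and H_meas: "H \<in> borel_measurable (lebesgue_on {a<..<b})"
    and H_bdd: "bounded (H ` {a<..<b})"
    and H_herm: "AE \<zeta> in lebesgue_on {a<..<b}. ctranspose (H \<zeta>) = H \<zeta>"
    and m_pos: "m > 0"
    and H_coercive: "AE \<zeta> in lebesgue_on {a<..<b}. \<forall>v. m * (norm v)\<^sup>2 \<le> Re (cdot v (H \<zeta> *v v))"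
    and fundamental: "\<And>\<mu>. is_fundamental_solution a b P0 P1 H \<mu> (\<Psi> \<mu>)"
begin

abbreviation M :: "real measure" where "M \<equiv> lebesgue_on {a<..<b}"

text \<open>Coefficient matrix of the differential equation for \<Psi>.\<close>

definition J :: "complex \<Rightarrow> real \<Rightarrow> complex^'n^'n" where
  "J \<mu> \<zeta> = mat \<mu> ** matrix_inv P1 ** matrix_inv (H \<zeta>) - matrix_inv P1 ** P0"

lemma H_inverse_AE:
  "AE \<zeta> in M. ctranspose (H \<zeta>) = H \<zeta> \<and> invertible (H \<zeta>) \<and> (\<forall>w. norm (matrix_inv (H \<zeta>) *v w) \<le> norm w / m)"
  using H_herm H_coercive by eventually_elim (auto intro: coercive_inverse[OF m_pos])

lemma P1_cancel: "P1 ** (matrix_inv P1 ** A) = A" "matrix_inv P1 ** (P1 ** A) = A"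
  for A :: "complex^'k^'n"
  by (simp_all add: matrix_mul_assoc matrix_inv_mult[OF P1_inv])

lemma P1_cancel_mv: "P1 *v (matrix_inv P1 *v v) = v" "matrix_inv P1 *v (P1 *v v) = v"
  by (simp_all add: matrix_vector_mul_assoc matrix_inv_mult[OF P1_inv])

lemma P1_J: "P1 ** J \<mu> \<zeta> = mat \<mu> ** matrix_inv (H \<zeta>) - P0"
proof -
  have "P1 ** (mat \<mu> ** matrix_inv P1 ** matrix_inv (H \<zeta>)) = mat \<mu> ** (P1 ** (matrix_inv P1 ** matrix_inv (H \<zeta>)))"
    unfolding matrix_mul_assoc mat_mult_commute[of \<mu> P1] ..
  then show ?thesis by (simp add: J_def mm_diff_right P1_cancel)
qed

text \<open>The right side is minus \<open>P1 ** J \<mu> \<zeta>\<close>: skewness of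
  \<open>P0\<close> and Hermitian \<open>P1\<close>, \<open>H\<close> make the coefficients at \<mu>
  and at its reflection in the imaginary axis adjoint with respect to \<open>P1\<close>.\<close>

lemma ctranspose_J_P1:
  assumes "ctranspose (H \<zeta>) = H \<zeta>" "invertible (H \<zeta>)"
  shows "ctranspose (J (- cnj \<mu>) \<zeta>) ** P1 = P0 - mat \<mu> ** matrix_inv (H \<zeta>)"
proof -
  let ?Hi = "matrix_inv (H \<zeta>)" and ?Pi = "matrix_inv P1"
  have "ctranspose (J (- cnj \<mu>) \<zeta>) = ?Hi ** (?Pi ** mat (- \<mu>)) + P0 ** ?Pi"
    by (simp add: J_def ctranspose_diff ctranspose_mult ctranspose_matrix_inv assms P0 P1 P1_inv mm_minus_left)
  moreover have "?Hi ** (?Pi ** mat (- \<mu>)) ** P1 = mat (- \<mu>) ** ?Hi ** (?Pi ** P1)"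
    unfolding mat_mult_commute[of "- \<mu>" ?Pi, symmetric] mat_mult_commute[of "- \<mu>" ?Hi]
    by (simp add: matrix_mul_assoc)
  moreover have "P0 ** ?Pi ** P1 = P0 ** (?Pi ** P1)" by (simp add: matrix_mul_assoc)
  ultimately show ?thesis
    by (simp add: mm_add_left matrix_inv_mult[OF P1_inv] mat_minus mm_minus_left)
qed

lemma \<Psi>_a: "\<Psi> \<mu> a = mat 1"
  using fundamental[of \<mu>] by (simp add: is_fundamental_solution_def)

lemma J_\<Psi>_L2: "(\<lambda>\<zeta>. J \<mu> \<zeta> ** \<Psi> \<mu> \<zeta>) \<in> L2 a b"
  using fundamental[of \<mu>] by (simp add: is_fundamental_solution_def has_H1_deriv_def J_def)

lemma \<Psi>_deriv: "abs_cont_deriv a b (\<Psi> \<mu>) (\<lambda>\<zeta>. J \<mu> \<zeta> ** \<Psi> \<mu> \<zeta>)"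
  using fundamental[of \<mu>] unfolding J_def
  by (intro has_H1_deriv_imp_abs_cont_deriv ab) (auto simp: is_fundamental_solution_def)

lemma \<Psi>_continuous: "continuous_on {a..b} (\<Psi> \<mu>)"
  by (rule abs_cont_deriv_continuous[OF \<Psi>_deriv])

lemma ctranspose_\<Psi>_continuous: "continuous_on {a..b} (\<lambda>\<zeta>. ctranspose (\<Psi> \<mu> \<zeta>))"
  by (rule bounded_linear.continuous_on[OF bounded_linear_ctranspose \<Psi>_continuous])

text \<open>The equation for \<open>\<Psi>\<close> at \<open>- cnj \<mu>\<close> is adjoint to the one at \<open>\<mu>\<close>, so this product has
  derivative zero. It provides the inverse of \<open>\<Psi>\<close> without any uniqueness theorem, and for
  imaginary \<open>\<mu>\<close>, where \<open>- cnj \<mu> = \<mu>\<close>, it makes the quadratic form of condition (ii) vanish.\<close>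

lemma \<Psi>_conjugate:
  assumes "\<zeta> \<in> {a..b}"
  shows "ctranspose (\<Psi> (- cnj \<mu>) \<zeta>) ** (P1 ** \<Psi> \<mu> \<zeta>) = P1"
proof -
  define B where "B = (\<lambda>(X :: complex^'n^'n) (Y :: complex^'n^'n). ctranspose X ** (P1 ** Y))"
  have B: "bounded_bilinear B"
    unfolding B_def
    by (rule bounded_bilinear.comp[OF bounded_bilinear_mm bounded_linear_ctranspose
          bounded_bilinear.bounded_linear_right[OF bounded_bilinear_mm]])
  let ?\<nu> = "- cnj \<mu>"
  have D: "abs_cont_deriv a b (\<lambda>\<zeta>. B (\<Psi> ?\<nu> \<zeta>) (\<Psi> \<mu> \<zeta>)) (\<lambda>_. 0)"
  proof (rule abs_cont_deriv_cong[OF abs_cont_deriv_product[OF B \<Psi>_deriv \<Psi>_deriv]])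
    show "ae_eq a b (\<lambda>x. B (J ?\<nu> x ** \<Psi> ?\<nu> x) (\<Psi> \<mu> x) + B (\<Psi> ?\<nu> x) (J \<mu> x ** \<Psi> \<mu> x)) (\<lambda>_. 0)"
      unfolding ae_eq_def using H_inverse_AE
    proof eventually_elim
      case (elim x)
      have "B (J ?\<nu> x ** \<Psi> ?\<nu> x) (\<Psi> \<mu> x) = ctranspose (\<Psi> ?\<nu> x) ** ((ctranspose (J ?\<nu> x) ** P1) ** \<Psi> \<mu> x)"
        by (simp add: B_def ctranspose_mult matrix_mul_assoc)
      moreover have "B (\<Psi> ?\<nu> x) (J \<mu> x ** \<Psi> \<mu> x) = ctranspose (\<Psi> ?\<nu> x) ** ((P1 ** J \<mu> x) ** \<Psi> \<mu> x)"
        by (simp add: B_def matrix_mul_assoc)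
      ultimately show ?case
        using elim by (simp only: P1_J ctranspose_J_P1) (simp add: mm_diff_left mm_diff_right)
    qed
  qed simp
  have "B (\<Psi> ?\<nu> \<zeta>) (\<Psi> \<mu> \<zeta>) = B (\<Psi> ?\<nu> a) (\<Psi> \<mu> a)"
    using abs_cont_deriv_eq[OF D assms] by simp
  then show ?thesis by (simp add: B_def \<Psi>_a)
qed

text \<open>The inverse of \<Psi> read off \<open>\<Psi>_conjugate\<close>. Being built from a
  fundamental solution, it is continuous, and at imaginary \<mu> it inherits the bound on
  \<Psi>.\<close>

definition \<Theta> :: "complex \<Rightarrow> real \<Rightarrow> complex^'n^'n" where
  "\<Theta> \<mu> \<zeta> = matrix_inv P1 ** (ctranspose (\<Psi> (- cnj \<mu>) \<zeta>) ** P1)"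

lemma \<Theta>_\<Psi>: "\<zeta> \<in> {a..b} \<Longrightarrow> \<Theta> \<mu> \<zeta> ** \<Psi> \<mu> \<zeta> = mat 1"
  using \<Psi>_conjugate[of \<zeta> \<mu>] by (simp add: \<Theta>_def matrix_mul_assoc[symmetric] matrix_inv_mult[OF P1_inv])

lemma \<Psi>_\<Theta>: "\<zeta> \<in> {a..b} \<Longrightarrow> \<Psi> \<mu> \<zeta> ** \<Theta> \<mu> \<zeta> = mat 1"
  using \<Theta>_\<Psi> matrix_left_right_inverse by blast

lemma \<Theta>_continuous: "continuous_on {a..b} (\<Theta> \<mu>)"
  unfolding \<Theta>_def[abs_def]
  by (intro bounded_bilinear.continuous_on[OF bounded_bilinear_mm] continuous_intros ctranspose_\<Psi>_continuous)

text \<open>Measurability of the inverse of \<open>H\<close> is read off the equation for \<open>\<Psi> 1\<close>.\<close>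

lemma H_inverse_measurable: "(\<lambda>\<zeta>. matrix_inv (H \<zeta>)) \<in> borel_measurable M"
proof -
  have "(\<lambda>\<zeta>. P1 ** ((J 1 \<zeta> ** \<Psi> 1 \<zeta>) ** \<Theta> 1 \<zeta> + matrix_inv P1 ** P0)) \<in> borel_measurable M"
  proof -
    have "(\<lambda>\<zeta>. J 1 \<zeta> ** \<Psi> 1 \<zeta>) \<in> borel_measurable M" using J_\<Psi>_L2[of 1] by (simp add: L2_def)
    note 1 = bounded_bilinear_measurable[OF bounded_bilinear_mm this continuous_on_Icc_measurable[OF \<Theta>_continuous[of 1]]]
    show ?thesis
      by (rule bounded_bilinear_measurable[OF bounded_bilinear_mm borel_measurable_const
            borel_measurable_add[OF 1 borel_measurable_const]])
  qed
  moreover have "P1 ** ((J 1 \<zeta> ** \<Psi> 1 \<zeta>) ** \<Theta> 1 \<zeta> + matrix_inv P1 ** P0) = matrix_inv (H \<zeta>)" if "\<zeta> \<in> space M" for \<zeta>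
  proof -
    have "(J 1 \<zeta> ** \<Psi> 1 \<zeta>) ** \<Theta> 1 \<zeta> = J 1 \<zeta>"
      using that \<Psi>_\<Theta>[of \<zeta> 1] by (simp add: matrix_mul_assoc[symmetric] space_restrict_space)
    then show ?thesis by (simp add: J_def P1_cancel)
  qed
  ultimately show ?thesis by (rule measurable_cong[THEN iffD1, rotated])
qed

text \<open>The effort is \<open>u = H x\<close>, the quantity that has a continuous representative
  and boundary values; the state is recovered by inverting \<open>H\<close> almost
  everywhere.\<close>

lemma state_of_effort:
  assumes u: "continuous_on {a..b} u"
  shows "(\<lambda>\<zeta>. matrix_inv (H \<zeta>) *v u \<zeta>) \<in> L2 a b"
    and "ae_eq a b u (\<lambda>\<zeta>. H \<zeta> *v (matrix_inv (H \<zeta>) *v u \<zeta>))"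
proof -
  show "(\<lambda>\<zeta>. matrix_inv (H \<zeta>) *v u \<zeta>) \<in> L2 a b"
  proof (rule L2_bound[OF continuous_L2[OF u]])
    show "(\<lambda>\<zeta>. matrix_inv (H \<zeta>) *v u \<zeta>) \<in> borel_measurable M"
      by (intro bounded_bilinear_measurable[OF bounded_bilinear_mv] H_inverse_measurable
          continuous_on_Icc_measurable[OF u])
    show "AE \<zeta> in M. norm (matrix_inv (H \<zeta>) *v u \<zeta>) \<le> (1 / m) * norm (u \<zeta>)"
      using H_inverse_AE by eventually_elim auto
  qed
  show "ae_eq a b u (\<lambda>\<zeta>. H \<zeta> *v (matrix_inv (H \<zeta>) *v u \<zeta>))"
    unfolding ae_eq_def using H_inverse_AE
    by eventually_elim (simp add: matrix_vector_mul_assoc matrix_inv_mult)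
qed

text \<open>For the effort \<Psi> g the product rule leaves \<Psi> g' as the only inhomogeneity, so
  (A - \<mu>) x = P1 \<Psi> g'. Later choices of g are a constant (eigenvectors), an indefinite
  integral (resolvent) and an affine function (approximate eigenvectors).\<close>

lemma variation_of_constants:
  assumes g: "abs_cont_deriv a b g g'" and g': "g' \<in> L2 a b"
    and bc: "WB *v vstack (\<Psi> \<mu> b *v g b) (g a) = 0"
  defines "x \<equiv> \<lambda>\<zeta>. matrix_inv (H \<zeta>) *v (\<Psi> \<mu> \<zeta> *v g \<zeta>)"
  shows "(x, \<lambda>\<zeta>. \<mu> *s x \<zeta> + P1 *v (\<Psi> \<mu> \<zeta> *v g' \<zeta>)) \<in> phs_operator a b P0 P1 H WB"
proof -
  define u where "u = (\<lambda>\<zeta>. \<Psi> \<mu> \<zeta> *v g \<zeta>)"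
  define v where "v = (\<lambda>\<zeta>. (J \<mu> \<zeta> ** \<Psi> \<mu> \<zeta>) *v g \<zeta> + \<Psi> \<mu> \<zeta> *v g' \<zeta>)"
  have x: "x = (\<lambda>\<zeta>. matrix_inv (H \<zeta>) *v u \<zeta>)" by (simp add: x_def u_def)
  note gc = abs_cont_deriv_continuous[OF g]
  have uv: "abs_cont_deriv a b u v"
    unfolding u_def v_def by (rule abs_cont_deriv_product[OF bounded_bilinear_mv \<Psi>_deriv g])
  note uc = abs_cont_deriv_continuous[OF uv]
  have \<Psi>g': "(\<lambda>\<zeta>. \<Psi> \<mu> \<zeta> *v g' \<zeta>) \<in> L2 a b"
    by (rule L2_bilinear_continuous[OF bounded_bilinear.flip[OF bounded_bilinear_mv] g' \<Psi>_continuous])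
  have vL: "v \<in> L2 a b"
    unfolding v_def by (intro L2_lin L2_bilinear_continuous[OF bounded_bilinear_mv J_\<Psi>_L2 gc] \<Psi>g')
  have xL: "x \<in> L2 a b" and ux: "ae_eq a b u (\<lambda>\<zeta>. H \<zeta> *v x \<zeta>)"
    unfolding x by (rule state_of_effort[OF uc])+
  have "has_H1_deriv a b u v" by (rule abs_cont_deriv_imp_has_H1_deriv[OF ab uv vL])
  then have Hx: "has_H1_deriv a b (\<lambda>\<zeta>. H \<zeta> *v x \<zeta>) v"
    by (rule has_H1_deriv_cong[OF _ ux])
      (use xL in \<open>auto simp: L2_def intro!: bounded_bilinear_measurable[OF bounded_bilinear_mv] H_meas\<close>)
  have dom: "x \<in> phs_dom a b H WB"
    unfolding phs_dom_def H1_def mem_Collect_eq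
  proof (intro conjI exI)
    show "WB *v vstack (u b) (u a) = 0" using bc by (simp add: u_def \<Psi>_a)
  qed (fact xL Hx uc ux)+
  have yL: "(\<lambda>\<zeta>. \<mu> *s x \<zeta> + P1 *v (\<Psi> \<mu> \<zeta> *v g' \<zeta>)) \<in> L2 a b"
    by (intro L2_lin L2_bounded_linear[OF bounded_linear_vector_scale xL]
        L2_bounded_linear[OF bounded_linear_mv \<Psi>g'])
  have "ae_eq a b (\<lambda>\<zeta>. \<mu> *s x \<zeta> + P1 *v (\<Psi> \<mu> \<zeta> *v g' \<zeta>)) (\<lambda>\<zeta>. P1 *v v \<zeta> + P0 *v (H \<zeta> *v x \<zeta>))"
    using ux unfolding ae_eq_def
  proof eventually_elim
    case (elim \<zeta>)
    have "P1 *v ((J \<mu> \<zeta> ** \<Psi> \<mu> \<zeta>) *v g \<zeta>) = (P1 ** J \<mu> \<zeta>) *v u \<zeta>"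
      by (simp add: u_def matrix_vector_mul_assoc matrix_mul_assoc)
    also have "\<dots> = \<mu> *s x \<zeta> - P0 *v u \<zeta>"
      unfolding P1_J x by (simp add: mv_diff_left
          matrix_vector_mul_assoc[symmetric] mat_mult_vec)
    finally show ?case
      using elim by (simp add: v_def mv_add_right)
  qed
  then show ?thesis
    unfolding phs_operator_def using dom yL Hx by blast
qed

text \<open>The converse of variation of constants: the adjoint of the conjugate solution times
  \<open>P1\<close> is an integrating factor, so the equation for the effort reduces to an integral
  of \<mu> x - A x.\<close>

lemma effort_of_state:
  assumes xy: "(x, y) \<in> phs_operator a b P0 P1 H WB"
  obtains u where "continuous_on {a..b} u" "ae_eq a b x (\<lambda>\<zeta>. matrix_inv (H \<zeta>) *v u \<zeta>)"
    "WB *v vstack (u b) (u a) = 0"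
    "\<And>\<mu>. abs_cont_deriv a b (\<lambda>\<zeta>. ctranspose (\<Psi> (- cnj \<mu>) \<zeta>) *v (P1 *v u \<zeta>))
       (\<lambda>\<zeta>. - (ctranspose (\<Psi> (- cnj \<mu>) \<zeta>) *v (\<mu> *s x \<zeta> - y \<zeta>)))"
proof -
  obtain v u where v: "has_H1_deriv a b (\<lambda>\<zeta>. H \<zeta> *v x \<zeta>) v"
      "ae_eq a b y (\<lambda>\<zeta>. P1 *v v \<zeta> + P0 *v (H \<zeta> *v x \<zeta>))"
    and u: "continuous_on {a..b} u" "ae_eq a b u (\<lambda>\<zeta>. H \<zeta> *v x \<zeta>)" "WB *v vstack (u b) (u a) = 0"
    using xy unfolding phs_operator_def phs_dom_def by blast
  have "has_H1_deriv a b u v"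
    by (rule has_H1_deriv_cong[OF v(1)])
      (use u continuous_on_Icc_measurable in \<open>auto simp: ae_eq_def elim: eventually_mono\<close>)
  then have uv: "abs_cont_deriv a b u v" by (rule has_H1_deriv_imp_abs_cont_deriv[OF ab u(1)])
  have xu: "ae_eq a b x (\<lambda>\<zeta>. matrix_inv (H \<zeta>) *v u \<zeta>)"
    using u(2) H_inverse_AE unfolding ae_eq_def
    by eventually_elim (simp add: matrix_vector_mul_assoc matrix_inv_mult)
  have "abs_cont_deriv a b (\<lambda>\<zeta>. ctranspose (\<Psi> (- cnj \<mu>) \<zeta>) *v (P1 *v u \<zeta>))
       (\<lambda>\<zeta>. - (ctranspose (\<Psi> (- cnj \<mu>) \<zeta>) *v (\<mu> *s x \<zeta> - y \<zeta>)))" for \<mu>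
  proof -
    let ?\<nu> = "- cnj \<mu>"
    define B where "B = (\<lambda>(X :: complex^'n^'n) (p :: complex^'n). ctranspose X *v (P1 *v p))"
    have B: "bounded_bilinear B"
      unfolding B_def
      by (rule bounded_bilinear.comp[OF bounded_bilinear_mv bounded_linear_ctranspose
            bounded_linear_mv])
    have "abs_cont_deriv a b (\<lambda>\<zeta>. B (\<Psi> ?\<nu> \<zeta>) (u \<zeta>)) (\<lambda>\<zeta>. - (ctranspose (\<Psi> ?\<nu> \<zeta>) *v (\<mu> *s x \<zeta> - y \<zeta>)))"
    proof (rule abs_cont_deriv_cong[OF abs_cont_deriv_product[OF B \<Psi>_deriv uv]])
      show "ae_eq a b (\<lambda>\<zeta>. B (J ?\<nu> \<zeta> ** \<Psi> ?\<nu> \<zeta>) (u \<zeta>) + B (\<Psi> ?\<nu> \<zeta>) (v \<zeta>))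
          (\<lambda>\<zeta>. - (ctranspose (\<Psi> ?\<nu> \<zeta>) *v (\<mu> *s x \<zeta> - y \<zeta>)))"
        using H_inverse_AE xu u(2) v(2) unfolding ae_eq_def
      proof eventually_elim
        case (elim \<zeta>)
        have "B (J ?\<nu> \<zeta> ** \<Psi> ?\<nu> \<zeta>) (u \<zeta>) = ctranspose (\<Psi> ?\<nu> \<zeta>) *v ((ctranspose (J ?\<nu> \<zeta>) ** P1) *v u \<zeta>)"
          by (simp add: B_def ctranspose_mult matrix_vector_mul_assoc matrix_mul_assoc)
        also have "(ctranspose (J ?\<nu> \<zeta>) ** P1) *v u \<zeta> = P0 *v u \<zeta> - \<mu> *s x \<zeta>"
          using elim by (simp add: ctranspose_J_P1 mv_diff_left
              matrix_vector_mul_assoc[symmetric] mat_mult_vec)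
        finally have "B (J ?\<nu> \<zeta> ** \<Psi> ?\<nu> \<zeta>) (u \<zeta>) + B (\<Psi> ?\<nu> \<zeta>) (v \<zeta>)
            = ctranspose (\<Psi> ?\<nu> \<zeta>) *v ((P0 *v u \<zeta> - \<mu> *s x \<zeta>) + P1 *v v \<zeta>)"
          by (simp add: B_def mv_add_right)
        also have "(P0 *v u \<zeta> - \<mu> *s x \<zeta>) + P1 *v v \<zeta> = - (\<mu> *s x \<zeta> - y \<zeta>)"
          using elim by simp
        finally show ?case by (simp only: mv_minus_right)
      qed
    qed simp
    then show ?thesis by (simp add: B_def)
  qed
  then show ?thesis using that u(1,3) xu by blast
qed

end

section \<open>Estimates for the energy norm\<close>

text \<open>The variance of the norm of f about its mean \<open>c\<close> is nonnegative.\<close>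

lemma integral_norm_squared_le:
  assumes "a < b" and f: "f \<in> L2 a b"
  shows "(LINT x|lebesgue_on {a<..<b}. norm (f x))\<^sup>2 \<le> (b - a) * (LINT x|lebesgue_on {a<..<b}. (norm (f x))\<^sup>2)"
proof -
  let ?M = "lebesgue_on {a<..<b}"
  interpret finite_measure "?M" by (rule finite_measure_lebesgue_on_Ioo)
  let ?I = "LINT x|?M. norm (f x)" and ?S = "LINT x|?M. (norm (f x))\<^sup>2"
  define c where "c = ?I / (b - a)"
  have i1: "integrable (?M) (\<lambda>x. norm (f x))"
    using L2_integrable[OF f] by simp
  have i2: "integrable (?M) (\<lambda>x. (norm (f x))\<^sup>2)" using f by (simp add: L2_def)
  have sp: "measure (?M) {a<..<b} = b - a"
    using assms(1) by (simp add: measure_restrict_space space_restrict_space)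
  have "0 \<le> (LINT x|?M. (norm (f x) - c)\<^sup>2)" by (rule integral_nonneg_AE) simp
  also have "(LINT x|?M. (norm (f x) - c)\<^sup>2)
      = (LINT x|?M. ((norm (f x))\<^sup>2 - (2 * c) * norm (f x)) + c\<^sup>2)"
    by (simp add: power2_diff algebra_simps)
  also have "\<dots> = ?S - (2 * c) * ?I + c\<^sup>2 * (b - a)"
    using i1 i2 sp by (simp add: Bochner_Integration.integral_add Bochner_Integration.integral_diff
        Bochner_Integration.integrable_diff mult.commute)
  also have "c\<^sup>2 * (b - a) = c * ?I" using assms(1) by (simp add: c_def power2_eq_square)
  finally have "c * ?I \<le> ?S" by (simp add: mult.commute mult.left_commute)
  then have "(b - a) * (c * ?I) \<le> (b - a) * ?S" using assms(1) by (intro mult_left_mono) auto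
  moreover have "(b - a) * (c * ?I) = ?I\<^sup>2" using assms(1) by (simp add: c_def power2_eq_square)
  ultimately show ?thesis by simp
qed

context port_hamiltonian
begin

lemma H_bound: "\<exists>C>0. \<forall>\<zeta>\<in>{a<..<b}. \<forall>v. norm (H \<zeta> *v v) \<le> C * norm v"
proof -
  obtain K where K: "K > 0" "\<And>A v. norm ((A :: complex^'n^'n) *v (v :: complex^'n)) \<le> norm A * norm v * K"
    using bounded_bilinear.pos_bounded[OF bounded_bilinear_mv] by blast
  obtain C where C: "C > 0" "\<And>\<zeta>. \<zeta> \<in> {a<..<b} \<Longrightarrow> norm (H \<zeta>) \<le> C"
    using H_bdd unfolding bounded_pos by auto
  have "norm (H \<zeta> *v v) \<le> (C * K) * norm v" if "\<zeta> \<in> {a<..<b}" for \<zeta> v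
  proof -
    have "norm (H \<zeta> *v v) \<le> norm (H \<zeta>) * norm v * K" by (rule K)
    also have "\<dots> \<le> C * norm v * K" using C(2)[OF that] K(1) by (intro mult_right_mono) auto
    finally show ?thesis by (simp add: mult_ac)
  qed
  then show ?thesis using C(1) K(1) by (intro exI[of _ "C * K"]) auto
qed

text \<open>Some positive bound of \<open>H\<close>, not necessarily the least; positivity allows
  division by it.\<close>

definition H_sup :: real where
  "H_sup = (SOME C. 0 < C \<and> (\<forall>\<zeta>\<in>{a<..<b}. \<forall>v. norm (H \<zeta> *v v) \<le> C * norm v))"

lemma H_sup: "0 < H_sup" "\<zeta> \<in> {a<..<b} \<Longrightarrow> norm (H \<zeta> *v v) \<le> H_sup * norm v"
  using someI_ex[of "\<lambda>C. 0 < C \<and> (\<forall>\<zeta>\<in>{a<..<b}. \<forall>v. norm (H \<zeta> *v v) \<le> C * norm v)"] H_bound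
  unfolding H_sup_def[symmetric] by auto

lemma space_M: "\<zeta> \<in> space M \<longleftrightarrow> \<zeta> \<in> {a<..<b}"
  by (simp add: space_restrict_space)

lemma energy_integrable:
  assumes f: "f \<in> L2 a b" and g: "g \<in> L2 a b"
  shows "integrable M (\<lambda>\<zeta>. cdot (g \<zeta>) (H \<zeta> *v f \<zeta>))"
proof -
  obtain K where K: "K > 0" "\<And>v w :: complex^'n. norm (cdot v w) \<le> norm v * norm w * K"
    using bounded_bilinear.pos_bounded[OF bounded_bilinear_cdot] by blast
  let ?B = "\<lambda>\<zeta>. (K * H_sup) * ((norm (f \<zeta>))\<^sup>2 + (norm (g \<zeta>))\<^sup>2)"
  show ?thesis
  proof (rule Bochner_Integration.integrable_bound)
    show "integrable M ?B"
      using f g by (intro integrable_mult_right Bochner_Integration.integrable_add) (auto simp: L2_def)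
    show "(\<lambda>\<zeta>. cdot (g \<zeta>) (H \<zeta> *v f \<zeta>)) \<in> borel_measurable M"
      using f g by (intro bounded_bilinear_measurable[OF bounded_bilinear_cdot]
          bounded_bilinear_measurable[OF bounded_bilinear_mv] H_meas) (auto simp: L2_def)
    show "AE \<zeta> in M. norm (cdot (g \<zeta>) (H \<zeta> *v f \<zeta>)) \<le> norm (?B \<zeta>)"
    proof (rule AE_I2)
      fix \<zeta> assume "\<zeta> \<in> space M"
      then have z: "\<zeta> \<in> {a<..<b}" by (simp add: space_M)
      have "norm (cdot (g \<zeta>) (H \<zeta> *v f \<zeta>)) \<le> norm (g \<zeta>) * norm (H \<zeta> *v f \<zeta>) * K" by (rule K)
      also have "\<dots> \<le> norm (g \<zeta>) * (H_sup * norm (f \<zeta>)) * K"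
        using H_sup(2)[OF z] K(1) by (intro mult_right_mono mult_left_mono) auto
      also have "\<dots> = (K * H_sup) * (norm (f \<zeta>) * norm (g \<zeta>))" by (simp add: mult_ac)
      also have "\<dots> \<le> ?B \<zeta>"
      proof (rule mult_left_mono)
        have "2 * (norm (f \<zeta>) * norm (g \<zeta>)) \<le> (norm (f \<zeta>))\<^sup>2 + (norm (g \<zeta>))\<^sup>2"
          using sum_squares_bound[of "norm (f \<zeta>)" "norm (g \<zeta>)"] by simp
        moreover have "0 \<le> norm (f \<zeta>) * norm (g \<zeta>)" by simp
        ultimately show "norm (f \<zeta>) * norm (g \<zeta>) \<le> (norm (f \<zeta>))\<^sup>2 + (norm (g \<zeta>))\<^sup>2" by linarith
      qed (use K(1) H_sup(1) in simp)
      finally show "norm (cdot (g \<zeta>) (H \<zeta> *v f \<zeta>)) \<le> norm (?B \<zeta>)"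
        using K(1) H_sup(1) by simp
    qed
  qed
qed

abbreviation sc :: "complex \<Rightarrow> (real \<Rightarrow> complex^'n) \<Rightarrow> real \<Rightarrow> complex^'n" where
  "sc c f \<equiv> (\<lambda>\<zeta>. c *s f \<zeta>)"

lemma Re_innerH: "f \<in> L2 a b \<Longrightarrow> Re (innerH a b H f f) = 1/2 * (LINT \<zeta>|M. Re (cdot (f \<zeta>) (H \<zeta> *v f \<zeta>)))"
  using integral_bounded_linear[OF bounded_linear_Re energy_integrable[of f f]] by (simp add: innerH_def)

sublocale energy: semi_inner sc "L2 a b" "innerH a b H"
proof
  fix x y :: "real \<Rightarrow> complex^'n" and c d :: complex
  show "sc c (x + y) = sc c x + sc c y" "sc (c + d) x = sc c x + sc d x"
    "sc c (sc d x) = sc (c * d) x" "sc 1 x = x"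
    by (auto simp: fun_eq_iff vec_eq_iff algebra_simps)
next
  interpret V: vector_space "sc"
    by standard (auto simp: fun_eq_iff vec_eq_iff algebra_simps)
  show "module.subspace sc (L2 a b)"
  proof (rule V.subspaceI)
    show "(0 :: real \<Rightarrow> complex^'n) \<in> L2 a b" by (simp add: L2_def zero_fun_def)
    fix x y :: "real \<Rightarrow> complex^'n" and c assume "x \<in> L2 a b" "y \<in> L2 a b"
    then show "x + y \<in> L2 a b" "sc c x \<in> L2 a b"
      using L2_lin[of x a b y] L2_bounded_linear[OF bounded_linear_vector_scale] by (auto simp: plus_fun_def)
  qed
next
  fix x y z :: "real \<Rightarrow> complex^'n" assume *: "x \<in> L2 a b" "y \<in> L2 a b" "z \<in> L2 a b"
  show "innerH a b H (x + y) z = innerH a b H x z + innerH a b H y z"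
    using energy_integrable[OF *(1,3)] energy_integrable[OF *(2,3)]
    by (simp add: innerH_def mv_add_right
        bounded_bilinear.add_right[OF bounded_bilinear_cdot] Bochner_Integration.integral_add algebra_simps)
next
  fix x y :: "real \<Rightarrow> complex^'n" and c assume *: "x \<in> L2 a b" "y \<in> L2 a b"
  show "innerH a b H (sc c x) y = c * innerH a b H x y"
    by (simp add: innerH_def mv_scale cdot_scale_right)
  have "cnj (LINT \<zeta>|M. cdot (y \<zeta>) (H \<zeta> *v x \<zeta>)) = (LINT \<zeta>|M. cnj (cdot (y \<zeta>) (H \<zeta> *v x \<zeta>)))"
    by (rule integral_bounded_linear[OF bounded_linear_cnj energy_integrable[OF *], symmetric])
  also have "\<dots> = (LINT \<zeta>|M. cdot (x \<zeta>) (H \<zeta> *v y \<zeta>))"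
  proof (rule integral_cong_AE)
    show "(\<lambda>\<zeta>. cnj (cdot (y \<zeta>) (H \<zeta> *v x \<zeta>))) \<in> borel_measurable M"
      using energy_integrable[OF *] by (intro borel_measurable_integrable integrable_bounded_linear[OF bounded_linear_cnj])
    show "(\<lambda>\<zeta>. cdot (x \<zeta>) (H \<zeta> *v y \<zeta>)) \<in> borel_measurable M"
      using energy_integrable[OF *(2,1)] by (rule borel_measurable_integrable)
    show "AE \<zeta> in M. cnj (cdot (y \<zeta>) (H \<zeta> *v x \<zeta>)) = cdot (x \<zeta>) (H \<zeta> *v y \<zeta>)"
      using H_herm by eventually_elim (simp add: cnj_cdot cdot_mv)
  qed
  finally show "innerH a b H y x = cnj (innerH a b H x y)"
    by (simp add: innerH_def)
next
  fix x :: "real \<Rightarrow> complex^'n" assume x: "x \<in> L2 a b"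
  have "0 \<le> (LINT \<zeta>|M. Re (cdot (x \<zeta>) (H \<zeta> *v x \<zeta>)))"
  proof (rule integral_nonneg_AE)
    show "AE \<zeta> in M. 0 \<le> Re (cdot (x \<zeta>) (H \<zeta> *v x \<zeta>))"
      using H_coercive
    proof eventually_elim
      case (elim \<zeta>)
      have "0 \<le> m * (norm (x \<zeta>))\<^sup>2" using m_pos by simp
      also have "\<dots> \<le> Re (cdot (x \<zeta>) (H \<zeta> *v x \<zeta>))" using elim by simp
      finally show ?case .
    qed
  qed
  then show "0 \<le> Re (innerH a b H x x)" by (simp add: Re_innerH[OF x])
qed

lemma nm_eq_normH: "energy.nm f = normH a b H f"
  by (simp add: energy.nm_def normH_def)

lemma nm_lower:
  assumes f: "f \<in> L2 a b"
  shows "m / 2 * (LINT \<zeta>|M. (norm (f \<zeta>))\<^sup>2) \<le> (energy.nm f)\<^sup>2"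
proof -
  have "(LINT \<zeta>|M. m * (norm (f \<zeta>))\<^sup>2) \<le> (LINT \<zeta>|M. Re (cdot (f \<zeta>) (H \<zeta> *v f \<zeta>)))"
  proof (rule integral_mono_AE)
    show "integrable M (\<lambda>\<zeta>. m * (norm (f \<zeta>))\<^sup>2)" using f by (simp add: L2_def)
    show "integrable M (\<lambda>\<zeta>. Re (cdot (f \<zeta>) (H \<zeta> *v f \<zeta>)))"
      by (rule integrable_bounded_linear[OF bounded_linear_Re energy_integrable[OF f f]])
    show "AE \<zeta> in M. m * (norm (f \<zeta>))\<^sup>2 \<le> Re (cdot (f \<zeta>) (H \<zeta> *v f \<zeta>))"
      using H_coercive by eventually_elim blast
  qed
  then show ?thesis by (simp add: energy.nm_sq[OF f] Re_innerH[OF f])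
qed

lemma nm_le_sup:
  assumes f: "f \<in> L2 a b" and le: "AE \<zeta> in M. norm (f \<zeta>) \<le> s" and s: "0 \<le> s"
  shows "energy.nm f \<le> sqrt (H_sup * (b - a) / 2) * s"
proof -
  interpret finite_measure M by (rule finite_measure_lebesgue_on_Ioo)
  have sp: "measure M {a<..<b} = b - a"
    using ab by (simp add: measure_restrict_space space_restrict_space)
  have "(LINT \<zeta>|M. Re (cdot (f \<zeta>) (H \<zeta> *v f \<zeta>))) \<le> (LINT \<zeta>|M. H_sup * s\<^sup>2)"
  proof (rule integral_mono_AE)
    show "integrable M (\<lambda>\<zeta>. H_sup * s\<^sup>2)" by simp
    show "integrable M (\<lambda>\<zeta>. Re (cdot (f \<zeta>) (H \<zeta> *v f \<zeta>)))"
      by (rule integrable_bounded_linear[OF bounded_linear_Re energy_integrable[OF f f]])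
    show "AE \<zeta> in M. Re (cdot (f \<zeta>) (H \<zeta> *v f \<zeta>)) \<le> H_sup * s\<^sup>2"
      using le AE_space
    proof eventually_elim
      case (elim \<zeta>)
      have "Re (cdot (f \<zeta>) (H \<zeta> *v f \<zeta>)) \<le> norm (f \<zeta>) * norm (H \<zeta> *v f \<zeta>)"
        unfolding Re_cdot by (rule norm_cauchy_schwarz)
      also have "\<dots> \<le> norm (f \<zeta>) * (H_sup * norm (f \<zeta>))"
        using H_sup(2)[of \<zeta>] elim(2) by (intro mult_left_mono) (auto simp: space_M)
      also have "\<dots> \<le> s * (H_sup * s)"
        using elim(1) H_sup(1) s by (intro mult_mono) auto
      finally show ?case by (simp add: power2_eq_square mult_ac)
    qed
  qed
  then have "(energy.nm f)\<^sup>2 \<le> (H_sup * (b - a) / 2) * s\<^sup>2"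
    by (simp add: energy.nm_sq[OF f] Re_innerH[OF f] sp mult_ac)
  also have "\<dots> = (sqrt (H_sup * (b - a) / 2) * s)\<^sup>2"
    using H_sup(1) ab by (simp add: power_mult_distrib)
  finally show ?thesis
    by (rule power2_le_imp_le) (use H_sup(1) ab s in simp)
qed

lemma nm_ae_eq:
  assumes "f \<in> L2 a b" "g \<in> L2 a b" "ae_eq a b f g"
  shows "energy.nm (f - g) = 0"
proof -
  have "energy.nm (f - g) \<le> sqrt (H_sup * (b - a) / 2) * 0"
    using assms by (intro nm_le_sup) (auto simp: ae_eq_def elim: eventually_mono)
  then show ?thesis using energy.nm_ge_0[OF energy.V_closed(3)[OF assms(1,2)]] by simp
qed

text \<open>Variation of constants sees the right-hand side through its L1 norm, which this bounds
  by the energy norm.\<close>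

lemma integral_norm_le_nm:
  assumes "f \<in> L2 a b"
  shows "(LINT \<zeta>|M. norm (f \<zeta>)) \<le> sqrt (2 * (b - a) / m) * energy.nm f"
proof (rule power2_le_imp_le)
  have "(LINT \<zeta>|M. norm (f \<zeta>))\<^sup>2 \<le> (b - a) * (LINT \<zeta>|M. (norm (f \<zeta>))\<^sup>2)"
    by (rule integral_norm_squared_le[OF ab assms])
  also have "\<dots> \<le> (b - a) * (2 / m * (energy.nm f)\<^sup>2)"
    using nm_lower[OF assms] m_pos ab by (intro mult_left_mono) (auto simp: field_simps)
  also have "\<dots> = (sqrt (2 * (b - a) / m) * energy.nm f)\<^sup>2"
    using m_pos ab by (simp add: power_mult_distrib)
  finally show "(LINT \<zeta>|M. norm (f \<zeta>))\<^sup>2 \<le> (sqrt (2 * (b - a) / m) * energy.nm f)\<^sup>2" .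
qed (use assms m_pos ab in simp)

text \<open>Pointwise, v is \<Theta> applied to \<Psi> v = H x, so |v| is at most C
  \<open>H_sup\<close> |x|; integrating squares keeps v visible in the energy norm.\<close>

lemma nm_propagated_ge:
  assumes C: "0 < C" "\<And>\<zeta> v. \<zeta> \<in> {a..b} \<Longrightarrow> norm (\<Theta> \<mu> \<zeta> *v v) \<le> C * norm v"
  shows "sqrt (m * (b - a) / 2) / (C * H_sup) * norm v \<le> energy.nm (\<lambda>\<zeta>. matrix_inv (H \<zeta>) *v (\<Psi> \<mu> \<zeta> *v v))"
proof (rule power2_le_imp_le)
  let ?x = "\<lambda>\<zeta>. matrix_inv (H \<zeta>) *v (\<Psi> \<mu> \<zeta> *v v)"
  interpret finite_measure M by (rule finite_measure_lebesgue_on_Ioo)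
  have sp: "measure M {a<..<b} = b - a"
    using ab by (simp add: measure_restrict_space space_restrict_space)
  have xL: "?x \<in> L2 a b"
    by (intro state_of_effort continuous_on_mv \<Psi>_continuous continuous_intros)
  have "(LINT \<zeta>|M. (norm v / (C * H_sup))\<^sup>2) \<le> (LINT \<zeta>|M. (norm (?x \<zeta>))\<^sup>2)"
  proof (rule integral_mono_AE)
    show "integrable M (\<lambda>\<zeta>. (norm (?x \<zeta>))\<^sup>2)" using xL by (simp add: L2_def)
    show "AE \<zeta> in M. (norm v / (C * H_sup))\<^sup>2 \<le> (norm (?x \<zeta>))\<^sup>2"
      using H_inverse_AE AE_space
    proof eventually_elim
      case (elim \<zeta>)
      then have z: "\<zeta> \<in> {a<..<b}" "\<zeta> \<in> {a..b}" by (auto simp: space_M)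
      have "norm v = norm (\<Theta> \<mu> \<zeta> *v (\<Psi> \<mu> \<zeta> *v v))"
        using \<Theta>_\<Psi>[OF z(2)] by (simp add: matrix_vector_mul_assoc)
      also have "\<dots> \<le> C * norm (\<Psi> \<mu> \<zeta> *v v)" by (rule C(2)[OF z(2)])
      also have "\<Psi> \<mu> \<zeta> *v v = H \<zeta> *v ?x \<zeta>"
        using elim by (simp add: matrix_vector_mul_assoc matrix_mul_assoc matrix_inv_mult)
      also have "C * norm (H \<zeta> *v ?x \<zeta>) \<le> C * (H_sup * norm (?x \<zeta>))"
        using H_sup(2)[OF z(1)] C(1) by (intro mult_left_mono) auto
      finally have "norm v / (C * H_sup) \<le> norm (?x \<zeta>)"
        using C(1) H_sup(1) by (simp add: field_simps)
      then show ?case using C(1) H_sup(1) by (intro power_mono) auto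
    qed
  qed simp
  then have "m / 2 * ((b - a) * (norm v / (C * H_sup))\<^sup>2) \<le> m / 2 * (LINT \<zeta>|M. (norm (?x \<zeta>))\<^sup>2)"
    using m_pos sp by (intro mult_left_mono) auto
  also have "\<dots> \<le> (energy.nm ?x)\<^sup>2" by (rule nm_lower[OF xL])
  also have "m / 2 * ((b - a) * (norm v / (C * H_sup))\<^sup>2) = (sqrt (m * (b - a) / 2) / (C * H_sup) * norm v)\<^sup>2"
    using m_pos ab by (simp add: power_mult_distrib power_divide)
  finally show "(sqrt (m * (b - a) / 2) / (C * H_sup) * norm v)\<^sup>2 \<le> (energy.nm ?x)\<^sup>2" .
  show "0 \<le> energy.nm ?x" using xL by simp
qed

end

text \<open>Write s = n \<tau> + r with r below \<tau>. The n halvings give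
  \<open>nm x / 2 ^ n\<close>, and the incomplete last period costs the factor 2.\<close>

lemma (in nonexpansive_semigroup) exponential_decay:
  assumes \<tau>: "0 < \<tau>" and half: "\<And>x. x \<in> V \<Longrightarrow> nm (S \<tau> x) \<le> nm x / 2"
    and s: "0 \<le> s" and x: "x \<in> V"
  shows "nm (S s x) \<le> 2 * exp (- (ln 2 / \<tau>) * s) * nm x"
proof -
  have pow: "nm (S (real n * \<tau>) y) \<le> nm y / 2 ^ n" if y: "y \<in> V" for n y
  proof (induction n)
    case 0
    then show ?case using S_contr[of 0 y] y by simp
  next
    case (Suc n)
    have nn: "0 \<le> real n * \<tau>" using \<tau> by simp
    have eq: "real (Suc n) * \<tau> = \<tau> + real n * \<tau>" by (simp add: algebra_simps)
    have "nm (S (\<tau> + real n * \<tau>) y) \<le> nm (S \<tau> (S (real n * \<tau>) y)) + nm (S (\<tau> + real n * \<tau>) y - S \<tau> (S (real n * \<tau>) y))"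
      using \<tau> nn y by (intro nm_le_diff) auto
    also have "\<dots> = nm (S \<tau> (S (real n * \<tau>) y))" using S_add[of \<tau> "real n * \<tau>" y] \<tau> nn y by simp
    also have "\<dots> \<le> nm (S (real n * \<tau>) y) / 2" using nn y by (intro half) auto
    finally show ?case unfolding eq using Suc by simp
  qed
  define n where "n = nat \<lfloor>s / \<tau>\<rfloor>"
  have q: "0 \<le> s / \<tau>" using s \<tau> by simp
  have n: "real n \<le> s / \<tau>" "s / \<tau> < real n + 1"
    using q unfolding n_def by (auto simp: of_nat_nat)
  define r where "r = s - real n * \<tau>"
  have r: "0 \<le> r" using n(1) \<tau> by (simp add: r_def pos_le_divide_eq)
  have nn: "0 \<le> real n * \<tau>" using \<tau> by simp
  have seq: "s = real n * \<tau> + r" by (simp add: r_def)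
  have "nm (S (real n * \<tau> + r) x) \<le> nm (S (real n * \<tau>) (S r x)) + nm (S (real n * \<tau> + r) x - S (real n * \<tau>) (S r x))"
    using r nn x by (intro nm_le_diff) auto
  also have "\<dots> = nm (S (real n * \<tau>) (S r x))" using S_add[OF nn r x] by simp
  also have "\<dots> \<le> nm (S r x) / 2 ^ n" using r x by (intro pow) auto
  also have "\<dots> \<le> nm x / 2 ^ n" using S_contr[OF r x] by (simp add: divide_right_mono)
  finally have "nm (S s x) \<le> nm x / 2 ^ n" by (simp add: seq[symmetric])
  also have "\<dots> \<le> 2 * exp (- (ln 2 / \<tau>) * s) * nm x"
  proof -
    have "ln 2 * (s / \<tau>) \<le> ln 2 * (real n + 1)" using n(2) by (intro mult_left_mono) auto
    then have "exp (- (ln 2 * (real n + 1))) \<le> exp (- (ln 2 / \<tau>) * s)" by simp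
    moreover have "exp (- (ln 2 * (real n + 1))) = 1 / (2 * 2 ^ n)"
    proof -
      have "exp (ln 2 * (real n + 1)) = exp (real (Suc n) * ln 2)" by (simp add: algebra_simps)
      also have "\<dots> = 2 ^ Suc n" by (subst exp_of_nat_mult) simp
      finally show ?thesis by (simp add: exp_minus inverse_eq_divide)
    qed
    ultimately have "1 / 2 ^ n \<le> 2 * exp (- (ln 2 / \<tau>) * s)" by simp
    then have "1 / 2 ^ n * nm x \<le> 2 * exp (- (ln 2 / \<tau>) * s) * nm x"
      using x by (intro mult_right_mono) auto
    then show ?thesis by simp
  qed
  finally show ?thesis .
qed

section \<open>Stability and the boundary matrix\<close>

text \<open>The supremum in \<open>bounded_\<Psi>\<close> is taken in the extended reals, where
  being finite really expresses boundedness.\<close>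

locale phs_semigroup = port_hamiltonian a b m P0 P1 H WB \<Psi>
  for a b m :: real and P0 P1 :: "complex^'n^'n" and H :: "real \<Rightarrow> complex^'n^'n"
    and WB :: "complex^('n + 'n)^'n" and \<Psi> :: "complex \<Rightarrow> real \<Rightarrow> complex^'n^'n" +
  fixes T :: "real \<Rightarrow> (real \<Rightarrow> complex^'n) \<Rightarrow> (real \<Rightarrow> complex^'n)"
  assumes rank_WB: "rank WB = CARD('n)"
    and contraction: "contraction_semigroup a b H T"
    and generator: "generator a b H T = phs_operator a b P0 P1 H WB"
    and bounded_\<Psi>: "(SUP \<omega>::real. SUP \<zeta>\<in>{a<..<b}. ereal (onorm ((*v) (\<Psi> (\<i> * of_real \<omega>) \<zeta>)))) < \<infinity>"
begin

lemma T_L2: "0 \<le> t \<Longrightarrow> x \<in> L2 a b \<Longrightarrow> T t x \<in> L2 a b"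
  using contraction by (auto simp: contraction_semigroup_def C0_semigroup_def bounded_operator_def)

sublocale sg: nonexpansive_semigroup sc "L2 a b" "innerH a b H" T
proof
  have C0: "C0_semigroup a b H T" and contr: "\<And>t. 0 \<le> t \<Longrightarrow> opnorm_le a b H (T t) 1"
    using contraction by (auto simp: contraction_semigroup_def)
  show "0 \<le> t \<Longrightarrow> x \<in> L2 a b \<Longrightarrow> T t x \<in> L2 a b" for t x by (rule T_L2)
  show "0 \<le> t \<Longrightarrow> x \<in> L2 a b \<Longrightarrow> energy.nm (T t x) \<le> energy.nm x" for t x
    using contr[of t] by (simp add: opnorm_le_def nm_eq_normH)
  show "x \<in> L2 a b \<Longrightarrow> energy.nm (T 0 x - x) = 0" for x
    using C0 T_L2[of 0 x] by (intro nm_ae_eq) (auto simp: C0_semigroup_def)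
  show "0 \<le> s \<Longrightarrow> 0 \<le> t \<Longrightarrow> x \<in> L2 a b \<Longrightarrow> energy.nm (T (s + t) x - T s (T t x)) = 0" for s t x
    using C0 T_L2 by (intro nm_ae_eq) (auto simp: C0_semigroup_def)
  fix t c d and x y :: "real \<Rightarrow> complex^'n" assume *: "0 \<le> (t :: real)" "x \<in> L2 a b" "y \<in> L2 a b"
  have "bounded_operator a b H (T t)" using C0 *(1) by (simp add: C0_semigroup_def)
  then have "ae_eq a b (T t (sc c x + sc d y)) (sc c (T t x) + sc d (T t y))"
    using *(2,3) unfolding bounded_operator_def plus_fun_def by blast
  moreover have "sc c x + sc d y \<in> L2 a b" "sc c (T t x) + sc d (T t y) \<in> L2 a b"
    using * T_L2 by (intro energy.V_closed; simp)+
  ultimately show "energy.nm (T t (sc c x + sc d y) - (sc c (T t x) + sc d (T t y))) = 0"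
    using * T_L2 by (intro nm_ae_eq) auto
qed

lemma of_real_vector_scale: "(of_real r :: complex) *s v = r *\<^sub>R v" for v :: "complex^'k"
  by (simp add: vec_eq_iff scaleR_conv_of_real[where 'a = complex])

text \<open>The bridge from the abstract generator to the differential operator.\<close>

lemma deriv_at_0_iff: "sg.deriv_at_0 x y \<longleftrightarrow> (x, y) \<in> phs_operator a b P0 P1 H WB"
proof -
  have "(\<lambda>\<zeta>. (1 / t) *\<^sub>R (T t x \<zeta> - x \<zeta>) - y \<zeta>) = sc (of_real (1 / t)) (T t x - x) - y" for t
    unfolding of_real_vector_scale by (simp add: fun_eq_iff)
  then have "sg.deriv_at_0 x y \<longleftrightarrow> (x, y) \<in> generator a b H T"
    by (simp add: sg.deriv_at_0_def generator_def nm_eq_normH)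
  then show ?thesis by (simp add: generator)
qed

lemma phs_operator_ae_cong:
  assumes "(x, y) \<in> phs_operator a b P0 P1 H WB" "ae_eq a b y y'" "y' \<in> L2 a b"
  shows "(x, y') \<in> phs_operator a b P0 P1 H WB"
proof -
  have "ae_eq a b y' w" if "ae_eq a b y w" for w
    using assms(2) that unfolding ae_eq_def by eventually_elim simp
  then show ?thesis using assms unfolding phs_operator_def by blast
qed

abbreviation QB :: "complex \<Rightarrow> complex^'n^'n" where
  "QB \<mu> \<equiv> boundary_matrix WB (\<Psi> \<mu> b)"

lemma \<Theta>_bound: "\<exists>C>0. \<forall>\<zeta>\<in>{a..b}. \<forall>v. norm (\<Theta> \<mu> \<zeta> *v v) \<le> C * norm v"
proof -
  obtain K where K: "K > 0" "\<And>A v. norm ((A :: complex^'n^'n) *v (v :: complex^'n)) \<le> norm A * norm v * K"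
    using bounded_bilinear.pos_bounded[OF bounded_bilinear_mv] by blast
  have "bounded (\<Theta> \<mu> ` {a..b})"
    by (intro compact_imp_bounded compact_continuous_image \<Theta>_continuous) simp
  then obtain C where C: "C > 0" "\<And>\<zeta>. \<zeta> \<in> {a..b} \<Longrightarrow> norm (\<Theta> \<mu> \<zeta>) \<le> C"
    unfolding bounded_pos by auto
  have "norm (\<Theta> \<mu> \<zeta> *v v) \<le> (C * K) * norm v" if "\<zeta> \<in> {a..b}" for \<zeta> v
  proof -
    have "norm (\<Theta> \<mu> \<zeta> *v v) \<le> norm (\<Theta> \<mu> \<zeta>) * norm v * K" by (rule K)
    also have "\<dots> \<le> C * norm v * K" using C(2)[OF that] K(1) by (intro mult_right_mono) auto
    finally show ?thesis by (simp add: mult_ac)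
  qed
  then show ?thesis using C(1) K(1) by (intro exI[of _ "C * K"]) auto
qed

text \<open>A kernel vector satisfies the boundary condition, hence yields an eigenvector of A for
  \<mu>. Dissipativity forces its energy norm to be 0, and then v = 0.\<close>

lemma QB_injective:
  assumes \<mu>: "0 < Re \<mu>" and 0: "QB \<mu> *v v = 0"
  shows "v = 0"
proof -
  let ?x = "\<lambda>\<zeta>. matrix_inv (H \<zeta>) *v (\<Psi> \<mu> \<zeta> *v v)"
  have "(?x, \<lambda>\<zeta>. \<mu> *s ?x \<zeta> + P1 *v (\<Psi> \<mu> \<zeta> *v 0)) \<in> phs_operator a b P0 P1 H WB"
    using 0 by (intro variation_of_constants[OF abs_cont_deriv_const]) (auto simp: L2_def boundary_matrix_mv)
  then have D: "sg.deriv_at_0 ?x (sc \<mu> ?x)"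
    by (simp add: deriv_at_0_iff mv_zero_right)
  then have xL: "?x \<in> L2 a b" by (simp add: sg.deriv_at_0_def)
  have "Im (innerH a b H ?x ?x) = 0"
    using arg_cong[OF energy.ip_sym[OF xL xL], of Im] by simp
  then have "Re (innerH a b H (sc \<mu> ?x) ?x) = Re \<mu> * (energy.nm ?x)\<^sup>2"
    using energy.ip_scale[OF xL xL, of \<mu>] energy.nm_sq[OF xL] by simp
  then have "Re \<mu> * (energy.nm ?x)\<^sup>2 \<le> 0" using sg.dissipative[OF D] by simp
  then have nm0: "energy.nm ?x = 0"
    using \<mu> by (simp add: mult_le_0_iff)
  obtain C where C: "C > 0" "\<forall>\<zeta>\<in>{a..b}. \<forall>v. norm (\<Theta> \<mu> \<zeta> *v v) \<le> C * norm v"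
    using \<Theta>_bound by blast
  have "sqrt (m * (b - a) / 2) / (C * H_sup) * norm v \<le> 0"
    using nm_propagated_ge[OF C(1), of \<mu> v] C(2) nm0 by simp
  moreover have "0 < sqrt (m * (b - a) / 2) / (C * H_sup)"
    using C(1) H_sup(1) m_pos ab by simp
  ultimately show "v = 0" by (metis mult_le_cancel_left_pos mult_zero_right norm_le_zero_iff)
qed

text \<open>With \<mu> = 1/h the equation is A x = \<mu> (x - y). It fixes g' in the variation of
  constants; the initial value of g is then determined by the boundary condition, since the boundary
  matrix is invertible.\<close>

lemma resolvent_exists:
  assumes h: "0 < h" and y: "y \<in> L2 a b"
  shows "\<exists>x. sg.deriv_at_0 x (sc (of_real (1 / h)) (x - y))"
proof -
  define \<mu> :: complex where "\<mu> = of_real (1 / h)"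
  define g' where "g' = (\<lambda>\<zeta>. \<Theta> \<mu> \<zeta> *v (matrix_inv P1 *v (- \<mu> *s y \<zeta>)))"
  have yL: "(\<lambda>\<zeta>. matrix_inv P1 *v (- \<mu> *s y \<zeta>)) \<in> L2 a b"
    by (intro L2_bounded_linear[OF bounded_linear_mv]
        L2_bounded_linear[OF bounded_linear_vector_scale] y)
  have g'L: "g' \<in> L2 a b"
    unfolding g'_def
    by (rule L2_bilinear_continuous[OF bounded_bilinear.flip[OF bounded_bilinear_mv] yL \<Theta>_continuous])
  define z where "z = integral {a..b} g'"
  have "inj ((*v) (QB \<mu>))"
  proof -
    have "\<forall>v. QB \<mu> *v v = 0 \<longrightarrow> v = 0" using QB_injective[of \<mu>] h by (auto simp: \<mu>_def)
    then show ?thesis by (metis matrix_left_invertible_injective matrix_left_invertible_ker)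
  qed
  then obtain Qi where Qi: "QB \<mu> ** Qi = mat 1"
    using matrix_left_invertible_injective matrix_left_right_inverse by blast
  \<comment> \<open>Cancels the boundary contribution of the inhomogeneity, where g b - g a =
    z.\<close>
  define v where "v = - (Qi *v (WB *v vstack (\<Psi> \<mu> b *v z) 0))"
  define g where "g = (\<lambda>\<zeta>. v + integral {a..\<zeta>} g')"
  have g: "abs_cont_deriv a b g g'"
    using L2_integrable[OF g'L] by (simp add: abs_cont_deriv_def integrable_lebesgue_on_Icc_iff g_def)
  have ends: "g a = v" "g b = v + z" by (auto simp: g_def z_def)
  have "vstack (\<Psi> \<mu> b *v (v + z)) v = vstack (\<Psi> \<mu> b *v v) v + vstack (\<Psi> \<mu> b *v z) 0"
    by (simp add: vec_eq_iff vstack_def mv_add_right split: sum.split)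
  moreover have "QB \<mu> *v (Qi *v w) = w" for w
    by (simp add: matrix_vector_mul_assoc Qi)
  then have "WB *v vstack (\<Psi> \<mu> b *v v) v = - (WB *v vstack (\<Psi> \<mu> b *v z) 0)"
    unfolding boundary_matrix_mv[symmetric] v_def
    by (simp add: mv_minus_right)
  ultimately have bc: "WB *v vstack (\<Psi> \<mu> b *v g b) (g a) = 0"
    unfolding ends by (simp add: mv_add_right)
  define x where "x = (\<lambda>\<zeta>. matrix_inv (H \<zeta>) *v (\<Psi> \<mu> \<zeta> *v g \<zeta>))"
  have op: "(x, \<lambda>\<zeta>. \<mu> *s x \<zeta> + P1 *v (\<Psi> \<mu> \<zeta> *v g' \<zeta>)) \<in> phs_operator a b P0 P1 H WB"
    unfolding x_def by (rule variation_of_constants[OF g g'L bc])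
  then have xL: "x \<in> L2 a b" by (simp add: phs_operator_def phs_dom_def)
  have "(x, sc \<mu> (x - y)) \<in> phs_operator a b P0 P1 H WB"
  proof (rule phs_operator_ae_cong[OF op])
    show "ae_eq a b (\<lambda>\<zeta>. \<mu> *s x \<zeta> + P1 *v (\<Psi> \<mu> \<zeta> *v g' \<zeta>)) (sc \<mu> (x - y))"
      unfolding ae_eq_def
    proof (rule AE_I2)
      fix \<zeta> assume "\<zeta> \<in> space M"
      then have "\<zeta> \<in> {a..b}" by (simp add: space_M)
      then have "\<Psi> \<mu> \<zeta> *v (\<Theta> \<mu> \<zeta> *v w) = w" for w
        by (simp add: matrix_vector_mul_assoc \<Psi>_\<Theta>)
      then have "\<Psi> \<mu> \<zeta> *v g' \<zeta> = matrix_inv P1 *v (- \<mu> *s y \<zeta>)"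
        unfolding g'_def .
      then have e: "P1 *v (\<Psi> \<mu> \<zeta> *v g' \<zeta>) = - \<mu> *s y \<zeta>"
        by (simp only: P1_cancel_mv)
      show "\<mu> *s x \<zeta> + P1 *v (\<Psi> \<mu> \<zeta> *v g' \<zeta>) = \<mu> *s (x - y) \<zeta>"
        unfolding e by (simp add: vec_eq_iff algebra_simps)
    qed
    show "sc \<mu> (x - y) \<in> L2 a b"
      using xL y by (intro energy.V_closed)
  qed
  then show ?thesis unfolding \<mu>_def using deriv_at_0_iff by blast
qed

text \<open>The hypothesis concerns the open interval; continuity extends the bound to the end
  points, where the boundary matrix needs it.\<close>

lemma \<Psi>_uniform_bound:
  obtains C where "0 < C" "\<And>\<omega> \<zeta> v. \<zeta> \<in> {a..b} \<Longrightarrow> norm (\<Psi> (\<i> * of_real \<omega>) \<zeta> *v v) \<le> C * norm v"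
proof -
  let ?f = "\<lambda>\<omega> \<zeta>. onorm ((*v) (\<Psi> (\<i> * of_real \<omega>) \<zeta>))"
  obtain n where n: "(SUP \<omega>::real. SUP \<zeta>\<in>{a<..<b}. ereal (?f \<omega> \<zeta>)) < ereal (real n)"
    using iffD1[OF less_PInf_Ex_of_nat less_imp_neq[OF bounded_\<Psi>]] by (rule exE)
  define C where "C = real n"
  have C: "(SUP \<omega>::real. SUP \<zeta>\<in>{a<..<b}. ereal (?f \<omega> \<zeta>)) \<le> ereal C"
    using n unfolding C_def by (rule less_imp_le)
  have le: "?f \<omega> \<zeta> \<le> C" if "\<zeta> \<in> {a<..<b}" for \<omega> \<zeta>
  proof -
    have "ereal (?f \<omega> \<zeta>) \<le> (SUP \<zeta>\<in>{a<..<b}. ereal (?f \<omega> \<zeta>))" by (rule SUP_upper[OF that])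
    also have "\<dots> \<le> (SUP \<omega>::real. SUP \<zeta>\<in>{a<..<b}. ereal (?f \<omega> \<zeta>))" by (rule SUP_upper) simp
    also note C
    finally show ?thesis by simp
  qed
  have inner: "norm (\<Psi> (\<i> * of_real \<omega>) \<zeta> *v v) \<le> max C 1 * norm v" if "\<zeta> \<in> {a<..<b}" for \<omega> \<zeta> v
  proof -
    have "norm (\<Psi> (\<i> * of_real \<omega>) \<zeta> *v v) \<le> ?f \<omega> \<zeta> * norm v"
      by (rule onorm[OF bounded_linear_mv])
    also have "\<dots> \<le> max C 1 * norm v" using le[OF that, of \<omega>] by (intro mult_right_mono) auto
    finally show ?thesis .
  qed
  show ?thesis
  proof (rule that[of "max C 1"])
    fix \<omega> \<zeta> v assume z: "\<zeta> \<in> {a..b}"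
    show "norm (\<Psi> (\<i> * of_real \<omega>) \<zeta> *v v) \<le> max C 1 * norm v"
    proof (rule continuous_on_closure_norm_le[of "{a<..<b}" "\<lambda>\<zeta>. \<Psi> (\<i> * of_real \<omega>) \<zeta> *v v"])
      show "continuous_on (closure {a<..<b}) (\<lambda>\<zeta>. \<Psi> (\<i> * of_real \<omega>) \<zeta> *v v)"
        using ab by (auto intro!: continuous_on_mv \<Psi>_continuous continuous_intros)
    qed (use z ab inner in auto)
  qed simp
qed

lemma quadratic_form_zero:
  "(hstack (ctranspose (\<Psi> (\<i> * of_real \<omega>) b)) (mat 1) ** vstack (hstack P1 0) (hstack 0 (- P1)) **
      vstack (\<Psi> (\<i> * of_real \<omega>) b) (mat 1)) *v v = 0"
proof -
  have "ctranspose (\<Psi> (\<i> * of_real \<omega>) b) ** (P1 ** \<Psi> (\<i> * of_real \<omega>) b) = P1"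
    using \<Psi>_conjugate[of b "\<i> * of_real \<omega>"] ab by simp
  then show ?thesis
    unfolding boundary_form by (simp add: matrix_mul_assoc[symmetric] mv_zero_left)
qed

end

lemma mv_norm_bound: "\<exists>K>0. \<forall>v. norm ((A :: complex^'n^'m) *v v) \<le> K * norm v"
proof -
  obtain K where K: "K > 0" "\<And>(A :: complex^'n^'m) (v :: complex^'n). norm (A *v v) \<le> norm A * norm v * K"
    using bounded_bilinear.pos_bounded[OF bounded_bilinear_mv] by blast
  have "norm (A *v v) \<le> ((norm A + 1) * K) * norm v" for v
  proof -
    have "norm (A *v v) \<le> norm A * norm v * K" by (rule K)
    also have "\<dots> \<le> (norm A + 1) * norm v * K" using K(1) by (intro mult_right_mono) auto
    finally show ?thesis by (simp add: mult_ac)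
  qed
  then show ?thesis using K(1) by (intro exI[of _ "(norm A + 1) * K"]) (auto intro!: mult_pos_pos add_nonneg_pos)
qed

lemma bounded_linear_pos_bound:
  "bounded_linear f \<Longrightarrow> \<exists>K>0. \<forall>x. norm (f x) \<le> K * norm x"
  using bounded_linear.pos_bounded[of f] by (metis mult.commute)

section \<open>Uniform estimates on the imaginary axis\<close>

context phs_semigroup
begin

abbreviation \<Psi>\<^sub>i :: "real \<Rightarrow> real \<Rightarrow> complex^'n^'n" where
  "\<Psi>\<^sub>i \<omega> \<equiv> \<Psi> (\<i> * of_real \<omega>)"

abbreviation \<Theta>\<^sub>i :: "real \<Rightarrow> real \<Rightarrow> complex^'n^'n" where
  "\<Theta>\<^sub>i \<omega> \<equiv> \<Theta> (\<i> * of_real \<omega>)"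

abbreviation Q\<^sub>i :: "real \<Rightarrow> complex^'n^'n" where
  "Q\<^sub>i \<omega> \<equiv> QB (\<i> * of_real \<omega>)"

text \<open>A quantitative form of (iii), with one constant for all frequencies and vectors.\<close>

definition uniformly_coercive :: bool where
  "uniformly_coercive \<longleftrightarrow> (\<exists>c>0. \<forall>\<omega>::real. \<forall>v. c * norm v \<le> norm (Q\<^sub>i \<omega> *v v))"

lemma \<Theta>_imaginary: "\<Theta>\<^sub>i \<omega> \<zeta> = matrix_inv P1 ** (ctranspose (\<Psi>\<^sub>i \<omega> \<zeta>) ** P1)"
  by (simp add: \<Theta>_def)

text \<open>On the axis \<Theta> is the adjoint of \<Psi> conjugated by \<open>P1\<close>, and an
  adjoint obeys the same norm bound.\<close>

lemma \<Theta>_uniform_bound: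
  obtains C where "0 < C" "\<And>\<omega> \<zeta> v. \<zeta> \<in> {a..b} \<Longrightarrow> norm (\<Theta>\<^sub>i \<omega> \<zeta> *v v) \<le> C * norm v"
proof -
  obtain C where C: "0 < C" "\<And>\<omega> \<zeta> v. \<zeta> \<in> {a..b} \<Longrightarrow> norm (\<Psi>\<^sub>i \<omega> \<zeta> *v v) \<le> C * norm v"
    by (rule \<Psi>_uniform_bound) (rule that)
  obtain k1 where k1: "0 < k1" "\<And>v. norm (P1 *v v) \<le> k1 * norm v" using mv_norm_bound by blast
  obtain k2 where k2: "0 < k2" "\<And>v. norm (matrix_inv P1 *v v) \<le> k2 * norm v" using mv_norm_bound by blast
  show ?thesis
  proof (rule that[of "k2 * (C * k1)"])
    fix \<omega> \<zeta> v assume z: "\<zeta> \<in> {a..b}"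
    let ?\<Psi> = "\<Psi>\<^sub>i \<omega> \<zeta>"
    have "norm (\<Theta>\<^sub>i \<omega> \<zeta> *v v) = norm (matrix_inv P1 *v (ctranspose ?\<Psi> *v (P1 *v v)))"
      by (simp add: \<Theta>_imaginary matrix_vector_mul_assoc matrix_mul_assoc)
    also have "\<dots> \<le> k2 * norm (ctranspose ?\<Psi> *v (P1 *v v))" by (rule k2)
    also have "\<dots> \<le> k2 * (C * norm (P1 *v v))"
      using k2(1) by (intro mult_left_mono norm_ctranspose_mv_le C(2)[OF z]) auto
    also have "\<dots> \<le> k2 * (C * (k1 * norm v))" using k1 k2(1) C(1) by (intro mult_left_mono) auto
    finally show "norm (\<Theta>\<^sub>i \<omega> \<zeta> *v v) \<le> k2 * (C * k1) * norm v" by (simp add: mult_ac)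
  qed (use k1 k2 C in simp)
qed

text \<open>Adding \<open>\<Psi>\<close> times a linear interpolation to \<open>\<Psi> v\<close> corrects its boundary values at a cost
  that is uniform in \<open>\<omega>\<close>; the result is an approximate eigenvector if \<open>QB \<mu> v\<close> is small.\<close>

lemma uniformly_coercive_of_decay:
  assumes \<tau>: "0 < \<tau>" and half: "\<And>x. x \<in> L2 a b \<Longrightarrow> energy.nm (T \<tau> x) \<le> energy.nm x / 2"
  shows uniformly_coercive
proof -
  obtain C where C: "0 < C" "\<And>\<omega> \<zeta> v. \<zeta> \<in> {a..b} \<Longrightarrow> norm (\<Psi>\<^sub>i \<omega> \<zeta> *v v) \<le> C * norm v"
    by (rule \<Psi>_uniform_bound) (rule that)
  obtain D where D: "0 < D" "\<And>\<omega> \<zeta> v. \<zeta> \<in> {a..b} \<Longrightarrow> norm (\<Theta>\<^sub>i \<omega> \<zeta> *v v) \<le> D * norm v"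
    by (rule \<Theta>_uniform_bound) (rule that)
  obtain k1 where k1: "0 < k1" "\<And>v. norm (P1 *v v) \<le> k1 * norm v" using mv_norm_bound by blast
  obtain R where R: "WB ** R = mat 1" using full_row_rank_right_inverse[OF rank_WB] by blast
  define top where "top w = (\<chi> i. w $ Inl i)" for w :: "complex^('n + 'n)"
  define bot where "bot w = (\<chi> i. w $ Inr i)" for w :: "complex^('n + 'n)"
  have stack: "vstack (top w) (bot w) = w" for w
    by (simp add: vec_eq_iff vstack_def top_def bot_def split: sum.split)
  have "bounded_linear (\<lambda>r. top (- (R *v r)))" "bounded_linear (\<lambda>r. bot (- (R *v r)))"
    unfolding linear_conv_bounded_linear[symmetric]
    by (rule linearI; simp add: vec_eq_iff top_def bot_def linear_simps[OF
          bounded_linear_mv])+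
  then obtain kp kq where kp: "0 < kp" "\<And>r. norm (top (- (R *v r))) \<le> kp * norm r"
    and kq: "0 < kq" "\<And>r. norm (bot (- (R *v r))) \<le> kq * norm r"
    using bounded_linear_pos_bound by metis
  define E where "E = sqrt (H_sup * (b - a) / 2)"
  have E: "0 < E" using H_sup(1) ab by (simp add: E_def)
  define c1 where "c1 = sqrt (m * (b - a) / 2) / (D * H_sup)"
  have c1: "0 < c1" using D(1) H_sup(1) m_pos ab by (simp add: c1_def)
  define L where "L = D * kp + kq"
  have L: "0 < L" using D(1) kp(1) kq(1) by (simp add: L_def add_pos_pos)
  \<comment> \<open>The first term bounds the corrected function \<open>x\<close> through the
    resolvent estimate, the second its distance from the uncorrected \<open>x0\<close>, both per
    unit of residual.\<close>
  define k where "k = 2 * \<tau> * (E * (k1 * (C * (L / (b - a))))) + E * (C * L / m)"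
  have k: "0 < k" using \<tau> E k1(1) C(1) L ab m_pos by (simp add: k_def add_pos_pos)
  have "c1 / k * norm v \<le> norm (Q\<^sub>i \<omega> *v v)" for \<omega> v
  proof -
    let ?\<mu> = "\<i> * of_real \<omega>"
    \<comment> \<open>\<open>r\<close> is the boundary residual of \<Psi> v. The pair
      \<open>p\<close>, \<open>q\<close> lifts -r through the right inverse of \<open>WB\<close> and
      corrects the values at b and a; \<open>s\<close> is \<open>p\<close> pulled back through
      \<Psi> b, so g runs from q + v to s + v.\<close>
    define r where "r = QB ?\<mu> *v v"
    define p where "p = top (- (R *v r))"
    define q where "q = bot (- (R *v r))"
    define s where "s = \<Theta> ?\<mu> b *v p"
    define l where "l \<zeta> = (\<zeta> - a) / (b - a)" for \<zeta>
    define g where "g = (\<lambda>\<zeta>. (q + v) + l \<zeta> *\<^sub>R (s - q))"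
    define g' where "g' = (\<lambda>\<zeta>::real. (1 / (b - a)) *\<^sub>R (s - q))"
    have pq: "norm p \<le> kp * norm r" "norm q \<le> kq * norm r" using kp kq by (auto simp: p_def q_def)
    have ns: "norm s \<le> D * kp * norm r"
    proof -
      have "norm s \<le> D * norm p" unfolding s_def by (rule D(2)) (use ab in simp)
      also have "\<dots> \<le> D * (kp * norm r)" using pq D(1) by (intro mult_left_mono) auto
      finally show ?thesis by (simp add: mult_ac)
    qed
    have sq: "norm s + norm q \<le> L * norm r" using ns pq by (simp add: L_def algebra_simps)
    have \<Psi>s: "\<Psi> ?\<mu> b *v s = p"
      using \<Psi>_\<Theta>[of b ?\<mu>] ab by (simp add: s_def matrix_vector_mul_assoc)
    have g: "abs_cont_deriv a b g g'"
    proof (rule abs_cont_deriv_C1)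
      show "continuous_on {a..b} g'" by (simp add: g'_def)
      fix x
      have "(l has_real_derivative 1 / (b - a)) (at x)"
        unfolding l_def[abs_def] using ab by (auto intro!: derivative_eq_intros)
      then show "(g has_vector_derivative g' x) (at x)"
        unfolding g_def g'_def
        by (auto intro!: derivative_eq_intros simp: has_real_derivative_iff_has_vector_derivative)
    qed
    have g'L: "g' \<in> L2 a b" unfolding g'_def by (intro continuous_L2 continuous_intros)
    have ends: "g a = q + v" "g b = s + v" using ab by (auto simp: g_def l_def)
    have "vstack (\<Psi> ?\<mu> b *v (s + v)) (q + v) = vstack (\<Psi> ?\<mu> b *v v) v + vstack p q"
      by (simp add: vec_eq_iff vstack_def mv_add_right \<Psi>s split: sum.split)
    moreover have "WB *v vstack (\<Psi> ?\<mu> b *v v) v = r"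
      unfolding r_def boundary_matrix_mv ..
    moreover have "WB *v vstack p q = - r"
      unfolding p_def q_def stack mv_minus_right matrix_vector_mul_assoc R
      by simp
    ultimately have bc: "WB *v vstack (\<Psi> ?\<mu> b *v g b) (g a) = 0"
      unfolding ends by (simp add: mv_add_right)
    define x where "x = (\<lambda>\<zeta>. matrix_inv (H \<zeta>) *v (\<Psi> ?\<mu> \<zeta> *v g \<zeta>))"
    define y where "y = (\<lambda>\<zeta>. ?\<mu> *s x \<zeta> + P1 *v (\<Psi> ?\<mu> \<zeta> *v g' \<zeta>))"
    define x0 where "x0 = (\<lambda>\<zeta>. matrix_inv (H \<zeta>) *v (\<Psi> ?\<mu> \<zeta> *v v))"
    have op: "sg.deriv_at_0 x y"
      unfolding deriv_at_0_iff x_def y_def by (rule variation_of_constants[OF g g'L bc])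
    then have xL: "x \<in> L2 a b" "y \<in> L2 a b" by (auto simp: sg.deriv_at_0_def)
    have x0L: "x0 \<in> L2 a b"
      unfolding x0_def
      by (intro state_of_effort continuous_on_mv \<Psi>_continuous continuous_intros)
    \<comment> \<open>The residual of the approximate eigenvector is P1 \<Psi> g' up to sign, and g'
      is constant of size proportional to \<open>norm r\<close>.\<close>
    have "energy.nm x \<le> 2 * \<tau> * energy.nm (sc ?\<mu> x - y)"
      by (rule sg.resolvent_bound_of_decay[OF op \<tau> half[OF xL(1)]])
    also have "energy.nm (sc ?\<mu> x - y) \<le> E * (k1 * (C * (L / (b - a))) * norm r)"
      unfolding E_def
    proof (rule nm_le_sup)
      show "sc ?\<mu> x - y \<in> L2 a b" using xL by (intro energy.V_closed)
      show "AE \<zeta> in M. norm ((sc ?\<mu> x - y) \<zeta>) \<le> k1 * (C * (L / (b - a))) * norm r"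
      proof (rule AE_I2)
        fix \<zeta> assume "\<zeta> \<in> space M"
        then have z: "\<zeta> \<in> {a..b}" by (simp add: space_M)
        have "norm ((sc ?\<mu> x - y) \<zeta>) = norm (P1 *v (\<Psi> ?\<mu> \<zeta> *v g' \<zeta>))" by (simp add: y_def)
        also have "\<dots> \<le> k1 * norm (\<Psi> ?\<mu> \<zeta> *v g' \<zeta>)" by (rule k1)
        also have "\<dots> \<le> k1 * (C * norm (g' \<zeta>))" using k1(1) C(2)[OF z] by (intro mult_left_mono) auto
        also have "norm (g' \<zeta>) \<le> (L / (b - a)) * norm r"
          using order_trans[OF norm_triangle_ineq4[of s q] sq] ab by (simp add: g'_def divide_right_mono)
        finally show "norm ((sc ?\<mu> x - y) \<zeta>) \<le> k1 * (C * (L / (b - a))) * norm r"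
          using k1(1) C(1) by (simp add: mult_ac)
      qed
      show "0 \<le> k1 * (C * (L / (b - a))) * norm r" using k1(1) C(1) L ab by simp
    qed
    finally have 1: "energy.nm x \<le> 2 * \<tau> * (E * (k1 * (C * (L / (b - a))) * norm r))" using \<tau> by simp
    have "energy.nm (x0 - x) \<le> E * (C * L / m * norm r)"
      unfolding E_def
    proof (rule nm_le_sup)
      show "x0 - x \<in> L2 a b" using xL x0L by (intro energy.V_closed)
      show "AE \<zeta> in M. norm ((x0 - x) \<zeta>) \<le> C * L / m * norm r"
        using H_inverse_AE AE_space
      proof eventually_elim
        case (elim \<zeta>)
        then have z: "\<zeta> \<in> {a..b}" by (simp add: space_M)
        let ?w = "q + l \<zeta> *\<^sub>R (s - q)"
        have l: "0 \<le> l \<zeta>" "l \<zeta> \<le> 1" using z ab by (auto simp: l_def divide_le_eq_1)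
        have "?w = (1 - l \<zeta>) *\<^sub>R q + l \<zeta> *\<^sub>R s" by (simp add: algebra_simps)
        also have "norm \<dots> \<le> (1 - l \<zeta>) * norm q + l \<zeta> * norm s"
          using l by (intro norm_triangle_le add_mono) auto
        also have "\<dots> \<le> norm q + norm s" using l by (intro add_mono mult_left_le_one_le) auto
        finally have w: "norm ?w \<le> L * norm r" using sq by simp
        have "(x0 - x) \<zeta> = - (matrix_inv (H \<zeta>) *v (\<Psi> ?\<mu> \<zeta> *v ?w))"
          by (simp add: x0_def x_def g_def mv_add_right
              mv_diff_right)
        then have "norm ((x0 - x) \<zeta>) \<le> norm (\<Psi> ?\<mu> \<zeta> *v ?w) / m" using elim by simp
        also have "\<dots> \<le> (C * norm ?w) / m" using C(2)[OF z] m_pos by (intro divide_right_mono) auto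
        also have "\<dots> \<le> (C * (L * norm r)) / m" using w C(1) m_pos by (intro divide_right_mono mult_left_mono) auto
        finally show ?case by simp
      qed
      show "0 \<le> C * L / m * norm r" using C(1) L m_pos by simp
    qed
    moreover have "energy.nm x0 \<le> energy.nm x + energy.nm (x0 - x)"
      using xL x0L by (intro energy.nm_le_diff)
    moreover have "c1 * norm v \<le> energy.nm x0"
      unfolding c1_def x0_def using D by (intro nm_propagated_ge) auto
    ultimately have "c1 * norm v \<le> k * norm r" using 1 by (simp add: k_def algebra_simps)
    then show ?thesis using k by (simp add: r_def field_simps)
  qed
  then show ?thesis
    unfolding uniformly_coercive_def using c1 k by (intro exI[of _ "c1 / k"]) auto
qed

text \<open>The effort is u = \<Psi> (u a + P1^-1 z), with z an integral of the right-hand side f,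
  so only u a remains to be bounded. The boundary condition says that the boundary matrix maps u a
  to a term linear in z b, and coercivity bounds u a by the L1 norm of f.\<close>

lemma resolvent_bound_of_coercive:
  assumes uniformly_coercive
  shows "\<exists>K>0. \<forall>\<omega>::real. \<forall>x y. sg.deriv_at_0 x y \<longrightarrow> K * energy.nm x \<le> energy.nm (sc (\<i> * of_real \<omega>) x - y)"
proof -
  obtain c where c: "0 < c" "\<And>\<omega> v. c * norm v \<le> norm (Q\<^sub>i \<omega> *v v)"
    using assms unfolding uniformly_coercive_def by blast
  obtain C where C: "0 < C" "\<And>\<omega> \<zeta> v. \<zeta> \<in> {a..b} \<Longrightarrow> norm (\<Psi>\<^sub>i \<omega> \<zeta> *v v) \<le> C * norm v"
    by (rule \<Psi>_uniform_bound) (rule that)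
  obtain k2 where k2: "0 < k2" "\<And>v. norm (matrix_inv P1 *v v) \<le> k2 * norm v" using mv_norm_bound by blast
  have "bounded_linear (\<lambda>p::complex^'n. WB *v vstack p (0::complex^'n))"
    by (intro bounded_linear_compose[OF bounded_linear_mv]
        bounded_linear_vstack bounded_linear_ident bounded_linear_zero)
  then obtain kw where kw: "0 < kw" "\<And>p. norm (WB *v vstack p (0::complex^'n)) \<le> kw * norm p"
    using bounded_linear_pos_bound by blast
  define s1 where "s1 = k2 * C"
  define s2 where "s2 = C * (kw * (C * s1) / c + s1)"
  define E where "E = sqrt (H_sup * (b - a) / 2)"
  define k where "k = E * (s2 / m) * sqrt (2 * (b - a) / m)"
  have s1: "0 < s1" using k2(1) C(1) by (simp add: s1_def)
  have s2: "0 < s2" using s1 C(1) kw(1) c(1) by (simp add: s2_def add_pos_pos)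
  have E: "0 < E" using H_sup(1) ab by (simp add: E_def)
  have k: "0 < k" using E s2 m_pos ab by (simp add: k_def)
  have "energy.nm x \<le> k * energy.nm (sc (\<i> * of_real \<omega>) x - y)" if xy: "sg.deriv_at_0 x y" for \<omega> x y
  proof -
    let ?\<mu> = "\<i> * of_real \<omega>"
    define f where "f = sc ?\<mu> x - y"
    have xL: "x \<in> L2 a b" "y \<in> L2 a b" using xy by (auto simp: sg.deriv_at_0_def)
    then have fL: "f \<in> L2 a b" unfolding f_def by (intro energy.V_closed)
    define F where "F = (LINT \<zeta>|M. norm (f \<zeta>))"
    have fi: "integrable M (\<lambda>\<zeta>. norm (f \<zeta>))" using L2_integrable[OF fL] by simp
    have F0: "0 \<le> F" unfolding F_def by (rule integral_nonneg_AE) simp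
    obtain u where u: "continuous_on {a..b} u" "ae_eq a b x (\<lambda>\<zeta>. matrix_inv (H \<zeta>) *v u \<zeta>)"
      "WB *v vstack (u b) (u a) = 0"
      and D: "\<And>\<mu>. abs_cont_deriv a b (\<lambda>\<zeta>. ctranspose (\<Psi> (- cnj \<mu>) \<zeta>) *v (P1 *v u \<zeta>))
       (\<lambda>\<zeta>. - (ctranspose (\<Psi> (- cnj \<mu>) \<zeta>) *v (\<mu> *s x \<zeta> - y \<zeta>)))"
      using effort_of_state xy unfolding deriv_at_0_iff by blast
    \<comment> \<open>For imaginary \<mu> the conjugate solution is \<Psi> itself, so only the
      assumed uniform bound enters.\<close>
    define h where "h = (\<lambda>\<zeta>. - (ctranspose (\<Psi> ?\<mu> \<zeta>) *v f \<zeta>))"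
    define z where "z \<zeta> = integral {a..\<zeta>} h" for \<zeta>
    have D': "abs_cont_deriv a b (\<lambda>\<zeta>. ctranspose (\<Psi> ?\<mu> \<zeta>) *v (P1 *v u \<zeta>)) h"
      using D[of ?\<mu>] by (simp add: h_def f_def)
    have ha: "h absolutely_integrable_on {a..b}" using D' by (simp add: abs_cont_deriv_def)
    have zle: "norm (z \<zeta>) \<le> C * F" if \<zeta>: "\<zeta> \<in> {a..b}" for \<zeta>
    proof -
      have ni: "(\<lambda>s. norm (f s)) integrable_on {a..b}"
        using fi by (simp add: integrable_lebesgue_on_Icc_iff set_lebesgue_integral_eq_integral)
      have sub: "g integrable_on {a..\<zeta>}" if "g integrable_on {a..b}" for g :: "real \<Rightarrow> 'b::euclidean_space"
        by (rule integrable_on_subinterval[OF that]) (use \<zeta> in auto)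
      have ni': "(\<lambda>s. C * norm (f s)) integrable_on {a..b}" by (rule integrable_on_mult_right[OF ni])
      have "norm (z \<zeta>) \<le> integral {a..\<zeta>} (\<lambda>s. C * norm (f s))"
        unfolding z_def
      proof (rule integral_norm_bound_integral)
        show "h integrable_on {a..\<zeta>}" using ha by (intro sub) (simp add: set_lebesgue_integral_eq_integral)
        show "(\<lambda>s. C * norm (f s)) integrable_on {a..\<zeta>}" by (rule sub[OF ni'])
        fix s assume "s \<in> {a..\<zeta>}"
        then have s: "s \<in> {a..b}" using \<zeta> by auto
        show "norm (h s) \<le> C * norm (f s)"
          unfolding h_def norm_minus_cancel by (rule norm_ctranspose_mv_le[OF C(2)[OF s]])
      qed
      also have "\<dots> \<le> integral {a..b} (\<lambda>s. C * norm (f s))"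
        using \<zeta> C(1) by (intro integral_subset_le sub ni') auto
      also have "\<dots> = C * F" using fi by (simp add: F_def integral_lebesgue_on_Icc)
      finally show ?thesis .
    qed
    have rep: "u \<zeta> = \<Psi> ?\<mu> \<zeta> *v (u a + matrix_inv P1 *v z \<zeta>)" if \<zeta>: "\<zeta> \<in> {a..b}" for \<zeta>
    proof -
      have "ctranspose (\<Psi> ?\<mu> \<zeta>) *v (P1 *v u \<zeta>) = P1 *v u a + z \<zeta>"
        using abs_cont_deriv_eq[OF D' \<zeta>] by (simp add: \<Psi>_a z_def)
      then have "\<Theta> ?\<mu> \<zeta> *v u \<zeta> = u a + matrix_inv P1 *v z \<zeta>"
        unfolding \<Theta>_imaginary matrix_vector_mul_assoc[symmetric]
        by (simp add: mv_add_right P1_cancel_mv)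
      moreover have "u \<zeta> = \<Psi> ?\<mu> \<zeta> *v (\<Theta> ?\<mu> \<zeta> *v u \<zeta>)"
        by (simp add: matrix_vector_mul_assoc \<Psi>_\<Theta>[OF \<zeta>])
      ultimately show ?thesis by simp
    qed
    have Pz: "norm (matrix_inv P1 *v z \<zeta>) \<le> s1 * F" if "\<zeta> \<in> {a..b}" for \<zeta>
    proof -
      have "norm (matrix_inv P1 *v z \<zeta>) \<le> k2 * norm (z \<zeta>)" by (rule k2)
      also have "\<dots> \<le> k2 * (C * F)" using zle[OF that] k2(1) by (intro mult_left_mono) auto
      finally show ?thesis by (simp add: s1_def mult_ac)
    qed
    have bI: "b \<in> {a..b}" using ab by simp
    let ?p = "\<Psi> ?\<mu> b *v (matrix_inv P1 *v z b)"
    have "vstack (u b) (u a) = vstack (\<Psi> ?\<mu> b *v u a) (u a) + vstack ?p 0"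
      using rep[OF bI] by (simp add: vec_eq_iff vstack_def mv_add_right split: sum.split)
    then have "QB ?\<mu> *v u a = - (WB *v vstack ?p 0)"
      using u(3) unfolding boundary_matrix_mv
      by (simp add: mv_add_right eq_neg_iff_add_eq_0)
    then have "c * norm (u a) \<le> norm (WB *v vstack ?p 0)" using c(2)[of "u a" \<omega>] by simp
    also have "\<dots> \<le> kw * norm ?p" by (rule kw)
    also have "\<dots> \<le> kw * (C * norm (matrix_inv P1 *v z b))" using kw(1) C(2)[OF bI] by (intro mult_left_mono) auto
    also have "\<dots> \<le> kw * (C * (s1 * F))" using Pz[OF bI] kw(1) C(1) by (intro mult_left_mono) auto
    finally have ua: "norm (u a) \<le> kw * (C * s1) / c * F" using c(1) by (simp add: field_simps)
    have ule: "norm (u \<zeta>) \<le> s2 * F" if \<zeta>: "\<zeta> \<in> {a..b}" for \<zeta>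
    proof -
      have "norm (u \<zeta>) \<le> C * norm (u a + matrix_inv P1 *v z \<zeta>)" using C(2)[OF \<zeta>] rep[OF \<zeta>] by metis
      also have "\<dots> \<le> C * (kw * (C * s1) / c * F + s1 * F)"
        using C(1) by (intro mult_left_mono norm_triangle_le add_mono ua Pz[OF \<zeta>]) auto
      finally show ?thesis by (simp add: s2_def algebra_simps)
    qed
    have "energy.nm x \<le> E * (s2 / m * F)"
      unfolding E_def
    proof (rule nm_le_sup[OF xL(1)])
      show "AE \<zeta> in M. norm (x \<zeta>) \<le> s2 / m * F"
        using H_inverse_AE AE_space u(2)[unfolded ae_eq_def]
      proof eventually_elim
        case (elim \<zeta>)
        have "norm (x \<zeta>) \<le> norm (u \<zeta>) / m" using elim by simp
        also have "\<dots> \<le> (s2 * F) / m" using ule[of \<zeta>] elim m_pos by (intro divide_right_mono) (auto simp: space_M)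
        finally show ?case by simp
      qed
      show "0 \<le> s2 / m * F" using s2 m_pos F0 by simp
    qed
    also have "\<dots> \<le> E * (s2 / m * (sqrt (2 * (b - a) / m) * energy.nm f))"
      using integral_norm_le_nm[OF fL] E s2 m_pos unfolding F_def by (intro mult_left_mono) auto
    finally show ?thesis by (simp add: k_def f_def mult_ac)
  qed
  then show ?thesis using k by (intro exI[of _ "1 / k"]) (auto simp: field_simps)
qed

lemma decay_of_coercive:
  assumes uniformly_coercive
  shows "\<exists>\<tau>>0. \<forall>x\<in>L2 a b. energy.nm (T \<tau> x) \<le> energy.nm x / 2"
proof -
  obtain K where K: "0 < K" "\<And>\<omega> x y. sg.deriv_at_0 x y \<Longrightarrow> K * energy.nm x \<le> energy.nm (sc (\<i> * of_real \<omega>) x - y)"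
    using resolvent_bound_of_coercive[OF assms] by blast
  interpret R: bounded_resolvent_semigroup sc "L2 a b" "innerH a b H" T K
  proof
    fix x :: "real \<Rightarrow> complex^'n" assume "x \<in> L2 a b"
    then show "((\<lambda>t. energy.nm (T t x - x)) \<longlongrightarrow> 0) (at_right 0)"
      using contraction by (simp add: contraction_semigroup_def C0_semigroup_def nm_eq_normH fun_diff_def)
  qed (use K resolvent_exists in auto)
  show ?thesis by (rule R.halving_time)
qed

lemma exponentially_stable_iff_coercive: "exponentially_stable a b H T \<longleftrightarrow> uniformly_coercive"
proof
  assume "exponentially_stable a b H T"
  then obtain N \<alpha> where N: "1 \<le> N" "0 < \<alpha>" "\<And>t. 0 \<le> t \<Longrightarrow> opnorm_le a b H (T t) (N * exp (- \<alpha> * t))"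
    unfolding exponentially_stable_def by blast
  \<comment> \<open>The time at which the exponential bound has dropped to 1/2.\<close>
  define \<tau> where "\<tau> = ln (2 * N) / \<alpha>"
  have \<tau>: "0 < \<tau>" using N by (simp add: \<tau>_def)
  have e: "N * exp (- \<alpha> * \<tau>) = 1 / 2" using N by (simp add: \<tau>_def exp_minus)
  have "opnorm_le a b H (T \<tau>) (1 / 2)"
    using N(3)[of \<tau>] \<tau> unfolding e by simp
  then have "energy.nm (T \<tau> x) \<le> energy.nm x / 2" if "x \<in> L2 a b" for x
    using that unfolding opnorm_le_def nm_eq_normH by simp
  then show uniformly_coercive by (rule uniformly_coercive_of_decay[OF \<tau>])
next
  assume uniformly_coercive
  then obtain \<tau> where \<tau>: "0 < \<tau>" "\<And>x. x \<in> L2 a b \<Longrightarrow> energy.nm (T \<tau> x) \<le> energy.nm x / 2"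
    using decay_of_coercive by blast
  have "opnorm_le a b H (T t) (2 * exp (- (ln 2 / \<tau>) * t))" if "0 \<le> t" for t
    using sg.exponential_decay[OF \<tau> that] unfolding opnorm_le_def nm_eq_normH by blast
  then show "exponentially_stable a b H T"
    unfolding exponentially_stable_def using \<tau>(1) by (intro exI[of _ 2] conjI exI[of _ "ln 2 / \<tau>"]) auto
qed

text \<open>If coercivity fails, normalised near-kernel vectors have a limit l on the unit sphere
  along a subsequence. A bound on the boundary matrices common to all frequencies lets l replace
  them, so l violates (iii) for the frequencies of that subsequence.\<close>

lemma coercive_iff_liminf:
  "uniformly_coercive \<longleftrightarrow>
    (\<forall>\<omega> :: nat \<Rightarrow> real. {v. liminf (\<lambda>k. ereal (norm (Q\<^sub>i (\<omega> k) *v v))) = 0} = {0})"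
proof
  let ?Z = "\<lambda>\<omega> :: nat \<Rightarrow> real. {v. liminf (\<lambda>k. ereal (norm (Q\<^sub>i (\<omega> k) *v v))) = 0}"
  assume uniformly_coercive
  then obtain c where c: "0 < c" "\<And>\<omega> v. c * norm v \<le> norm (Q\<^sub>i \<omega> *v v)"
    unfolding uniformly_coercive_def by blast
  show "\<forall>\<omega> :: nat \<Rightarrow> real. ?Z \<omega> = {0}"
  proof (intro allI equalityI subsetI)
    fix \<omega> :: "nat \<Rightarrow> real" and v
    assume "v \<in> ?Z \<omega>"
    moreover have "ereal (c * norm v) \<le> liminf (\<lambda>k. ereal (norm (Q\<^sub>i (\<omega> k) *v v)))"
      by (rule Liminf_bounded) (simp add: c(2))
    ultimately have "c * norm v \<le> 0" by simp
    then show "v \<in> {0}" using c(1) by (simp add: mult_le_0_iff)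
  next
    fix \<omega> :: "nat \<Rightarrow> real" and v :: "complex^'n" assume "v \<in> {0}"
    then show "v \<in> ?Z \<omega>"
      by (simp add: mv_zero_right Liminf_const zero_ereal_def[symmetric])
  qed
next
  let ?Z = "\<lambda>\<omega> :: nat \<Rightarrow> real. {v. liminf (\<lambda>k. ereal (norm (Q\<^sub>i (\<omega> k) *v v))) = 0}"
  assume iii: "\<forall>\<omega> :: nat \<Rightarrow> real. ?Z \<omega> = {0}"
  obtain C where C: "0 < C" "\<And>\<omega> \<zeta> v. \<zeta> \<in> {a..b} \<Longrightarrow> norm (\<Psi>\<^sub>i \<omega> \<zeta> *v v) \<le> C * norm v"
    by (rule \<Psi>_uniform_bound) (rule that)
  obtain kw where kw: "0 < kw" "\<And>w. norm (WB *v w) \<le> kw * norm w" using mv_norm_bound by blast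
  \<comment> \<open>The uniform Lipschitz bound; the summand 1 stems from the identity
    block.\<close>
  have Qle: "norm (Q\<^sub>i \<omega> *v v) \<le> kw * (C + 1) * norm v" for \<omega> v
  proof -
    have "vstack (\<Psi>\<^sub>i \<omega> b *v v) v = vstack (\<Psi>\<^sub>i \<omega> b *v v) (0::complex^'n) + vstack (0::complex^'n) v"
      by (simp add: vec_eq_iff vstack_def split: sum.split)
    moreover have "norm (vstack p (0::complex^'n)) = norm p" "norm (vstack (0::complex^'n) p) = norm p" for p :: "complex^'n"
      by (simp_all add: norm_vec_def L2_set_def vstack_def UNIV_Plus_UNIV[symmetric] sum.Plus del: UNIV_Plus_UNIV)
    ultimately have "norm (vstack (\<Psi>\<^sub>i \<omega> b *v v) v) \<le> norm (\<Psi>\<^sub>i \<omega> b *v v) + norm v"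
      by (metis norm_triangle_ineq)
    also have "\<dots> \<le> (C + 1) * norm v" using C(2)[of b \<omega> v] ab by (simp add: algebra_simps)
    finally have "kw * norm (vstack (\<Psi>\<^sub>i \<omega> b *v v) v) \<le> kw * ((C + 1) * norm v)"
      using kw(1) by (intro mult_left_mono) auto
    then show ?thesis using kw(2)[of "vstack (\<Psi>\<^sub>i \<omega> b *v v) v"] by (simp add: boundary_matrix_mv mult_ac)
  qed
  show uniformly_coercive
  proof (rule ccontr)
    assume "\<not> uniformly_coercive"
    then have "\<forall>n. \<exists>\<omega> v. norm (Q\<^sub>i \<omega> *v v) < (1 / real (Suc n)) * norm v"
      unfolding uniformly_coercive_def by (meson not_le zero_less_divide_1_iff of_nat_0_less_iff zero_less_Suc)
    then obtain \<omega> v where wv: "\<And>n. norm (Q\<^sub>i (\<omega> n :: real) *v v n) < (1 / real (Suc n)) * norm (v n)"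
      by metis
    have v0: "v n \<noteq> 0" for n using wv[of n] by auto
    define e where "e n = (1 / norm (v n)) *\<^sub>R v n" for n
    have e1: "norm (e n) = 1" for n using v0[of n] by (simp add: e_def)
    have Qe: "norm (Q\<^sub>i (\<omega> n) *v e n) < 1 / real (Suc n)" for n
      using wv[of n] v0[of n]
      by (simp add: e_def bounded_bilinear.scaleR_right[OF bounded_bilinear_mv] pos_divide_less_eq)
    have "compact (sphere (0 :: complex^'n) 1)" by simp
    then obtain l r where lr: "l \<in> sphere 0 1" "strict_mono r" "(e \<circ> r) \<longlonglongrightarrow> l"
      unfolding compact_def using e1 by (metis dist_0_norm mem_sphere)
    let ?u = "\<lambda>k. 1 / real (Suc (r k)) + kw * (C + 1) * norm (l - e (r k))"
    have "(\<lambda>k. norm (Q\<^sub>i (\<omega> (r k)) *v l)) \<longlonglongrightarrow> 0"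
    proof (rule tendsto_sandwich[OF _ _ tendsto_const])
      show "\<forall>\<^sub>F k in sequentially. 0 \<le> norm (Q\<^sub>i (\<omega> (r k)) *v l)" by simp
      have "norm (Q\<^sub>i (\<omega> (r k)) *v l) \<le> ?u k" for k
      proof -
        have "Q\<^sub>i (\<omega> (r k)) *v l = Q\<^sub>i (\<omega> (r k)) *v e (r k) + Q\<^sub>i (\<omega> (r k)) *v (l - e (r k))"
          by (simp add: mv_diff_right)
        also have "norm \<dots> \<le> ?u k"
          by (intro norm_triangle_le add_mono Qle less_imp_le[OF Qe])
        finally show ?thesis .
      qed
      then show "\<forall>\<^sub>F k in sequentially. norm (Q\<^sub>i (\<omega> (r k)) *v l) \<le> ?u k"
        by simp
      have "(\<lambda>k. 1 / real (Suc (r k))) \<longlonglongrightarrow> 0"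
        using LIMSEQ_subseq_LIMSEQ[OF LIMSEQ_Suc[OF lim_const_over_n[of "1::real"]] lr(2)] by (simp add: o_def)
      moreover have "(\<lambda>k. norm (l - e (r k))) \<longlonglongrightarrow> norm (l - l)"
        using lr(3) by (intro tendsto_intros) (simp add: o_def)
      ultimately have "(\<lambda>k. ?u k) \<longlonglongrightarrow> 0 + kw * (C + 1) * norm (l - l)"
        by (rule tendsto_add[OF _ tendsto_mult_left])
      then show "(\<lambda>k. ?u k) \<longlonglongrightarrow> 0" by simp
    qed
    then have "(\<lambda>k. ereal (norm (Q\<^sub>i (\<omega> (r k)) *v l))) \<longlonglongrightarrow> ereal 0"
      by simp
    then have "liminf (\<lambda>k. ereal (norm (Q\<^sub>i (\<omega> (r k)) *v l))) = ereal 0"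
      by (rule lim_imp_Liminf[rotated]) simp
    then have "l \<in> ?Z (\<lambda>k. \<omega> (r k))"
      by (simp add: zero_ereal_def)
    then have "l = 0" using spec[OF iii, of "\<lambda>k. \<omega> (r k)"] by blast
    then show False using lr(1) by simp
  qed
qed

end

theorem theorem3p2:
  fixes a b m :: real
    and P0 P1 Q :: "complex^'n^'n"
    and H :: "real \<Rightarrow> complex^'n^'n"
    and WB :: "complex^('n + 'n)^'n"
    and T :: "real \<Rightarrow> (real \<Rightarrow> complex^'n) \<Rightarrow> (real \<Rightarrow> complex^'n)"
    and \<Psi> :: "complex \<Rightarrow> real \<Rightarrow> complex^'n^'n"
    and \<Q> :: "complex \<Rightarrow> complex^'n^'n"
  assumes "a < b"
    and "ctranspose P0 = - P0" and "ctranspose P1 = P1" and "invertible P1"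
    and "H \<in> borel_measurable (lebesgue_on {a<..<b})"
    and "bounded (H ` {a<..<b})"
    and "AE \<zeta> in lebesgue_on {a<..<b}. ctranspose (H \<zeta>) = H \<zeta>"
    and "m > 0"
    and "AE \<zeta> in lebesgue_on {a<..<b}. \<forall>v. m * (norm v)\<^sup>2 \<le> Re (cdot v (H \<zeta> *v v))"
    and "rank WB = CARD('n)"
    and "contraction_semigroup a b H T"
    and "generator a b H T = phs_operator a b P0 P1 H WB"
    and "\<And>\<mu>. is_fundamental_solution a b P0 P1 H \<mu> (\<Psi> \<mu>)"
    and "(SUP \<omega>::real. SUP \<zeta>\<in>{a<..<b}. ereal (onorm ((*v) (\<Psi> (\<i> * of_real \<omega>) \<zeta>)))) < \<infinity>"
    and Q_eq: "Q = P1"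
    and calQ_eq: "\<And>\<mu>. \<Q> \<mu> = boundary_matrix WB (\<Psi> \<mu> b)"
  shows "(exponentially_stable a b H T \<longleftrightarrow>
           (\<forall>\<omega> :: nat \<Rightarrow> real.
             {v. liminf (\<lambda>k. ereal (
                   norm (\<Q> (\<i> * of_real (\<omega> k)) *v v) +
                   cmod (cdot v ((hstack (ctranspose (\<Psi> (\<i> * of_real (\<omega> k)) b)) (mat 1) **
                                  vstack (hstack Q 0) (hstack 0 (- Q)) **
                                  vstack (\<Psi> (\<i> * of_real (\<omega> k)) b) (mat 1)) *v v)))) = 0} = {0})) \<and>
         (exponentially_stable a b H T \<longleftrightarrow>
           (\<forall>\<omega> :: nat \<Rightarrow> real.
             {v. liminf (\<lambda>k. ereal (norm (\<Q> (\<i> * of_real (\<omega> k)) *v v))) = 0} = {0}))"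
proof -
  interpret phs_semigroup a b m P0 P1 H WB \<Psi> T
    by standard (use assms in auto)
  show ?thesis
    \<comment> \<open>With the quadratic term rewritten to 0, the sets in (ii) and (iii) coincide,
      so one equivalence serves both.\<close>
    unfolding Q_eq calQ_eq quadratic_form_zero bounded_bilinear.zero_right[OF bounded_bilinear_cdot]
    using exponentially_stable_iff_coercive coercive_iff_liminf by simp
qed

end
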